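(* Let $(W,S)$ be a finite irreducible Coxeter system of type $\mathrm{A}$ or of type $\mathrm{D}$, with $S=\{s_a\}$ indexed, and with $J$ the subset of the set of relations of $W$ specified in the context. Let $\Sigma=\{\Sigma_i \mid i\in I\}$ be an admissible partition of $S$, and let $(X,T)$, with $T=\{t_i=s_{\Sigma_i}\mid i\in I\}$ and $X=\langle T\rangle$, be the Coxeter system that $\Sigma$ embeds in $(W,S)$. Put $$K=\{(t_it_j)^{m(t_i,t_j)} \mid \text{for all } s_a\in\Sigma_i \text{ and for all } s_b\in\Sigma_j,\ (s_as_b)^{m(s_a,s_b)}\in J\}.$$ For $x\in X$, let $\mathcal{T}_X(x)$ be the subset of the set of tilings $\mathcal{T}_W(x)$ corresponding to $\Sigma$-consistent reduced words of $x$. Then there exists a bijection between $\mathcal{R}_{X,K}(x)$ and $\mathcal{T}_X(x)$.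
   Context: **Reduced words.** For a Coxeter system $(W,S)$ with length function $\ell$, a reduced word for $w\in W$ is an expression $w=s_{i_1}\cdots s_{i_\ell}$ with $s_{i_j}\in S$ and $\ell=\ell(w)$. For a subset $J$ of the set of defining relations $(rs)^{m(r,s)}=1$ ($r\neq s$ in $S$), the relation being denoted by $(rs)^{m(r,s)}$, two reduced words for $w$ are $J$-equivalent if one can be obtained from the other by a sequence of replacements of a consecutive alternating subword $srs\cdots$ (of $m(r,s)$ letters) by $rsr\cdots$ ($m(r,s)$ letters), each corresponding to a relation in $J$. $\mathcal{R}_{W,J}(w)$ denotes the set of $J$-equivalence classes of reduced words for $w$; $\mathcal{R}_{X,K}(x)$ is defined in the same way for the Coxeter system $(X,T)$. **Admissible partitions.** Let $\Sigma=\{\Sigma_i\mid i\in I\}$ be a partition of $S$ such that each $W_{\Sigma_i}=\langle\Sigma_i\rangle$ is finite. Put $s_{\Sigma_i}=\prod_{s\in\Sigma_i}s$, for some understood ordering of $\Sigma_i$, when the elements of $\Sigma_i$ pairwise commute; otherwise $s_{\Sigma_i}$ is the longest element of $W_{\Sigma_i}$. Put $T=\{s_{\Sigma_i}\mid i\in I\}$ and $X=\langle T\rangle$. $\Sigma$ is admissible if for all $i\in I$ and all $w\in X$, either $\Sigma_i\subseteq D_R(w)$ or $\Sigma_i\subseteq S\setminus D_R(w)$, where $D_R(w)=\{s\in S\mid \ell(ws)=\ell(w)-1\}$. It is known (Mühlherr) that then $(X,T)$ is a Coxeter system embedded in $(W,S)$ in such a way that reduced words in $X$ correspond to reduced words in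 $W$. A word over $S$ is $\Sigma$-consistent if it can be partitioned in the form $x_1x_2\cdots x_k$ where each $x_j$ is a reduced word for some $s_{\Sigma_i}$. **Type A.** $W=\mathrm{Sym}(n)$, $s_i=(i,i+1)$ for $1\le i\le n-1$, $J=\{(s_is_j)^2\mid |i-j|\ge 2\}$. For $w\in W$, $Y(w)$ is the (possibly degenerate) $2n$-gon with unit sides and top vertex $M$ such that the first $n$ edges anticlockwise from $M$ are labelled $1,\dots,n$ consecutively and form half of a regular $2n$-gon, and the $i$-th edge clockwise from $M$ is a translate of the edge labelled $w^{-1}(i)$. The right-hand path is denoted $B(w)$; $B(\mathrm{id})$ is the left-hand path. $\mathcal{T}_W(w)$ is the set of tilings of $Y(w)$ by rhombi (coverings by rhombi that intersect only on their boundaries). **Type D.** $W$ of type $\mathrm{D}_n$ acts on $\{\pm1,\dots,\pm n\}$ with $s_1=(1,-2)(2,-1)$, $s_2=(1,2)(-1,-2)$, $s_i=(i-1,i)(-(i-1),-i)$ for $3\le i\le n$ (so in the Coxeter diagram nodes $1$ and $2$ are both joined to $3$, and $3,4,\dots,n$ is a path). $J$ consists of all $(s_is_j)^2$ with $|i-j|\ge2$, excluding $(s_1s_3)^2$; so $J$ is the set of all commutation relations of $W$ other than $(s_1s_2)^2$. For $w\in W$, $Y(w)$ is a $4n$-gon with unit edges, top vertex $U$ and bottom vertex $L$: the left path from $U$ down to $L$ is convex, symmetric about the horizontal line through its middle vertex, with edges labelled $n,n-1,\dots,1,-1,\dots,-n$ in this order, each edge making an angle greater than $\pi/3$ with the horizontal;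 the right path $B(w)$, read from $L$ upwards, has edges in positions $-n,\dots,-1,1,\dots,n$, the edge in position $i$ having the same length as, and being parallel to, the left edge labelled $w^{-1}(i)$. A megatile is an octagon with unit edges, with top and bottom vertices on a vertical line, whose first four edges $E$ anticlockwise from the top vertex are symmetric about the horizontal line through the middle vertex, and whose remaining edges are obtained from $E$ by transposing its first and second edges and its third and fourth edges, and then reflecting in the vertical line through the top and bottom vertices. $\mathcal{T}_W(w)$ is the set of tilings of $Y(w)$ by rhombi and megatiles. **Correspondence of words and tilings.** Elnitsky proved that, in both types, for every $w\in W$ there is a bijection between $\mathcal{R}_{W,J}(w)$ and $\mathcal{T}_W(w)$; a tiling corresponds to a reduced word if it is the image of the class of that word. Concretely (permutations composed from right to left), a reduced word $w=s_{i_1}\cdots s_{i_\ell}$ gives the elements $u_k=s_{i_{\ell-k+1}}\cdots s_{i_\ell}$ ($0\le k\le \ell$), hence paths $B(u_0)=B(\mathrm{id}),\dots,B(u_\ell)=B(w)$ in $Y(w)$, and the tiling consists of the tiles bounded by consecutive paths: in type A a rhombus for each letter; in type D a megatile for $s_1$ and a pair of rhombi, mirror images in a horizontal line up to position, for each $s_i$ with $i\ge2$.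
   Formalization: In a Σ-consistent word each factor x_j must also be J-equivalent to a fixed chosen reduced word for s_{Σ_i}; without this the claim fails (A_2, Σ={{s_1,s_2}}, x=s_1s_2s_1: one class, two tilings). *)

theory Defs
  imports
    "HOL-Analysis.Analysis"
    "HOL-Algebra.Sym_Groups"
    "HOL-Algebra.Multiplicative_Group"
    "HOL-Library.Disjoint_Sets"
begin

section \<open>Words in a group with a distinguished set of generators\<close>

text \<open>A word is a list of group elements.  Everything in this section applies both to
  \<open>(W, S)\<close> and to \<open>(X, T)\<close>.\<close>

definition word_prod :: "('g, 'b) monoid_scheme \<Rightarrow> 'g list \<Rightarrow> 'g" where
  "word_prod G ws = foldr (\<lambda>a b. a \<otimes>\<^bsub>G\<^esub> b) ws \<one>\<^bsub>G\<^esub>"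

definition word_length :: "('g, 'b) monoid_scheme \<Rightarrow> 'g set \<Rightarrow> 'g \<Rightarrow> nat" where
  "word_length G S w = (LEAST k. \<exists>ws \<in> lists S. length ws = k \<and> word_prod G ws = w)"

definition reduced_words :: "('g, 'b) monoid_scheme \<Rightarrow> 'g set \<Rightarrow> 'g \<Rightarrow> 'g list set" where
  "reduced_words G S w =
     {ws \<in> lists S. word_prod G ws = w \<and> length ws = word_length G S w}"

fun alternating :: "'g \<Rightarrow> 'g \<Rightarrow> nat \<Rightarrow> 'g list" where
  "alternating r s 0 = []"
| "alternating r s (Suc m) = r # alternating s r m"

text \<open>The relation \<open>(rs)\<^bsup>m(r,s)\<^esup>\<close> is encoded as the unordered pair \<open>{r, s}\<close>, since
  \<open>m(r,s) = m(s,r)\<close> is the order of \<open>rs\<close> and so is determined by the group.\<close>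

definition braid_moves ::
  "('g, 'b) monoid_scheme \<Rightarrow> 'g set set \<Rightarrow> ('g list \<times> 'g list) set" where
  "braid_moves G J =
     {(u @ alternating r s m @ v, u @ alternating s r m @ v) | u v r s m.
        {r, s} \<in> J \<and> m = group.ord G (r \<otimes>\<^bsub>G\<^esub> s)}"

definition word_equiv ::
  "('g, 'b) monoid_scheme \<Rightarrow> 'g set \<Rightarrow> 'g set set \<Rightarrow> 'g \<Rightarrow> ('g list \<times> 'g list) set" where
  "word_equiv G S J w =
     {(u, v). u \<in> reduced_words G S w \<and> v \<in> reduced_words G S w \<and> (u, v) \<in> (braid_moves G J)\<^sup>*}"

definition word_classes ::
  "('g, 'b) monoid_scheme \<Rightarrow> 'g set \<Rightarrow> 'g set set \<Rightarrow> 'g \<Rightarrow> 'g list set set" where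
  "word_classes G S J w = reduced_words G S w // word_equiv G S J w"

definition right_descents :: "('g, 'b) monoid_scheme \<Rightarrow> 'g set \<Rightarrow> 'g \<Rightarrow> 'g set" where
  "right_descents G S w = {s \<in> S. word_length G S (w \<otimes>\<^bsub>G\<^esub> s) + 1 = word_length G S w}"


section \<open>Admissible partitions\<close>

definition pairwise_commuting :: "('g, 'b) monoid_scheme \<Rightarrow> 'g set \<Rightarrow> bool" where
  "pairwise_commuting G P \<longleftrightarrow> (\<forall>s\<in>P. \<forall>t\<in>P. s \<otimes>\<^bsub>G\<^esub> t = t \<otimes>\<^bsub>G\<^esub> s)"

definition longest_element :: "('g, 'b) monoid_scheme \<Rightarrow> 'g set \<Rightarrow> 'g" where
  "longest_element G P =
     (THE w. w \<in> generate G P \<and> (\<forall>v \<in> generate G P. word_length G P v \<le> word_length G P w))"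

text \<open>An understood expression \<open>e P\<close> is chosen for each block \<open>P\<close>: an ordering of \<open>P\<close> if the
  elements of \<open>P\<close> commute, and a reduced word for the longest element otherwise.  The group
  element \<open>block_elt G e P\<close> does not depend on this choice.\<close>

definition understood_expression :: "('g, 'b) monoid_scheme \<Rightarrow> 'g set \<Rightarrow> 'g list \<Rightarrow> bool" where
  "understood_expression G P ws \<longleftrightarrow>
     (if pairwise_commuting G P then distinct ws \<and> set ws = P
      else ws \<in> reduced_words G P (longest_element G P))"

definition block_elt :: "('g, 'b) monoid_scheme \<Rightarrow> ('g set \<Rightarrow> 'g list) \<Rightarrow> 'g set \<Rightarrow> 'g" where
  "block_elt G e P =
     (if pairwise_commuting G P then word_prod G (e P) else longest_element G P)"

definition block_gens ::
  "('g, 'b) monoid_scheme \<Rightarrow> ('g set \<Rightarrow> 'g list) \<Rightarrow> 'g set set \<Rightarrow> 'g set" where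
  "block_gens G e \<Sigma> = block_elt G e ` \<Sigma>"

definition block_group ::
  "('g, 'b) monoid_scheme \<Rightarrow> ('g set \<Rightarrow> 'g list) \<Rightarrow> 'g set set \<Rightarrow> ('g, 'b) monoid_scheme" where
  "block_group G e \<Sigma> = G\<lparr>carrier := generate G (block_gens G e \<Sigma>)\<rparr>"

definition admissible_partition ::
  "('g, 'b) monoid_scheme \<Rightarrow> 'g set \<Rightarrow> ('g set \<Rightarrow> 'g list) \<Rightarrow> 'g set set \<Rightarrow> bool" where
  "admissible_partition G S e \<Sigma> \<longleftrightarrow>
     partition_on S \<Sigma> \<and>
     (\<forall>P\<in>\<Sigma>. finite (generate G P)) \<and>
     (\<forall>P\<in>\<Sigma>. understood_expression G P (e P)) \<and>
     (\<forall>P\<in>\<Sigma>. \<forall>w \<in> carrier (block_group G e \<Sigma>).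
        P \<subseteq> right_descents G S w \<or> P \<subseteq> S - right_descents G S w)"

definition block_relations ::
  "('g, 'b) monoid_scheme \<Rightarrow> ('g set \<Rightarrow> 'g list) \<Rightarrow> 'g set set \<Rightarrow> 'g set set \<Rightarrow> 'g set set" where
  "block_relations G e J \<Sigma> =
     {{block_elt G e P, block_elt G e Q} | P Q.
        P \<in> \<Sigma> \<and> Q \<in> \<Sigma> \<and> P \<noteq> Q \<and> (\<forall>a\<in>P. \<forall>b\<in>Q. {a, b} \<in> J)}"

text \<open>Each factor is a reduced word for some block element, namely the understood expression up
  to \<open>J\<close>-equivalence.  The last clause has no effect when all reduced words of the block element
  are \<open>J\<close>-equivalent.  Without it, different expressions of one and the same generator in \<open>T\<close>
  give different tilings: for the block \<open>{s\<^sub>1, s\<^sub>2}\<close>, take the words \<open>s\<^sub>1s\<^sub>2s\<^sub>1\<close> and \<open>s\<^sub>2s\<^sub>1s\<^sub>2\<close>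
  in type A, and \<open>s\<^sub>1s\<^sub>2\<close> and \<open>s\<^sub>2s\<^sub>1\<close> in type D.\<close>

definition consistent_word ::
  "('g, 'b) monoid_scheme \<Rightarrow> 'g set \<Rightarrow> 'g set set \<Rightarrow> ('g set \<Rightarrow> 'g list) \<Rightarrow> 'g set set
     \<Rightarrow> 'g list \<Rightarrow> bool" where
  "consistent_word G S J e \<Sigma> ws \<longleftrightarrow>
     (\<exists>xs. ws = concat xs \<and>
        (\<forall>y \<in> set xs. \<exists>P\<in>\<Sigma>. y \<in> reduced_words G S (block_elt G e P) \<and>
           (e P, y) \<in> word_equiv G S J (block_elt G e P)))"

text \<open>\<open>\<T> x\<close> stands for the set of all tilings of \<open>Y(x)\<close>, and \<open>tl_of r\<close> for the tiling
  corresponding to the reduced word \<open>r\<close>.\<close>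

definition consistent_tilings ::
  "('g, 'b) monoid_scheme \<Rightarrow> 'g set \<Rightarrow> 'g set set \<Rightarrow> ('g set \<Rightarrow> 'g list) \<Rightarrow> 'g set set
     \<Rightarrow> ('g \<Rightarrow> 't set) \<Rightarrow> ('g list \<Rightarrow> 't) \<Rightarrow> 'g \<Rightarrow> 't set" where
  "consistent_tilings G S J e \<Sigma> \<T> tl_of x =
     {\<tau> \<in> \<T> x. \<exists>r \<in> reduced_words G S x. consistent_word G S J e \<Sigma> r \<and> \<tau> = tl_of r}"


section \<open>Polygons and tilings\<close>

text \<open>A polygonal path is given by its starting point and the list of its edge vectors.\<close>

definition path_vertex :: "complex \<Rightarrow> complex list \<Rightarrow> nat \<Rightarrow> complex" where
  "path_vertex p ds k = p + sum_list (take k ds)"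

definition polyline :: "complex \<Rightarrow> complex list \<Rightarrow> complex set" where
  "polyline p ds = (\<Union>k<length ds. closed_segment (path_vertex p ds k) (path_vertex p ds (Suc k)))"

text \<open>The (possibly degenerate) polygon bounded by two polygonal paths from \<open>p\<close> with a common
  endpoint.\<close>

definition polygon_boundary :: "complex \<Rightarrow> complex list \<Rightarrow> complex list \<Rightarrow> complex set" where
  "polygon_boundary p ds es = polyline p ds \<union> polyline p es"

definition polygon :: "complex \<Rightarrow> complex list \<Rightarrow> complex list \<Rightarrow> complex set" where
  "polygon p ds es = polygon_boundary p ds es \<union> inside (polygon_boundary p ds es)"

text \<open>Where the two paths share an edge the polygon is degenerate and has no tile there, so only
  the part of the polygon off its boundary has to be covered.\<close>

definition tilings_by ::
  "complex set set \<Rightarrow> complex \<Rightarrow> complex list \<Rightarrow> complex list \<Rightarrow> complex set set set" where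
  "tilings_by \<P> p ds es =
     {\<tau>. finite \<tau> \<and> \<tau> \<subseteq> \<P> \<and>
         \<Union>\<tau> \<union> polygon_boundary p ds es = polygon p ds es \<and>
         (\<forall>A\<in>\<tau>. \<forall>B\<in>\<tau>. A \<noteq> B \<longrightarrow> A \<inter> B \<subseteq> frontier A \<inter> frontier B)}"

definition unit_rhombi :: "complex set set" where
  "unit_rhombi =
     {polygon p [u, v] [v, u] | p u v. norm u = 1 \<and> norm v = 1 \<and> u \<noteq> v \<and> u \<noteq> - v}"

text \<open>The edges \<open>E\<close> of a megatile are read from its top vertex \<open>p\<close> downwards.  Reflection in a
  vertical line is \<open>z \<mapsto> - cnj z\<close> on edge vectors; reflection in a horizontal line reverses the path
  and sends the edge vector \<open>z\<close>, again read downwards, to \<open>- cnj z\<close>.  The remaining conditions say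
  that the figure is a simple octagon with eight proper corners, highest vertex \<open>p\<close>, and \<open>E\<close> on its
  left-hand side.\<close>

definition megatiles :: "complex set set" where
  "megatiles =
     {polygon p E F | p E F e1 e2.
        E = [e1, e2, - cnj e2, - cnj e1] \<and>
        F = map (\<lambda>z. - cnj z) [E ! 1, E ! 0, E ! 3, E ! 2] \<and>
        norm e1 = 1 \<and> norm e2 = 1 \<and>
        Im e1 < 0 \<and> Im e2 < 0 \<and> Re (e1 + e2) < 0 \<and>
        e1 \<noteq> e2 \<and> Re e1 \<noteq> 0 \<and> Re e2 \<noteq> 0 \<and>
        polyline p E \<inter> polyline p F = {p, p + sum_list E}}"

text \<open>The tile between two paths starting at the origin with edge vectors \<open>ds\<close> and \<open>es\<close> that
  differ in the \<open>m\<close> consecutive edges from index \<open>a\<close> on.\<close>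

definition tile_between :: "complex list \<Rightarrow> complex list \<Rightarrow> nat \<Rightarrow> nat \<Rightarrow> complex set" where
  "tile_between ds es a m =
     polygon (path_vertex 0 ds a) (take m (drop a ds)) (take m (drop a es))"


section \<open>Type A\<close>

definition gen_A :: "nat \<Rightarrow> nat \<Rightarrow> nat" where
  "gen_A i = Transposition.transpose i (i + 1)"

definition gens_A :: "nat \<Rightarrow> (nat \<Rightarrow> nat) set" where
  "gens_A n = gen_A ` {1..n - 1}"

definition rels_A :: "nat \<Rightarrow> (nat \<Rightarrow> nat) set set" where
  "rels_A n = {{gen_A i, gen_A j} | i j. i \<in> {1..n - 1} \<and> j \<in> {1..n - 1} \<and> i + 2 \<le> j}"

text \<open>The edge labelled \<open>j\<close>, read downwards from the top vertex \<open>M = 0\<close>; the regular \<open>2n\<close>-gon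
  stands on the vertex opposite to \<open>M\<close>.\<close>

definition edge_A :: "nat \<Rightarrow> nat \<Rightarrow> complex" where
  "edge_A n j = cis (pi + (2 * real j - 1) * pi / (2 * real n))"

definition path_A :: "nat \<Rightarrow> (nat \<Rightarrow> nat) \<Rightarrow> complex list" where
  "path_A n w = map (\<lambda>i. edge_A n (inv_into UNIV w i)) [1..<n + 1]"

definition tilings_A :: "nat \<Rightarrow> (nat \<Rightarrow> nat) \<Rightarrow> complex set set set" where
  "tilings_A n w = tilings_by unit_rhombi 0 (path_A n id) (path_A n w)"

definition tiles_A :: "nat \<Rightarrow> nat \<Rightarrow> (nat \<Rightarrow> nat) \<Rightarrow> complex set set" where
  "tiles_A n i u = {tile_between (path_A n u) (path_A n (gen_A i \<circ> u)) (i - 1) 2}"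

definition tiling_of_A :: "nat \<Rightarrow> (nat \<Rightarrow> nat) list \<Rightarrow> complex set set" where
  "tiling_of_A n r =
     \<Union>{tiles_A n i (word_prod (sym_group n) vs) | us i vs.
          i \<in> {1..n - 1} \<and> r = us @ gen_A i # vs}"


section \<open>Type D\<close>

definition gen_D :: "nat \<Rightarrow> int \<Rightarrow> int" where
  "gen_D i =
     (if i = 1 then Transposition.transpose 1 (- 2) \<circ> Transposition.transpose 2 (- 1)
      else Transposition.transpose (int i - 1) (int i) \<circ>
        Transposition.transpose (- (int i - 1)) (- int i))"

definition gens_D :: "nat \<Rightarrow> (int \<Rightarrow> int) set" where
  "gens_D n = gen_D ` {1..n}"

definition signed_perms :: "nat \<Rightarrow> (int \<Rightarrow> int) monoid" where
  "signed_perms n =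
     \<lparr>carrier = {w. w permutes ({- int n..int n} - {0}) \<and> (\<forall>i. w (- i) = - w i)},
      mult = (\<circ>), one = id\<rparr>"

definition group_D :: "nat \<Rightarrow> (int \<Rightarrow> int) monoid" where
  "group_D n = (signed_perms n)\<lparr>carrier := generate (signed_perms n) (gens_D n)\<rparr>"

definition rels_D :: "nat \<Rightarrow> (int \<Rightarrow> int) set set" where
  "rels_D n =
     {{gen_D i, gen_D j} | i j.
        i \<in> {1..n} \<and> j \<in> {1..n} \<and> i + 2 \<le> j \<and> (i, j) \<noteq> (1, 3)}"

text \<open>\<open>\<theta> i\<close> is the angle which the edge labelled \<open>i > 0\<close>, read upwards, makes with the horizontal;
  by symmetry of the left path the edge labelled \<open>- i\<close> has angle \<open>\<pi> - \<theta> i\<close>.  The left path is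
  (strictly) convex precisely if \<open>\<theta>\<close> is decreasing with values below \<open>\<pi>/2\<close>.\<close>

definition angles_D :: "nat \<Rightarrow> (nat \<Rightarrow> real) \<Rightarrow> bool" where
  "angles_D n \<theta> \<longleftrightarrow>
     (\<forall>i\<in>{1..n}. pi / 3 < \<theta> i \<and> \<theta> i < pi / 2) \<and>
     (\<forall>i\<in>{1..n}. \<forall>j\<in>{1..n}. i < j \<longrightarrow> \<theta> j < \<theta> i)"

definition edge_D :: "(nat \<Rightarrow> real) \<Rightarrow> int \<Rightarrow> complex" where
  "edge_D \<theta> j = (if 0 < j then cis (\<theta> (nat j)) else cis (pi - \<theta> (nat (- j))))"

text \<open>All paths are read upwards from the bottom vertex \<open>L = 0\<close>; the edge in position \<open>j\<close> has index
  \<open>n + j\<close> if \<open>j < 0\<close> and \<open>n + j - 1\<close> if \<open>j > 0\<close>.\<close>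

definition positions_D :: "nat \<Rightarrow> int list" where
  "positions_D n = [- int n..-1] @ [1..int n]"

definition path_D :: "nat \<Rightarrow> (nat \<Rightarrow> real) \<Rightarrow> (int \<Rightarrow> int) \<Rightarrow> complex list" where
  "path_D n \<theta> w = map (\<lambda>i. edge_D \<theta> (inv_into UNIV w i)) (positions_D n)"

definition tilings_D :: "nat \<Rightarrow> (nat \<Rightarrow> real) \<Rightarrow> (int \<Rightarrow> int) \<Rightarrow> complex set set set" where
  "tilings_D n \<theta> w =
     tilings_by (unit_rhombi \<union> megatiles) 0 (path_D n \<theta> id) (path_D n \<theta> w)"

text \<open>\<open>s\<^sub>1\<close> changes the edges in positions \<open>-2, -1, 1, 2\<close>; for \<open>i \<ge> 2\<close>, \<open>s\<^sub>i\<close> changes those in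
  positions \<open>-i, -(i-1)\<close> and \<open>i-1, i\<close>.\<close>

definition tiles_D :: "nat \<Rightarrow> (nat \<Rightarrow> real) \<Rightarrow> nat \<Rightarrow> (int \<Rightarrow> int) \<Rightarrow> complex set set" where
  "tiles_D n \<theta> i u =
     (let ds = path_D n \<theta> u; es = path_D n \<theta> (gen_D i \<circ> u)
      in if i = 1 then {tile_between ds es (n - 2) 4}
         else {tile_between ds es (n - i) 2, tile_between ds es (n + i - 2) 2})"

definition tiling_of_D :: "nat \<Rightarrow> (nat \<Rightarrow> real) \<Rightarrow> (int \<Rightarrow> int) list \<Rightarrow> complex set set" where
  "tiling_of_D n \<theta> r =
     \<Union>{tiles_D n \<theta> i (word_prod (group_D n) vs) | us i vs.
          i \<in> {1..n} \<and> r = us @ gen_D i # vs}"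

end

theory Submission
  imports Defs
begin

text \<open>Ascents in types A and D satisfy Bourbaki's criterion for a Coxeter system, so words obey the
  exchange condition.  If \<open>P\<close> consists of descents of \<open>s\<^sub>Q v\<close> but not of \<open>v\<close>, then
  admissibility makes conjugation by \<open>v\<close> carry \<open>P\<close> onto \<open>Q\<close>, hence \<open>s\<^sub>Q v = v s\<^sub>P\<close>: this is an
  exchange condition for \<open>(X, T)\<close>, by which a word over \<open>T\<close> is reduced exactly if its expansion over
  \<open>S\<close> is.  Equivalence under commutation relations is detected by the projections onto pairs of
  non-commuting letters, and these projections of an expansion determine those of the word over \<open>T\<close>.

  All paths are graphs of functions of the height.  A reduced word sweeps such a graph monotonically
  across the polygon, and its tiles are the regions between consecutive graphs.  The first tile of
  one word lies along the left boundary; any other word with the same tiling sweeps it by the same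
  letter, after letters that commute with it.  So the tiling determines the projections.\<close>

section \<open>Words and the exchange condition\<close>


text \<open>A chain of J-moves between the expansions of two words over T passes through words that
  need not be expansions of anything, so J-equivalence cannot be pulled back to K-equivalence move
  by move. Projections avoid the intermediate words, since they compare only the two ends. This is
  why the geometric side is made to deliver equal projections and not a chain of moves.

  Blocks may differ in length, so length over S does not determine length over T. The exchange
  condition for T therefore records that the deleted block is as long as the block by which one
  multiplies; deletion then keeps lengths over S additive.

  The two sides of Y(x) may share edges or touch in vertices, so the boundary is in general no
  Jordan curve. As both sides are graphs over the height, the bounded part of the complement can be
  found directly, by splitting the complement of the boundary into two open sets.\<close>

lemma word_prod_Nil [simp]: "word_prod G [] = \<one>\<^bsub>G\<^esub>"
  by (simp add: word_prod_def)

lemma word_prod_Cons [simp]: "word_prod G (a # ws) = a \<otimes>\<^bsub>G\<^esub> word_prod G ws"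
  by (simp add: word_prod_def)

context group begin

lemma word_prod_closed [simp]: "ws \<in> lists (carrier G) \<Longrightarrow> word_prod G ws \<in> carrier G"
  by (induction ws) auto

lemma word_prod_append:
  "us \<in> lists (carrier G) \<Longrightarrow> vs \<in> lists (carrier G) \<Longrightarrow>
     word_prod G (us @ vs) = word_prod G us \<otimes> word_prod G vs"
  by (induction us) (auto simp: m_assoc)

lemma word_prod_in_generate: "ws \<in> lists Q \<Longrightarrow> word_prod G ws \<in> generate G Q"
  by (induction ws) (auto intro: generate.intros)

text \<open>An involution is its own inverse, so the inverse clause of \<open>generate\<close>
  yields only one-letter words again.\<close>

lemma generate_involutions:
  assumes "Q \<subseteq> carrier G" "\<And>s. s \<in> Q \<Longrightarrow> s \<otimes> s = \<one>"
  shows "generate G Q = word_prod G ` lists Q"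
proof
  show "word_prod G ` lists Q \<subseteq> generate G Q"
    using word_prod_in_generate by auto
  show "generate G Q \<subseteq> word_prod G ` lists Q"
  proof
    fix x assume "x \<in> generate G Q"
    thus "x \<in> word_prod G ` lists Q"
    proof induction
      case one
      show ?case by (rule image_eqI[of _ _ "[]"]) auto
    next
      case (incl h)
      thus ?case using assms(1) by (intro image_eqI[of _ _ "[h]"]) auto
    next
      case (inv h)
      hence "inv h = h" using assms by (intro inv_equality) auto
      thus ?case using inv assms(1) by (intro image_eqI[of _ _ "[h]"]) auto
    next
      case (eng h1 h2)
      then obtain us vs where "us \<in> lists Q" "vs \<in> lists Q"
        "h1 = word_prod G us" "h2 = word_prod G vs" by auto
      moreover have "lists Q \<subseteq> lists (carrier G)" using assms(1) by auto
      ultimately show ?case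
        by (intro image_eqI[of _ _ "us @ vs"]) (use assms(1) in \<open>auto simp: word_prod_append subset_iff\<close>)
    qed
  qed
qed

end

text \<open>The predicate \<open>pos w s\<close> stands for \<open>w \<alpha>\<^sub>s > 0\<close>, where \<open>\<alpha>\<^sub>s\<close> is the simple root of \<open>s\<close>.
  The last two assumptions are Bourbaki's criterion (Lie IV.1.7) for a Coxeter system.\<close>

locale sign_group = group G for G (structure) +
  fixes S :: "'a set" and pos :: "'a \<Rightarrow> 'a \<Rightarrow> bool"
  assumes gens_carrier: "S \<subseteq> carrier G"
    and gens_square: "s \<in> S \<Longrightarrow> s \<otimes> s = \<one>"
    and pos_one: "s \<in> S \<Longrightarrow> pos \<one> s"
    and pos_flip: "w \<in> generate G S \<Longrightarrow> s \<in> S \<Longrightarrow> pos w s \<Longrightarrow> \<not> pos (w \<otimes> s) s"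
    and pos_switch: "w \<in> generate G S \<Longrightarrow> s \<in> S \<Longrightarrow> t \<in> S \<Longrightarrow> pos w s \<Longrightarrow> \<not> pos (t \<otimes> w) s \<Longrightarrow>
           t \<otimes> w = w \<otimes> s"
begin

abbreviation len :: "'a \<Rightarrow> nat" where "len \<equiv> word_length G S"
abbreviation prod_of :: "'a list \<Rightarrow> 'a" where "prod_of \<equiv> word_prod G"
abbreviation W :: "'a set" where "W \<equiv> generate G S"

text \<open>Restriction to fewer generators keeps the axioms with the same \<open>pos\<close>, so a
  parabolic subgroup inherits the whole theory and shares its ascents with the big group. The
  interpretations \<open>Q\<close> and \<open>P\<close> below rest on this.\<close>

lemma sign_group_subset:
  assumes "Q \<subseteq> S" shows "sign_group G Q pos"
proof -
  have "generate G Q \<subseteq> generate G S" using assms by (rule mono_generate)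
  thus ?thesis
    using assms gens_carrier gens_square pos_one pos_flip pos_switch
    by unfold_locales (auto simp: subset_iff)
qed

lemma gen_closed [simp]: "s \<in> S \<Longrightarrow> s \<in> carrier G"
  using gens_carrier by auto

lemma W_closed: "w \<in> W \<Longrightarrow> w \<in> carrier G"
  using generate_in_carrier[OF gens_carrier] .

lemma gen_W [simp]: "s \<in> S \<Longrightarrow> s \<in> W" by (rule generate.incl)

lemma W_subgroup: "subgroup W G"
  by (rule generate_is_subgroup[OF gens_carrier])

lemma inv_gen [simp]: "s \<in> S \<Longrightarrow> inv s = s"
  by (intro inv_equality) (auto simp: gens_square)

lemma gen_cancel [simp]: "s \<in> S \<Longrightarrow> w \<in> carrier G \<Longrightarrow> w \<otimes> s \<otimes> s = w"
  by (simp add: m_assoc gens_square)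

lemma gen_cancel_left [simp]: "s \<in> S \<Longrightarrow> w \<in> carrier G \<Longrightarrow> s \<otimes> (s \<otimes> w) = w"
  by (simp add: m_assoc[symmetric] gens_square)

lemma word_closed: "ws \<in> lists S \<Longrightarrow> ws \<in> lists (carrier G)"
  using gens_carrier by auto

lemma prod_of_closed [simp]: "ws \<in> lists S \<Longrightarrow> prod_of ws \<in> carrier G"
  by (intro word_prod_closed word_closed)

lemma prod_of_append:
  "us \<in> lists S \<Longrightarrow> vs \<in> lists S \<Longrightarrow> prod_of (us @ vs) = prod_of us \<otimes> prod_of vs"
  by (intro word_prod_append word_closed)

lemma prod_of_snoc: "us \<in> lists S \<Longrightarrow> s \<in> S \<Longrightarrow> prod_of (us @ [s]) = prod_of us \<otimes> s"
  by (simp add: prod_of_append)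

lemma prod_of_W: "ws \<in> lists S \<Longrightarrow> prod_of ws \<in> W"
  by (rule word_prod_in_generate)

lemma W_words: "W = prod_of ` lists S"
  by (rule generate_involutions[OF gens_carrier gens_square])

lemma prod_of_rev: "ws \<in> lists S \<Longrightarrow> prod_of (rev ws) = inv (prod_of ws)"
proof (induction ws)
  case (Cons a ws)
  moreover from this have "rev ws \<in> lists S" by auto
  ultimately show ?case by (simp add: prod_of_snoc inv_mult_group)
qed simp

section \<open>Length and the exchange condition\<close>

lemma len_le: "ws \<in> lists S \<Longrightarrow> len (prod_of ws) \<le> length ws"
  unfolding word_length_def by (rule Least_le) auto

lemma ex_reduced:
  assumes "w \<in> W"
  obtains ws where "ws \<in> lists S" "prod_of ws = w" "length ws = len w"
proof -
  have "\<exists>k. \<exists>ws \<in> lists S. length ws = k \<and> prod_of ws = w"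
    using assms W_words by auto
  hence "\<exists>ws \<in> lists S. length ws = len w \<and> prod_of ws = w"
    unfolding word_length_def by (rule LeastI_ex)
  thus ?thesis using that by auto
qed

lemma len_one [simp]: "len \<one> = 0"
  using len_le[of "[]"] by simp

lemma len_zero: "w \<in> W \<Longrightarrow> len w = 0 \<Longrightarrow> w = \<one>"
  by (metis ex_reduced length_0_conv word_prod_Nil)

lemma len_mult: "v \<in> W \<Longrightarrow> w \<in> W \<Longrightarrow> len (v \<otimes> w) \<le> len v + len w"
  by (metis ex_reduced prod_of_append len_le length_append append_in_lists_conv)

lemma len_inv_le: "w \<in> W \<Longrightarrow> len (inv w) \<le> len w"
proof -
  assume "w \<in> W"
  then obtain ws where ws: "ws \<in> lists S" "prod_of ws = w" "length ws = len w"
    by (rule ex_reduced)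
  hence "len (prod_of (rev ws)) \<le> length (rev ws)" by (intro len_le) auto
  thus ?thesis using ws prod_of_rev by simp
qed

lemma inv_W [simp]: "w \<in> W \<Longrightarrow> inv w \<in> W"
  by (rule generate_m_inv_closed[OF gens_carrier])

lemma mult_W [simp]: "v \<in> W \<Longrightarrow> w \<in> W \<Longrightarrow> v \<otimes> w \<in> W"
  by (rule generate.eng)

lemma len_inv [simp]: "w \<in> W \<Longrightarrow> len (inv w) = len w"
  by (metis len_inv_le inv_W W_closed inv_inv le_antisym)

text \<open>Among the suffixes of the word, \<open>pos\<close> holds for the empty one and fails for
  the whole. At a letter \<open>t\<close> where it switches, \<open>pos_switch\<close> turns
  \<open>t \<otimes> prod_of vs\<close> into \<open>prod_of vs \<otimes> s\<close>, and this
  \<open>s\<close> cancels against the one multiplied on.\<close>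

lemma exchange:
  assumes "ws \<in> lists S" "s \<in> S" "\<not> pos (prod_of ws) s"
  obtains us t vs where "ws = us @ t # vs" "prod_of ws \<otimes> s = prod_of (us @ vs)"
    "pos (prod_of vs) s" "\<not> pos (t \<otimes> prod_of vs) s"
proof -
  have "\<exists>us t vs. ws = us @ t # vs \<and> prod_of ws \<otimes> s = prod_of (us @ vs) \<and>
    pos (prod_of vs) s \<and> \<not> pos (t \<otimes> prod_of vs) s"
    using assms
  proof (induction ws)
    case Nil thus ?case using pos_one by simp
  next
    case (Cons a ws)
    show ?case
    proof (cases "pos (prod_of ws) s")
      case True
      have "a \<otimes> prod_of ws = prod_of ws \<otimes> s"
        using Cons True by (intro pos_switch prod_of_W) auto
      hence "prod_of (a # ws) \<otimes> s = prod_of ([] @ ws)" using Cons by simp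
      thus ?thesis using True Cons by (intro exI[of _ "[]"]) auto
    next
      case False
      then obtain us t vs where *: "ws = us @ t # vs" "prod_of ws \<otimes> s = prod_of (us @ vs)"
        "pos (prod_of vs) s" "\<not> pos (t \<otimes> prod_of vs) s" using Cons by auto
      have "prod_of (a # ws) \<otimes> s = a \<otimes> (prod_of ws \<otimes> s)" using Cons by (simp add: m_assoc)
      also have "\<dots> = prod_of ((a # us) @ vs)" by (simp add: *(2))
      finally show ?thesis using * by (intro exI[of _ "a # us"]) auto
    qed
  qed
  thus ?thesis using that by blast
qed

text \<open>Exchange in a reduced word saves one letter; multiplying back by \<open>s\<close> shows
  that the length drops by no more.\<close>

lemma len_descent:
  assumes "w \<in> W" "s \<in> S" "\<not> pos w s"
  shows "Suc (len (w \<otimes> s)) = len w"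
proof -
  obtain ws where ws: "ws \<in> lists S" "prod_of ws = w" "length ws = len w"
    using assms(1) by (rule ex_reduced)
  then obtain us t vs where *: "ws = us @ t # vs" "prod_of ws \<otimes> s = prod_of (us @ vs)"
    using exchange assms by metis
  have "len (w \<otimes> s) \<le> length (us @ vs)" using * ws len_le[of "us @ vs"] by auto
  hence "Suc (len (w \<otimes> s)) \<le> len w" using ws * by auto
  moreover have "len w \<le> len (w \<otimes> s) + len s"
    using len_mult[of "w \<otimes> s" s] assms W_closed by simp
  moreover have "len s \<le> 1" using len_le[of "[s]"] assms by simp
  ultimately show ?thesis by simp
qed

lemma len_ascent:
  assumes "w \<in> W" "s \<in> S" "pos w s"
  shows "len (w \<otimes> s) = Suc (len w)"
  using len_descent[of "w \<otimes> s" s] pos_flip[of w s] assms W_closed by simp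

lemma pos_iff: "w \<in> W \<Longrightarrow> s \<in> S \<Longrightarrow> pos w s \<longleftrightarrow> len w < len (w \<otimes> s)"
  using len_ascent len_descent by fastforce

lemma len_gen: "s \<in> S \<Longrightarrow> len s = 1"
  using len_ascent[of \<one> s] pos_one[of s] by (simp add: generate.one)

lemma right_descents_iff: "w \<in> W \<Longrightarrow> s \<in> right_descents G S w \<longleftrightarrow> s \<in> S \<and> \<not> pos w s"
  using len_ascent len_descent by (fastforce simp: right_descents_def)

text \<open>Both lengths rise or fall by one according to the same predicate \<open>pos\<close>, so
  they agree along any word over \<open>Q\<close>.\<close>

lemma len_subset:
  assumes "Q \<subseteq> S" "w \<in> generate G Q"
  shows "word_length G Q w = len w"
proof -
  interpret Q: sign_group G Q pos using assms(1) by (rule sign_group_subset)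
  have sub: "generate G Q \<subseteq> W" using assms(1) by (rule mono_generate)
  obtain ws where "ws \<in> lists Q" "prod_of ws = w" using assms(2) Q.W_words by auto
  moreover have "ws \<in> lists Q \<Longrightarrow> word_length G Q (prod_of ws) = len (prod_of ws)"
  proof (induction ws rule: rev_induct)
    case (snoc s ws)
    hence s: "s \<in> Q" "s \<in> S" "prod_of ws \<in> generate G Q" "prod_of ws \<in> W" "ws \<in> lists Q"
      using assms(1) Q.prod_of_W sub by auto
    show ?case
    proof (cases "pos (prod_of ws) s")
      case True
      thus ?thesis using snoc s len_ascent Q.len_ascent by (simp add: Q.prod_of_snoc)
    next
      case False
      hence "Suc (len (prod_of ws \<otimes> s)) = Suc (word_length G Q (prod_of ws \<otimes> s))"
        using snoc s len_descent Q.len_descent by simp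
      thus ?thesis using s by (simp add: Q.prod_of_snoc)
    qed
  qed simp
  ultimately show ?thesis by blast
qed

lemma len_one_parabolic:
  assumes "Q \<subseteq> S" "z \<in> generate G Q" "len z = 1" shows "z \<in> Q"
proof -
  interpret Q: sign_group G Q pos using assms(1) by (rule sign_group_subset)
  obtain ws where ws: "ws \<in> lists Q" "prod_of ws = z" "length ws = 1"
    using Q.ex_reduced[OF assms(2)] len_subset[OF assms(1,2)] assms(3) by auto
  then obtain q where "ws = [q]" by (auto simp: length_Suc_conv)
  thus ?thesis using ws assms(1) by auto
qed

text \<open>Exchange in a word over \<open>Q\<close> puts \<open>w \<otimes> s\<close>, and hence
  \<open>s\<close>, into the parabolic subgroup, where an element of length one is a letter of
  \<open>Q\<close>.\<close>

lemma parabolic_descent: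
  assumes "Q \<subseteq> S" "s \<in> S" "w \<in> generate G Q" "\<not> pos w s"
  shows "s \<in> Q"
proof -
  interpret Q: sign_group G Q pos using assms(1) by (rule sign_group_subset)
  obtain ws where ws: "ws \<in> lists Q" "prod_of ws = w" using assms(3) Q.W_words by auto
  have wsS: "ws \<in> lists S" using ws assms(1) by auto
  obtain us t vs where *: "ws = us @ t # vs" "prod_of ws \<otimes> s = prod_of (us @ vs)"
    using exchange[OF wsS assms(2)] assms(4) ws by metis
  have "prod_of (us @ vs) \<in> generate G Q" using * ws by (intro Q.prod_of_W) auto
  hence "inv w \<otimes> (w \<otimes> s) \<in> generate G Q" using * ws assms(3) by auto
  moreover have "inv w \<otimes> (w \<otimes> s) = s"
    using assms Q.W_closed by (simp add: m_assoc[symmetric])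
  ultimately show ?thesis using len_one_parabolic[OF assms(1)] len_gen[OF assms(2)] by simp
qed

section \<open>Coset representatives of parabolic subgroups\<close>

lemma reduced_snoc:
  assumes "ws \<in> lists S" "s \<in> S" "length (ws @ [s]) = len (prod_of (ws @ [s]))"
  shows "len (prod_of ws) = length ws" "len (prod_of ws \<otimes> s) = Suc (length ws)"
proof -
  show *: "len (prod_of ws \<otimes> s) = Suc (length ws)" using assms by (simp add: prod_of_snoc)
  moreover have "len (prod_of ws \<otimes> s) \<le> Suc (len (prod_of ws))"
    using len_mult[of "prod_of ws" s] prod_of_W[OF assms(1)] len_gen assms(2) by simp
  ultimately show "len (prod_of ws) = length ws" using len_le[OF assms(1)] by simp
qed

text \<open>The letter deleted by the exchange cannot lie in \<open>ws\<close>, since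
  \<open>ws\<close> followed by \<open>s\<close> is reduced. So it lies in \<open>xs\<close>, and
  \<open>ws\<close> survives intact.\<close>

lemma exchange_append:
  assumes "xs \<in> lists S" "ws \<in> lists S" "s \<in> S" "\<not> pos (prod_of xs \<otimes> prod_of ws) s"
    and red: "len (prod_of ws \<otimes> s) = Suc (length ws)"
  obtains ys where "ys \<in> lists S" "length xs = Suc (length ys)"
    "prod_of xs \<otimes> prod_of ws \<otimes> s = prod_of ys \<otimes> prod_of ws"
proof -
  have l: "xs @ ws \<in> lists S" using assms by simp
  have "\<not> pos (prod_of (xs @ ws)) s" using assms by (simp add: prod_of_append)
  then obtain us t vs where *: "xs @ ws = us @ t # vs" "prod_of (xs @ ws) \<otimes> s = prod_of (us @ vs)"
    using exchange[OF l assms(3)] by metis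
  have uv: "us \<in> lists S" "vs \<in> lists S" using l unfolding *(1) by auto
  from * consider (a) ys where "xs = us @ t # ys" "vs = ys @ ws"
    | (b) ys where "us = xs @ ys" "ws = ys @ t # vs"
    by (auto simp: append_eq_append_conv2 append_eq_Cons_conv)
  thus ?thesis
  proof cases
    case (a ys)
    have ys: "us @ ys \<in> lists S" using assms(1) a by auto
    have "prod_of xs \<otimes> prod_of ws \<otimes> s = prod_of ((us @ ys) @ ws)"
      using *(2) a(2) assms prod_of_append[OF assms(1,2)] by simp
    thus ?thesis using that[OF ys] a prod_of_append[OF ys assms(2)] by simp
  next
    case (b ys)
    have ys: "ys @ vs \<in> lists S" using assms(2) b by auto
    have "prod_of xs \<otimes> (prod_of ws \<otimes> s) = prod_of (xs @ ys @ vs)"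
      using *(2) b(1) assms by (simp add: prod_of_append m_assoc)
    hence "prod_of ws \<otimes> s = prod_of (ys @ vs)"
      unfolding prod_of_append[OF assms(1) ys] using assms prod_of_closed[OF ys] by simp
    thus ?thesis using len_le[OF ys] red b by simp
  qed
qed

text \<open>If a letter of \<open>u\<close> lowered the length, \<open>exchange_append\<close> would
  delete a letter of \<open>x\<close> and leave a shorter element of the same coset.\<close>

lemma len_min_coset:
  assumes "Q \<subseteq> S" "x \<in> W" "\<And>v. v \<in> generate G Q \<Longrightarrow> len x \<le> len (x \<otimes> v)" "u \<in> generate G Q"
  shows "len (x \<otimes> u) = len x + len u"
proof -
  interpret Q: sign_group G Q pos using assms(1) by (rule sign_group_subset)
  have sub: "generate G Q \<subseteq> W" using assms(1) by (rule mono_generate)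
  obtain ws where ws: "ws \<in> lists Q" "prod_of ws = u" "length ws = len u"
    using Q.ex_reduced[OF assms(4)] len_subset[OF assms(1,4)] by metis
  have "ws \<in> lists Q \<Longrightarrow> length ws = len (prod_of ws) \<Longrightarrow>
     len (x \<otimes> prod_of ws) = len x + len (prod_of ws)"
  proof (induction ws rule: rev_induct)
    case Nil thus ?case using assms W_closed by simp
  next
    case (snoc s ws)
    hence s: "s \<in> Q" "s \<in> S" "ws \<in> lists Q" "ws \<in> lists S" "prod_of ws \<in> generate G Q" "prod_of ws \<in> W"
      using assms(1) Q.prod_of_W sub by auto
    note len0 = reduced_snoc(1)[OF s(4,2) snoc.prems(2)]
    note len1 = reduced_snoc(2)[OF s(4,2) snoc.prems(2)]
    have IH: "len (x \<otimes> prod_of ws) = len x + len (prod_of ws)" using snoc len0 s by simp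
    have "pos (x \<otimes> prod_of ws) s"
    proof (rule ccontr)
      assume neg: "\<not> pos (x \<otimes> prod_of ws) s"
      obtain xs where xs: "xs \<in> lists S" "prod_of xs = x" "length xs = len x"
        using assms(2) by (rule ex_reduced)
      obtain ys where ys: "ys \<in> lists S" "len x = Suc (length ys)" "x \<otimes> prod_of ws \<otimes> s = prod_of ys \<otimes> prod_of ws"
        using exchange_append[OF xs(1) s(4,2) _ len1] neg xs by metis
      hence "x \<otimes> prod_of ws \<otimes> s \<otimes> inv (prod_of ws) = prod_of ys"
        using s by (simp add: m_assoc)
      hence "prod_of ys = x \<otimes> (prod_of ws \<otimes> s \<otimes> inv (prod_of ws))"
        using s assms(2) W_closed by (simp add: m_assoc)
      moreover have "prod_of ws \<otimes> s \<otimes> inv (prod_of ws) \<in> generate G Q"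
        using s Q.inv_W by simp
      ultimately have "len x \<le> len (prod_of ys)" using assms(3) by simp
      thus False using len_le[OF ys(1)] ys(2) by simp
    qed
    hence "len (x \<otimes> prod_of ws \<otimes> s) = Suc (len (x \<otimes> prod_of ws))"
      using s assms(2) by (intro len_ascent) auto
    thus ?case using IH len1 len0 s assms(2) W_closed by (simp add: prod_of_snoc m_assoc)
  qed
  thus ?thesis using ws len_subset[OF assms(1,4)] by simp
qed

lemma min_coset_ex:
  assumes "Q \<subseteq> S" "x \<in> W"
  obtains x0 u where "x0 \<in> W" "u \<in> generate G Q" "x = x0 \<otimes> u"
    "\<And>v. v \<in> generate G Q \<Longrightarrow> len x0 \<le> len (x0 \<otimes> v)"
proof -
  interpret Q: sign_group G Q pos using assms(1) by (rule sign_group_subset)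
  have sub: "generate G Q \<subseteq> W" using assms(1) by (rule mono_generate)
  define f where "f v = len (x \<otimes> v)" for v
  have "\<exists>v. v \<in> generate G Q \<and> (\<forall>v'. v' \<in> generate G Q \<longrightarrow> f v \<le> f v')"
    using generate.one by (intro exists_least_iff[THEN iffD1] ex_has_least_nat[of _ \<one>])
  then obtain v where v: "v \<in> generate G Q" "\<And>v'. v' \<in> generate G Q \<Longrightarrow> f v \<le> f v'" by blast
  have vW: "v \<in> W" "v \<in> carrier G" "x \<in> carrier G" using v sub W_closed assms by auto
  show ?thesis
  proof
    show "x \<otimes> v \<in> W" using assms vW by simp
    show "inv v \<in> generate G Q" using v by simp
    show "x = x \<otimes> v \<otimes> inv v" using vW by (simp add: m_assoc)
    fix u assume u: "u \<in> generate G Q"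
    have "f v \<le> f (v \<otimes> u)" using u v by simp
    thus "len (x \<otimes> v) \<le> len (x \<otimes> v \<otimes> u)"
      using vW u Q.W_closed by (simp add: f_def m_assoc)
  qed
qed

text \<open>Without descents in \<open>Q\<close>, \<open>x\<close> is the shortest element of its
  coset: otherwise the last letter of its parabolic factor would be a descent.\<close>

lemma len_mult_parabolic:
  assumes "Q \<subseteq> S" "x \<in> W" "\<And>s. s \<in> Q \<Longrightarrow> pos x s" "u \<in> generate G Q"
  shows "len (x \<otimes> u) = len x + len u"
proof -
  interpret Q: sign_group G Q pos using assms(1) by (rule sign_group_subset)
  have sub: "generate G Q \<subseteq> W" using assms(1) by (rule mono_generate)
  obtain x0 v where x0: "x0 \<in> W" "v \<in> generate G Q" "x = x0 \<otimes> v"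
    "\<And>v. v \<in> generate G Q \<Longrightarrow> len x0 \<le> len (x0 \<otimes> v)"
    using min_coset_ex[OF assms(1,2)] by metis
  have "v = \<one>"
  proof (rule ccontr)
    assume "v \<noteq> \<one>"
    obtain ws where ws: "ws \<in> lists Q" "prod_of ws = v" "length ws = len v"
      using Q.ex_reduced[OF x0(2)] len_subset[OF assms(1) x0(2)] by metis
    with \<open>v \<noteq> \<one>\<close> have "ws \<noteq> []" by auto
    then obtain s vs where sv: "ws = vs @ [s]" by (metis rev_exhaust)
    hence s: "s \<in> Q" "s \<in> S" "vs \<in> lists S" using ws assms(1) by auto
    have "v \<otimes> s = prod_of vs" using sv ws(2) s prod_of_snoc[OF s(3,2)] by (metis gen_cancel prod_of_closed)
    hence "len (v \<otimes> s) < len v" using len_le[of vs] s ws sv by simp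
    moreover have "len (x0 \<otimes> (v \<otimes> s)) = len x0 + len (v \<otimes> s)" "len (x0 \<otimes> v) = len x0 + len v"
      using s x0 by (intro len_min_coset[OF assms(1)]; simp)+
    ultimately have "len (x \<otimes> s) < len x"
      using x0 s W_closed sub by (simp add: m_assoc subset_iff)
    thus False using len_ascent[of x s] assms s by simp
  qed
  thus ?thesis using x0 len_min_coset[OF assms(1) x0(1) x0(4) assms(4)] W_closed by simp
qed

lemma left_pos_iff: "w \<in> W \<Longrightarrow> s \<in> S \<Longrightarrow> pos (inv w) s \<longleftrightarrow> len w < len (s \<otimes> w)"
proof -
  assume *: "w \<in> W" "s \<in> S"
  have "inv (s \<otimes> w) = inv w \<otimes> s" using * W_closed by (simp add: inv_mult_group)
  hence "len (inv w \<otimes> s) = len (s \<otimes> w)" using * len_inv[of "s \<otimes> w"] by simp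
  thus ?thesis using * pos_iff[of "inv w" s] by simp
qed

lemma len_parabolic_mult:
  assumes "Q \<subseteq> S" "x \<in> W" "\<And>s. s \<in> Q \<Longrightarrow> pos (inv x) s" "u \<in> generate G Q"
  shows "len (u \<otimes> x) = len u + len x"
proof -
  interpret Q: sign_group G Q pos using assms(1) by (rule sign_group_subset)
  have sub: "generate G Q \<subseteq> W" using assms(1) by (rule mono_generate)
  have u: "u \<in> W" using assms sub by auto
  have "len (inv x \<otimes> inv u) = len (inv x) + len (inv u)"
    using assms by (intro len_mult_parabolic) auto
  moreover have "inv x \<otimes> inv u = inv (u \<otimes> x)"
    using u assms W_closed by (simp add: inv_mult_group)
  ultimately show ?thesis using u assms by simp
qed

text \<open>Induction along a reduced word for \<open>u\<close>. When the next letter is a descent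
  of \<open>x\<close>, the exchange deletes a letter of the left factor, and the right factor grows
  by one. As \<open>u\<close> is arbitrary, an \<open>x\<close> in the parabolic subgroup must then
  be longest there.\<close>

lemma descent_factor:
  assumes "Q \<subseteq> S" "x \<in> W" "\<And>s. s \<in> Q \<Longrightarrow> \<not> pos x s" "u \<in> generate G Q"
  obtains a where "a \<in> W" "x = a \<otimes> u" "len x = len a + len u"
proof -
  interpret Q: sign_group G Q pos using assms(1) by (rule sign_group_subset)
  have sub: "generate G Q \<subseteq> W" using assms(1) by (rule mono_generate)
  obtain ws where ws: "ws \<in> lists Q" "prod_of ws = u" "length ws = len u"
    using Q.ex_reduced[OF assms(4)] len_subset[OF assms(1,4)] by metis
  have "ws \<in> lists Q \<Longrightarrow> length ws = len (prod_of ws) \<Longrightarrow>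
     \<exists>a \<in> W. x = a \<otimes> prod_of ws \<and> len x = len a + len (prod_of ws)"
  proof (induction ws rule: rev_induct)
    case Nil thus ?case using assms W_closed by auto
  next
    case (snoc s ws)
    hence s: "s \<in> Q" "s \<in> S" "ws \<in> lists Q" "ws \<in> lists S" "prod_of ws \<in> W"
      using assms(1) Q.prod_of_W sub by auto
    note len0 = reduced_snoc(1)[OF s(4,2) snoc.prems(2)]
    note len1 = reduced_snoc(2)[OF s(4,2) snoc.prems(2)]
    from len0 obtain a where a: "a \<in> W" "x = a \<otimes> prod_of ws" "len x = len a + length ws"
      using snoc s by auto
    obtain xs where xs: "xs \<in> lists S" "prod_of xs = a" "length xs = len a"
      using a(1) by (rule ex_reduced)
    have "\<not> pos (prod_of xs \<otimes> prod_of ws) s" using a assms(3) xs s by simp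
    then obtain ys where ys: "ys \<in> lists S" "len a = Suc (length ys)" "x \<otimes> s = prod_of ys \<otimes> prod_of ws"
      using exchange_append[OF xs(1) s(4,2) _ len1] xs a by metis
    have "x = x \<otimes> s \<otimes> s" using s assms W_closed by simp
    also have "\<dots> = prod_of ys \<otimes> (prod_of ws \<otimes> s)" unfolding ys(3) using s ys by (simp add: m_assoc)
    finally have x: "x = prod_of ys \<otimes> (prod_of ws \<otimes> s)" .
    have "len x \<le> len (prod_of ys) + len (prod_of ws \<otimes> s)"
      unfolding x using ys s by (intro len_mult prod_of_W mult_W) auto
    hence "len x = len (prod_of ys) + len (prod_of ws \<otimes> s)"
      using len1 len_le[OF ys(1)] ys(2) a(3) by simp
    thus ?case using x ys s prod_of_W[OF ys(1)]
      by (intro bexI[of _ "prod_of ys"]) (auto simp: prod_of_snoc)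
  qed
  thus ?thesis using ws len_subset[OF assms(1,4)] that by auto
qed

end

section \<open>Longest elements and conjugation of parabolic subgroups\<close>


lemma (in group) inv_cancel_left [simp]:
  "y \<in> carrier G \<Longrightarrow> x \<in> carrier G \<Longrightarrow> inv y \<otimes> (y \<otimes> x) = x"
  "y \<in> carrier G \<Longrightarrow> x \<in> carrier G \<Longrightarrow> y \<otimes> (inv y \<otimes> x) = x"
  by (simp_all flip: m_assoc)

context sign_group begin

text \<open>The longest element described by its descents; this fits a product of commuting
  generators and a longest element alike.\<close>

definition is_full :: "'a set \<Rightarrow> 'a \<Rightarrow> bool" where
  "is_full Q w \<longleftrightarrow> w \<in> generate G Q \<and> (\<forall>s\<in>Q. \<not> pos w s)"

lemma parabolic_W: "Q \<subseteq> S \<Longrightarrow> w \<in> generate G Q \<Longrightarrow> w \<in> W"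
  using mono_generate[of Q S] by auto

lemma full_W: "Q \<subseteq> S \<Longrightarrow> is_full Q w \<Longrightarrow> w \<in> W"
  by (auto simp: is_full_def parabolic_W)

lemma full_len_ge: "Q \<subseteq> S \<Longrightarrow> is_full Q w \<Longrightarrow> u \<in> generate G Q \<Longrightarrow> len u \<le> len w"
  by (metis descent_factor full_W is_full_def le_add2)

text \<open>By \<open>descent_factor\<close> one of the two ends in the other, and neither is
  longer.\<close>

lemma full_unique:
  assumes "Q \<subseteq> S" "is_full Q w" "is_full Q v" shows "w = v"
proof -
  obtain a where a: "a \<in> W" "w = a \<otimes> v" "len w = len a + len v"
    using descent_factor[of Q w v] assms by (metis full_W is_full_def)
  moreover have "len w \<le> len v" using assms full_len_ge by (simp add: is_full_def)
  ultimately show ?thesis using len_zero[of a] assms(1,3) full_W W_closed by simp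
qed

lemma maximal_full:
  assumes "Q \<subseteq> S" "w \<in> generate G Q" "\<And>v. v \<in> generate G Q \<Longrightarrow> len v \<le> len w"
  shows "is_full Q w"
  unfolding is_full_def
proof (intro conjI ballI notI)
  fix s assume s: "s \<in> Q" "pos w s"
  hence "len (w \<otimes> s) = Suc (len w)"
    using assms(1) by (intro len_ascent parabolic_W[OF assms(1,2)]) auto
  moreover have "len (w \<otimes> s) \<le> len w"
    by (rule assms(3)[OF generate.eng[OF assms(2) generate.incl[OF s(1)]]])
  ultimately show False by simp
qed (use assms in auto)

text \<open>The definite description is legitimate because elements of maximal length are full and
  full elements are unique.\<close>

lemma longest_full:
  assumes "Q \<subseteq> S" "finite (generate G Q)"
  shows "is_full Q (longest_element G Q)"
proof -
  define mx where "mx w \<longleftrightarrow> w \<in> generate G Q \<and>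
    (\<forall>v \<in> generate G Q. word_length G Q v \<le> word_length G Q w)" for w
  have full: "is_full Q w" if "mx w" for w
    using that maximal_full[OF assms(1)] len_subset[OF assms(1)] by (auto simp: mx_def)
  have ne: "generate G Q \<noteq> {}" using generate.one by auto
  have "\<exists>w\<in>generate G Q. word_length G Q w = Max (word_length G Q ` generate G Q)"
  proof -
    have "Max (word_length G Q ` generate G Q) \<in> word_length G Q ` generate G Q"
      using assms ne by (intro Max_in) auto
    thus ?thesis by (metis (no_types) imageE)
  qed
  then obtain w where w: "w \<in> generate G Q"
    "word_length G Q w = Max (word_length G Q ` generate G Q)" by blast
  have "mx w" unfolding mx_def using w assms by auto
  hence "mx (longest_element G Q)"
    unfolding longest_element_def mx_def[symmetric]
    using full full_unique[OF assms(1)] by (intro theI[of mx w]) auto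
  thus ?thesis by (rule full)
qed

text \<open>Each new letter is an ascent, since by \<open>parabolic_descent\<close> a descent would
  already occur in the word.\<close>

lemma len_distinct: "distinct ws \<Longrightarrow> ws \<in> lists S \<Longrightarrow> len (prod_of ws) = length ws"
proof (induction ws rule: rev_induct)
  case (snoc s ws)
  have sub: "set ws \<subseteq> S" "ws \<in> lists S" "s \<in> S" using snoc by auto
  have "prod_of ws \<in> generate G (set ws)" by (rule word_prod_in_generate) auto
  hence "pos (prod_of ws) s" using parabolic_descent[of "set ws" s] snoc sub by auto
  thus ?case using snoc sub len_ascent prod_of_W prod_of_snoc by simp
qed simp

text \<open>Any letter of the product can be carried to the right end, where a further copy cancels
  it.\<close>

lemma commuting_full:
  assumes "Q \<subseteq> S" "pairwise_commuting G Q" "distinct ws" "set ws = Q"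
  shows "is_full Q (prod_of ws)"
  unfolding is_full_def
proof (intro conjI ballI)
  show "prod_of ws \<in> generate G Q" using assms by (intro word_prod_in_generate) auto
  fix s assume s: "s \<in> Q"
  then obtain us vs where ws: "ws = us @ s # vs" using assms(4) by (metis split_list)
  have l: "us \<in> lists S" "vs \<in> lists S" "s \<in> S" "ws \<in> lists S" using ws assms by auto
  have comm: "zs \<in> lists Q \<Longrightarrow> prod_of zs \<otimes> s = s \<otimes> prod_of zs" for zs
  proof (induction zs)
    case Nil thus ?case using l by simp
  next
    case (Cons z zs)
    have z: "z \<in> S" "z \<otimes> s = s \<otimes> z" "zs \<in> lists S" 
      using Cons assms(1,2) s by (auto simp: pairwise_commuting_def)
    have "prod_of (z # zs) \<otimes> s = z \<otimes> s \<otimes> prod_of zs"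
      using Cons z(1,3) l by (simp add: m_assoc)
    also have "z \<otimes> s = s \<otimes> z" by (rule z(2))
    also have "s \<otimes> z \<otimes> prod_of zs = s \<otimes> prod_of (z # zs)" using z l by (simp add: m_assoc)
    finally show ?case .
  qed
  have "vs \<in> lists Q" using ws assms(4) by auto
  hence "prod_of ws \<otimes> s = prod_of us \<otimes> (s \<otimes> (s \<otimes> prod_of vs))"
    using l comm by (simp add: ws prod_of_append m_assoc)
  also have "\<dots> = prod_of (us @ vs)" using l by (simp add: prod_of_append)
  finally have "len (prod_of ws \<otimes> s) \<le> length (us @ vs)" using len_le[of "us @ vs"] l by auto
  moreover have "len (prod_of ws) = length ws" using assms l by (intro len_distinct) auto
  ultimately show "\<not> pos (prod_of ws) s"
    using pos_iff[of "prod_of ws" s] l prod_of_W by (auto simp: ws)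
qed

lemma full_inv:
  assumes "Q \<subseteq> S" "is_full Q w" shows "inv w = w"
proof -
  interpret Q: sign_group G Q pos using assms(1) by (rule sign_group_subset)
  have w: "w \<in> generate G Q" "w \<in> W" using assms full_W by (auto simp: is_full_def)
  have "is_full Q (inv w)"
    using assms w full_len_ge by (intro maximal_full) auto
  thus ?thesis using full_unique assms by blast
qed

lemma full_support:
  assumes "Q \<subseteq> S" "ws \<in> lists Q" "is_full Q (prod_of ws)" shows "set ws = Q"
proof
  show "set ws \<subseteq> Q" using assms by auto
  show "Q \<subseteq> set ws"
  proof
    fix s assume s: "s \<in> Q"
    have "prod_of ws \<in> generate G (set ws)" by (rule word_prod_in_generate) auto
    thus "s \<in> set ws" using parabolic_descent[of "set ws" s] s assms by (auto simp: is_full_def)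
  qed
qed

text \<open>Somewhere along a word for \<open>t\<close> the ascent \<open>s\<close> of
  \<open>v\<close> is lost, and \<open>pos_switch\<close> there gives
  \<open>z \<otimes> v = v \<otimes> s\<close> with \<open>z\<close> in the parabolic subgroup of
  \<open>Q\<close>. Lengths add up in \<open>z \<otimes> v\<close>, so \<open>z\<close> has length
  one.\<close>

lemma conj_into:
  assumes "P \<subseteq> S" "Q \<subseteq> S" "t \<in> generate G Q" "v \<in> W"
    and "\<And>q. q \<in> Q \<Longrightarrow> pos (inv v) q" "s \<in> P" "pos v s" "\<not> pos (t \<otimes> v) s"
  shows "v \<otimes> s \<otimes> inv v \<in> Q"
proof -
  interpret Q: sign_group G Q pos using assms(2) by (rule sign_group_subset)
  have s: "s \<in> S" using assms by auto
  obtain ws where ws: "ws \<in> lists Q" "prod_of ws = t" using assms(3) Q.W_words by auto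
  have "ws \<in> lists Q \<Longrightarrow> \<not> pos (prod_of ws \<otimes> v) s \<Longrightarrow>
    \<exists>q y. q \<in> Q \<and> y \<in> generate G Q \<and> pos (y \<otimes> v) s \<and> \<not> pos (q \<otimes> (y \<otimes> v)) s"
  proof (induction ws)
    case Nil thus ?case using assms W_closed by simp
  next
    case (Cons q ws)
    have ws: "ws \<in> lists Q" "q \<in> Q" using Cons by auto
    show ?case
    proof (cases "pos (prod_of ws \<otimes> v) s")
      case True
      thus ?thesis using Cons.prems ws assms(2,4) W_closed Q.prod_of_W[OF ws(1)] Q.W_closed
        by (intro exI[of _ q] exI[of _ "prod_of ws"]) (auto simp: m_assoc)
    next
      case False
      thus ?thesis using Cons ws by auto
    qed
  qed
  then obtain q y where y: "q \<in> Q" "y \<in> generate G Q" "pos (y \<otimes> v) s" "\<not> pos (q \<otimes> (y \<otimes> v)) s"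
    using ws assms by blast
  have yW: "y \<in> W" "q \<in> S" using y assms parabolic_W by auto
  have "q \<otimes> (y \<otimes> v) = y \<otimes> v \<otimes> s" using yW y s assms by (intro pos_switch) auto
  hence "inv y \<otimes> (q \<otimes> (y \<otimes> v)) = inv y \<otimes> (y \<otimes> v \<otimes> s)" by simp
  moreover define z where "z = inv y \<otimes> q \<otimes> y"
  ultimately have zv: "z \<otimes> v = v \<otimes> s"
    using yW s assms(4) W_closed by (simp add: m_assoc)
  have z: "z \<in> generate G Q" unfolding z_def using y by simp
  have "len (z \<otimes> v) = len z + len v" using z assms by (intro len_parabolic_mult) auto
  moreover have "len (v \<otimes> s) = Suc (len v)" using assms s by (intro len_ascent) auto
  ultimately have "len z = 1" unfolding zv by simp
  hence "z \<in> Q" by (rule len_one_parabolic[OF assms(2) z])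
  moreover have "v \<otimes> s \<otimes> inv v = z"
    unfolding zv[symmetric] using assms(4) W_closed Q.W_closed[OF z] by (simp add: m_assoc)
  ultimately show ?thesis by simp
qed

text \<open>Conjugation by \<open>v\<close> carries one parabolic subgroup into the other, preserves
  length and matches the generators. Hence it takes a full element to a full element, which is
  unique.\<close>

lemma conj_full:
  assumes "P \<subseteq> S" "Q \<subseteq> S" "v \<in> W" "is_full P t" "is_full Q t'"
    and pos: "\<And>s. s \<in> P \<Longrightarrow> pos v s" "\<And>q. q \<in> Q \<Longrightarrow> pos (inv v) q"
    and conj: "\<And>s. s \<in> P \<Longrightarrow> v \<otimes> s \<otimes> inv v \<in> Q" "\<And>q. q \<in> Q \<Longrightarrow> inv v \<otimes> q \<otimes> v \<in> P"
  shows "t' \<otimes> v = v \<otimes> t"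
proof -
  interpret P: sign_group G P pos using assms(1) by (rule sign_group_subset)
  interpret Q: sign_group G Q pos using assms(2) by (rule sign_group_subset)
  have v: "v \<in> carrier G" using assms W_closed by simp
  have gen: "v \<otimes> u \<otimes> inv v \<in> generate G Q" if u: "u \<in> generate G P" for u
  proof -
    obtain ws where ws: "ws \<in> lists P" "prod_of ws = u" using u P.W_words by auto
    have "ws \<in> lists P \<Longrightarrow> v \<otimes> prod_of ws \<otimes> inv v \<in> generate G Q"
    proof (induction ws)
      case Nil thus ?case using v generate.one by simp
    next
      case (Cons s ws)
      have "v \<otimes> prod_of (s # ws) \<otimes> inv v = (v \<otimes> s \<otimes> inv v) \<otimes> (v \<otimes> prod_of ws \<otimes> inv v)"
        using Cons v P.prod_of_closed[of ws] by (simp add: m_assoc)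
      also have "\<dots> \<in> generate G Q"
        by (rule generate.eng[OF generate.incl[OF conj(1)]]) (use Cons in auto)
      finally show ?case .
    qed
    thus ?thesis using ws by simp
  qed
  \<comment> \<open>The element \<open>v \<otimes> u\<close> has additive length, and so has the
    same element written with the conjugate of \<open>u\<close> on the left of
    \<open>v\<close>.\<close>
  have len: "len (v \<otimes> u \<otimes> inv v) = len u" if u: "u \<in> generate G P" for u
  proof -
    have "len (v \<otimes> u \<otimes> inv v \<otimes> v) = len (v \<otimes> u \<otimes> inv v) + len v"
      using assms gen u by (intro len_parabolic_mult[of Q]) auto
    moreover have "v \<otimes> u \<otimes> inv v \<otimes> v = v \<otimes> u" using u v P.W_closed by (simp add: m_assoc)
    moreover have "len (v \<otimes> u) = len v + len u" using assms u by (intro len_mult_parabolic[of P]) auto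
    ultimately show ?thesis by simp
  qed
  have t: "t \<in> generate G P" "t \<in> carrier G" using assms(4) P.W_closed by (auto simp: is_full_def)
  have "is_full Q (v \<otimes> t \<otimes> inv v)"
    unfolding is_full_def
  proof (intro conjI ballI gen t)
    fix q assume q: "q \<in> Q"
    define s where "s = inv v \<otimes> q \<otimes> v"
    have s: "s \<in> P" "s \<in> S" using conj q assms by (auto simp: s_def)
    have "v \<otimes> s = q \<otimes> v" using v q by (simp add: s_def m_assoc)
    hence q': "q = v \<otimes> s \<otimes> inv v" using v q s by (simp add: m_assoc)
    have "v \<otimes> t \<otimes> inv v \<otimes> q = v \<otimes> (t \<otimes> s) \<otimes> inv v"
      unfolding q' using v t s by (simp add: m_assoc)
    hence "len (v \<otimes> t \<otimes> inv v \<otimes> q) = len (t \<otimes> s)" using s t by (simp add: len)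
    moreover have "Suc (len (t \<otimes> s)) = len t"
      using assms(1,4) s t by (intro len_descent full_W) (auto simp: is_full_def)
    ultimately have "len (v \<otimes> t \<otimes> inv v \<otimes> q) < len (v \<otimes> t \<otimes> inv v)" using t by (simp add: len)
    thus "\<not> pos (v \<otimes> t \<otimes> inv v) q"
      using pos_iff[of "v \<otimes> t \<otimes> inv v" q] q assms(2) parabolic_W gen t by auto
  qed
  hence "v \<otimes> t \<otimes> inv v = t'" using full_unique assms by blast
  thus ?thesis using v t by (auto simp: m_assoc)
qed

end

section \<open>Admissible partitions\<close>


locale sign_partition = sign_group +
  fixes e :: "'a set \<Rightarrow> 'a list" and \<Sigma> :: "'a set set"
  assumes admissible: "admissible_partition G S e \<Sigma>"
begin

abbreviation tau :: "'a set \<Rightarrow> 'a" where "tau \<equiv> block_elt G e"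
abbreviation T :: "'a set" where "T \<equiv> block_gens G e \<Sigma>"
abbreviation X :: "'a set" where "X \<equiv> generate G T"
abbreviation bprod :: "'a set list \<Rightarrow> 'a" where "bprod ps \<equiv> prod_of (map tau ps)"
abbreviation blen :: "'a set list \<Rightarrow> nat" where "blen ps \<equiv> sum_list (map (\<lambda>P. len (tau P)) ps)"

lemma block_subset: "P \<in> \<Sigma> \<Longrightarrow> P \<subseteq> S"
  using admissible by (auto simp: admissible_partition_def partition_on_def)

lemma block_nonempty: "P \<in> \<Sigma> \<Longrightarrow> P \<noteq> {}"
  using admissible by (auto simp: admissible_partition_def partition_on_def)

lemma block_disjoint: "P \<in> \<Sigma> \<Longrightarrow> Q \<in> \<Sigma> \<Longrightarrow> s \<in> P \<Longrightarrow> s \<in> Q \<Longrightarrow> P = Q"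
  using admissible by (auto simp: admissible_partition_def partition_on_def disjoint_def)

lemma understood: "P \<in> \<Sigma> \<Longrightarrow> understood_expression G P (e P)"
  using admissible by (auto simp: admissible_partition_def)

text \<open>Both cases of \<open>block_elt\<close> give the full element of the block, so arguments
  about \<open>tau\<close> can be uniform.\<close>

lemma tau_full: "P \<in> \<Sigma> \<Longrightarrow> is_full P (tau P)"
  using understood[of P] block_subset[of P] admissible
  by (auto simp: block_elt_def understood_expression_def admissible_partition_def
      intro: commuting_full longest_full split: if_splits)

lemma tau_gen: "P \<in> \<Sigma> \<Longrightarrow> tau P \<in> generate G P"
  using tau_full by (auto simp: is_full_def)

lemma tau_W [simp]: "P \<in> \<Sigma> \<Longrightarrow> tau P \<in> W"
  by (rule full_W[OF block_subset tau_full])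

lemma tau_closed [simp]: "P \<in> \<Sigma> \<Longrightarrow> tau P \<in> carrier G"
  by (simp add: W_closed)

lemma tau_inv [simp]: "P \<in> \<Sigma> \<Longrightarrow> inv (tau P) = tau P"
  by (rule full_inv[OF block_subset tau_full])

lemma tau_square [simp]: "P \<in> \<Sigma> \<Longrightarrow> tau P \<otimes> tau P = \<one>"
  using r_inv[of "tau P"] by simp

lemma tau_cancel [simp]: "P \<in> \<Sigma> \<Longrightarrow> w \<in> carrier G \<Longrightarrow> w \<otimes> tau P \<otimes> tau P = w"
  by (simp add: m_assoc)

lemma e_prod: "P \<in> \<Sigma> \<Longrightarrow> e P \<in> lists P \<and> prod_of (e P) = tau P \<and> length (e P) = len (tau P)"
proof (cases "pairwise_commuting G P")
  case True
  assume P: "P \<in> \<Sigma>"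
  hence "distinct (e P)" "set (e P) = P"
    using understood[OF P] True by (auto simp: understood_expression_def)
  moreover have "e P \<in> lists S" using calculation block_subset[OF P] by auto
  ultimately show ?thesis using True len_distinct[of "e P"] by (auto simp: block_elt_def)
next
  case False
  assume P: "P \<in> \<Sigma>"
  hence "e P \<in> reduced_words G P (tau P)"
    using understood[OF P] False by (auto simp: understood_expression_def block_elt_def)
  thus ?thesis using len_subset[OF block_subset[OF P] tau_gen[OF P]]
    by (auto simp: reduced_words_def)
qed

lemma e_set: "P \<in> \<Sigma> \<Longrightarrow> set (e P) = P"
  using full_support[of P "e P"] e_prod[of P] tau_full block_subset by auto

lemma e_reduced: "P \<in> \<Sigma> \<Longrightarrow> e P \<in> reduced_words G S (tau P)"
  using e_prod[of P] block_subset[of P] by (auto simp: reduced_words_def)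

lemma tau_len_pos: "P \<in> \<Sigma> \<Longrightarrow> 0 < len (tau P)"
  using e_prod[of P] e_set[of P] block_nonempty[of P] by (cases "e P") auto

text \<open>The descents of \<open>tau P\<close> lie in \<open>P\<close>, and distinct blocks are
  disjoint.\<close>

lemma tau_inj: "P \<in> \<Sigma> \<Longrightarrow> Q \<in> \<Sigma> \<Longrightarrow> tau P = tau Q \<Longrightarrow> P = Q"
proof -
  assume *: "P \<in> \<Sigma>" "Q \<in> \<Sigma>" "tau P = tau Q"
  obtain s where s: "s \<in> P" using block_nonempty[OF *(1)] by auto
  hence "\<not> pos (tau Q) s" using tau_full[OF *(1)] * by (auto simp: is_full_def)
  hence "s \<in> Q" using parabolic_descent[OF block_subset[OF *(2)] _ tau_gen[OF *(2)]]
    s block_subset[OF *(1)] by auto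
  thus "P = Q" using s * block_disjoint by blast
qed

lemma T_closed: "T \<subseteq> carrier G" by (auto simp: block_gens_def)

lemma X_W: "x \<in> X \<Longrightarrow> x \<in> W"
proof -
  have "T \<subseteq> W" by (auto simp: block_gens_def)
  thus "x \<in> X \<Longrightarrow> x \<in> W" using generate_subgroup_incl[OF _ W_subgroup] by auto
qed

lemma X_inv [simp]: "x \<in> X \<Longrightarrow> inv x \<in> X"
  by (rule generate_m_inv_closed[OF T_closed])

lemma tau_X [simp]: "P \<in> \<Sigma> \<Longrightarrow> tau P \<in> X"
  by (intro generate.incl) (auto simp: block_gens_def)

lemma bprod_X: "ps \<in> lists \<Sigma> \<Longrightarrow> bprod ps \<in> X"
  by (intro word_prod_in_generate) (auto simp: block_gens_def)

lemma bprod_W: "ps \<in> lists \<Sigma> \<Longrightarrow> bprod ps \<in> W"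
  using bprod_X X_W by blast

lemma bprod_closed: "ps \<in> lists \<Sigma> \<Longrightarrow> bprod ps \<in> carrier G"
  using bprod_W W_closed by blast

lemma bprod_append:
  "ps \<in> lists \<Sigma> \<Longrightarrow> qs \<in> lists \<Sigma> \<Longrightarrow> bprod (ps @ qs) = bprod ps \<otimes> bprod qs"
  by (simp, intro word_prod_append) auto

text \<open>The descent clause of admissibility enters the proof here and nowhere else.\<close>

lemma pos_block:
  assumes "x \<in> X" "P \<in> \<Sigma>" "s \<in> P" "t \<in> P" "pos x s" shows "pos x t"
proof -
  have "P \<subseteq> right_descents G S x \<or> P \<subseteq> S - right_descents G S x"
    using assms admissible by (auto simp: admissible_partition_def block_group_def)
  thus ?thesis using assms right_descents_iff X_W block_subset by blast
qed

lemma len_tau_ascent: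
  assumes "x \<in> X" "P \<in> \<Sigma>" "s \<in> P" "pos x s"
  shows "len (x \<otimes> tau P) = len x + len (tau P)"
  by (rule len_mult_parabolic[OF block_subset[OF assms(2)] X_W[OF assms(1)]
        pos_block[OF assms(1-3) _ assms(4)] tau_gen[OF assms(2)]])

lemma len_tau_descent:
  assumes "x \<in> X" "P \<in> \<Sigma>" "s \<in> P" "\<not> pos x s"
  shows "len (x \<otimes> tau P) + len (tau P) = len x"
proof -
  have "\<And>t. t \<in> P \<Longrightarrow> \<not> pos x t" using assms pos_block by blast
  then obtain a where "a \<in> W" "x = a \<otimes> tau P" "len x = len a + len (tau P)"
    using descent_factor[of P x "tau P"] assms X_W tau_gen block_subset by metis
  thus ?thesis using assms W_closed by simp
qed

lemma len_bprod_le: "ps \<in> lists \<Sigma> \<Longrightarrow> len (bprod ps) \<le> blen ps"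
proof (induction ps)
  case (Cons P ps)
  thus ?case using len_mult[of "tau P" "bprod ps"] bprod_W[of ps] by auto
qed simp

text \<open>\<open>pos\<close> switches at some block \<open>Q\<close>; let \<open>v\<close> be the
  product of the blocks after it. \<open>conj_into\<close> is applied to \<open>v\<close>, and to
  its inverse with \<open>P\<close> and \<open>Q\<close> interchanged; admissibility spreads each of
  its hypotheses from one letter to the whole block. The two block elements have equal length
  because \<open>tau Q \<otimes> v\<close> and \<open>v \<otimes> tau P\<close> are the same element
  and both have additive length.\<close>

lemma block_exchange:
  assumes "ps \<in> lists \<Sigma>" "len (bprod ps) = blen ps" "P \<in> \<Sigma>" "s \<in> P" "\<not> pos (bprod ps) s"
  obtains us Q vs where "ps = us @ Q # vs" "bprod ps \<otimes> tau P = bprod (us @ vs)"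
    "len (tau Q) = len (tau P)"
proof -
  have "ps \<in> lists \<Sigma> \<Longrightarrow> \<not> pos (bprod ps) s \<Longrightarrow>
     \<exists>us Q vs. ps = us @ Q # vs \<and> pos (bprod vs) s \<and> \<not> pos (bprod (Q # vs)) s"
  proof (induction ps)
    case Nil thus ?case using pos_one block_subset assms by auto
  next
    case (Cons Q ps)
    show ?case
    proof (cases "pos (bprod ps) s")
      case True thus ?thesis using Cons by blast
    next
      case False
      then obtain us Q' vs where "ps = us @ Q' # vs \<and> pos (bprod vs) s \<and> \<not> pos (bprod (Q' # vs)) s"
        using Cons by auto
      thus ?thesis by (intro exI[of _ "Q # us"]) auto
    qed
  qed
  then obtain us Q vs where ps: "ps = us @ Q # vs" "pos (bprod vs) s" "\<not> pos (bprod (Q # vs)) s"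
    using assms by blast
  have l: "us \<in> lists \<Sigma>" "Q \<in> \<Sigma>" "vs \<in> lists \<Sigma>" "Q # vs \<in> lists \<Sigma>" using ps assms by auto
  define v where "v = bprod vs"
  have v: "v \<in> X" "v \<in> W" "v \<in> carrier G" using l bprod_X bprod_W W_closed by (auto simp: v_def)
  \<comment> \<open>The lengths of the blocks add up over all of \<open>ps\<close>, hence also over
    the final segment that starts with \<open>Q\<close>.\<close>
  have "len (bprod ps) \<le> len (bprod us) + len (tau Q \<otimes> v)"
    using len_mult[of "bprod us" "bprod (Q # vs)"] l bprod_W[of us] bprod_W[of "Q # vs"] bprod_append[of us "Q # vs"]
    by (simp add: ps v_def)
  hence "len (tau Q) + len v \<le> len (tau Q \<otimes> v)"
    using assms(2) len_bprod_le[of us] len_bprod_le[of vs] l by (simp add: ps v_def)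
  hence lenQv: "len (tau Q \<otimes> v) = len (tau Q) + len v"
    using len_mult[of "tau Q" v] l v by simp
  \<comment> \<open>If one letter of \<open>Q\<close> were a left descent of \<open>v\<close>, all
    of \<open>tau Q\<close> would cancel against \<open>v\<close>, contrary to
    \<open>lenQv\<close>.\<close>
  have posQ: "pos (inv v) q" if q: "q \<in> Q" for q
  proof (rule ccontr)
    assume "\<not> pos (inv v) q"
    hence "len (inv v \<otimes> tau Q) + len (tau Q) = len (inv v)"
      using q l v by (intro len_tau_descent) auto
    moreover have "inv v \<otimes> tau Q = inv (tau Q \<otimes> v)" using l v by (simp add: inv_mult_group)
    ultimately show False using lenQv l v tau_len_pos[OF l(2)] by simp
  qed
  have posP: "pos v r" if "r \<in> P" for r using pos_block[OF v(1) assms(3,4) that] ps(2) by (simp add: v_def)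
  have QvX: "tau Q \<otimes> v \<in> X" using l v by (simp add: generate.eng)
  have negP: "\<not> pos (tau Q \<otimes> v) r" if "r \<in> P" for r
    using ps(3) pos_block[OF QvX assms(3) that assms(4)] by (auto simp: v_def)
  have conj1: "v \<otimes> r \<otimes> inv v \<in> Q" if r: "r \<in> P" for r
    by (rule conj_into[OF block_subset[OF assms(3)] block_subset[OF l(2)] tau_gen[OF l(2)] v(2)
          posQ r posP[OF r] negP[OF r]])
  have lenPv: "len (tau P \<otimes> inv v) = len (tau P) + len v"
  proof -
    have "len (v \<otimes> tau P) = len v + len (tau P)" using assms v posP by (intro len_tau_ascent) auto
    moreover have "inv (v \<otimes> tau P) = tau P \<otimes> inv v" using assms v by (simp add: inv_mult_group)
    ultimately show ?thesis using len_inv[of "v \<otimes> tau P"] v assms by simp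
  qed
  have PvX: "tau P \<otimes> inv v \<in> X" using assms v by (simp add: generate.eng)
  \<comment> \<open>By \<open>pos_block\<close> it suffices to test the letter
    \<open>v \<otimes> s \<otimes> inv v\<close> of \<open>Q\<close>. Multiplying by it leaves
    \<open>tau P \<otimes> s \<otimes> inv v\<close>, which is too short for an ascent.\<close>
  have negQ: "\<not> pos (tau P \<otimes> inv v) q" if q: "q \<in> Q" for q
  proof
    assume "pos (tau P \<otimes> inv v) q"
    hence *: "pos (tau P \<otimes> inv v) (v \<otimes> s \<otimes> inv v)"
      using conj1[OF assms(4)] l q PvX pos_block by blast
    have s: "s \<in> S" "v \<otimes> s \<otimes> inv v \<in> S" using conj1[OF assms(4)] block_subset l assms by auto
    have "tau P \<otimes> inv v \<otimes> (v \<otimes> s \<otimes> inv v) = tau P \<otimes> s \<otimes> inv v"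
      using assms v s by (simp add: m_assoc)
    moreover have "len (tau P \<otimes> s \<otimes> inv v) \<le> len (tau P \<otimes> s) + len (inv v)"
      using assms v s by (intro len_mult) auto
    moreover have "Suc (len (tau P \<otimes> s)) = len (tau P)"
      using assms s tau_full by (intro len_descent) (auto simp: is_full_def)
    moreover have "len (tau P \<otimes> inv v \<otimes> (v \<otimes> s \<otimes> inv v)) = Suc (len (tau P \<otimes> inv v))"
      using * s PvX X_W by (intro len_ascent) auto
    ultimately show False using lenPv v by simp
  qed
  have conj2: "inv v \<otimes> q \<otimes> v \<in> P" if q: "q \<in> Q" for q
  proof -
    have "inv v \<otimes> q \<otimes> inv (inv v) \<in> P"
      by (rule conj_into[OF block_subset[OF l(2)] block_subset[OF assms(3)] tau_gen[OF assms(3)]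
            inv_W[OF v(2)] _ q posQ[OF q] negQ[OF q]]) (use v posP in simp)
    thus ?thesis using v by simp
  qed
  have eq: "tau Q \<otimes> v = v \<otimes> tau P"
    by (rule conj_full[OF block_subset[OF assms(3)] block_subset[OF l(2)] v(2) tau_full[OF assms(3)]
          tau_full[OF l(2)] posP posQ conj1 conj2])
  have "len (tau Q \<otimes> v) = len v + len (tau P)"
    unfolding eq using assms v posP by (intro len_tau_ascent) auto
  hence "len (tau Q) = len (tau P)" using lenQv by simp
  moreover have "bprod ps \<otimes> tau P = bprod us \<otimes> (tau Q \<otimes> v \<otimes> tau P)"
    using l v assms bprod_closed[of us] bprod_append[of us "Q # vs"] by (simp add: ps m_assoc v_def)
  hence "bprod ps \<otimes> tau P = bprod (us @ vs)"
    unfolding eq using l v assms bprod_append[of us vs] by (simp add: v_def)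
  ultimately show ?thesis using that ps by blast
qed

section \<open>Reduced words over T\<close>

lemma T_word: "ws \<in> lists T \<Longrightarrow> \<exists>ps \<in> lists \<Sigma>. ws = map tau ps"
  by (metis block_gens_def image_iff lists_image)

lemma map_tau_T: "ps \<in> lists \<Sigma> \<Longrightarrow> map tau ps \<in> lists T"
  by (auto simp: block_gens_def)

lemma T_len_le: "ps \<in> lists \<Sigma> \<Longrightarrow> word_length G T (bprod ps) \<le> length ps"
  unfolding word_length_def
  by (rule Least_le) (use map_tau_T in \<open>auto intro!: bexI[of _ "map tau ps"]\<close>)

lemma ex_T_reduced:
  assumes "ps \<in> lists \<Sigma>"
  obtains qs where "qs \<in> lists \<Sigma>" "length qs = word_length G T (bprod ps)" "bprod qs = bprod ps"
proof -
  have "\<exists>k. \<exists>ws\<in>lists T. length ws = k \<and> prod_of ws = bprod ps" using map_tau_T[OF assms] by blast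
  hence "\<exists>ws\<in>lists T. length ws = word_length G T (bprod ps) \<and> prod_of ws = bprod ps"
    unfolding word_length_def by (rule LeastI_ex)
  thus ?thesis using that T_word by (metis length_map)
qed

text \<open>If the last block failed to be an ascent, \<open>block_exchange\<close> would express
  the product by two blocks fewer, against reducedness over \<open>T\<close>.\<close>

lemma T_reduced_additive:
  "ps \<in> lists \<Sigma> \<Longrightarrow> map tau ps \<in> reduced_words G T (bprod ps) \<Longrightarrow> len (bprod ps) = blen ps"
proof (induction ps rule: rev_induct)
  case (snoc P ps)
  have l: "ps \<in> lists \<Sigma>" "P \<in> \<Sigma>" using snoc by auto
  have bp: "bprod (ps @ [P]) = bprod ps \<otimes> tau P" using bprod_append[of ps "[P]"] l by simp
  have red: "Suc (length ps) = word_length G T (bprod ps \<otimes> tau P)"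
    using snoc.prems(2) bp by (simp add: reduced_words_def)
  have min: "Suc (length ps) \<le> length qs" if "qs \<in> lists \<Sigma>" "bprod qs = bprod ps \<otimes> tau P" for qs
    using T_len_le[OF that(1)] that(2) red by simp
  have "length ps = word_length G T (bprod ps)"
  proof (rule antisym[OF _ T_len_le[OF l(1)]])
    obtain qs where qs: "qs \<in> lists \<Sigma>" "length qs = word_length G T (bprod ps)" "bprod qs = bprod ps"
      using ex_T_reduced[OF l(1)] .
    have "Suc (length ps) \<le> length (qs @ [P])"
      using qs l bprod_append[of qs "[P]"] by (intro min) auto
    thus "length ps \<le> word_length G T (bprod ps)" using qs by simp
  qed
  hence "map tau ps \<in> reduced_words G T (bprod ps)" using map_tau_T[OF l(1)] by (simp add: reduced_words_def)
  hence IH: "len (bprod ps) = blen ps" using snoc l by simp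
  obtain s where s: "s \<in> P" using block_nonempty[OF l(2)] by auto
  have "pos (bprod ps) s"
  proof (rule ccontr)
    assume "\<not> pos (bprod ps) s"
    then obtain us Q vs where "ps = us @ Q # vs" "bprod ps \<otimes> tau P = bprod (us @ vs)"
      using block_exchange[OF l(1) IH l(2) s] by metis
    thus False using min[of "us @ vs"] l by auto
  qed
  hence "len (bprod ps \<otimes> tau P) = len (bprod ps) + len (tau P)"
    using l s bprod_X by (intro len_tau_ascent) auto
  thus ?case using IH bp by simp
qed simp

text \<open>Cancelling the last block of \<open>qs\<close> deletes from \<open>ps\<close> a block of
  the same length over \<open>S\<close>, so both shortened words are additive again.\<close>

lemma additive_length_unique:
  "ps \<in> lists \<Sigma> \<Longrightarrow> qs \<in> lists \<Sigma> \<Longrightarrow> len (bprod ps) = blen ps \<Longrightarrow> len (bprod qs) = blen qs \<Longrightarrow>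
     bprod ps = bprod qs \<Longrightarrow> length ps = length qs"
proof (induction qs arbitrary: ps rule: rev_induct)
  case Nil
  thus ?case using tau_len_pos by (cases ps) force+
next
  case (snoc Q qs)
  have l: "qs \<in> lists \<Sigma>" "Q \<in> \<Sigma>" using snoc by auto
  obtain s where s: "s \<in> Q" using block_nonempty[OF l(2)] by auto
  have bp: "bprod ps = bprod qs \<otimes> tau Q" using bprod_append[of qs "[Q]"] l snoc by simp
  have psX: "bprod ps \<in> X" using snoc bprod_X by blast
  have eq: "bprod ps \<otimes> tau Q = bprod qs" using bp l bprod_closed by simp
  have lqs: "len (bprod ps) = blen qs + len (tau Q)" using snoc.prems by simp
  have le: "len (bprod qs) \<le> blen qs" using l len_bprod_le by simp
  have neg: "\<not> pos (bprod ps) s"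
  proof
    assume "pos (bprod ps) s"
    hence "len (bprod ps \<otimes> tau Q) = len (bprod ps) + len (tau Q)"
      using psX l s by (intro len_tau_ascent) auto
    thus False using eq lqs le tau_len_pos[OF l(2)] by simp
  qed
  hence "len (bprod ps \<otimes> tau Q) + len (tau Q) = len (bprod ps)"
    using psX l s by (intro len_tau_descent) auto
  hence qs: "len (bprod qs) = blen qs" using eq lqs by simp
  obtain us P vs where uv: "ps = us @ P # vs" "bprod ps \<otimes> tau Q = bprod (us @ vs)"
    "len (tau P) = len (tau Q)"
    using block_exchange[OF snoc.prems(1,3) l(2) s neg] by metis
  have "length (us @ vs) = length qs"
    using uv eq qs l snoc.prems lqs by (intro snoc.IH) auto
  thus ?case using uv by simp
qed

text \<open>A reduced word over \<open>T\<close> for the same element is additive as well, and so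
  has the same number of blocks.\<close>

lemma additive_T_reduced:
  assumes "ps \<in> lists \<Sigma>" "len (bprod ps) = blen ps"
  shows "map tau ps \<in> reduced_words G T (bprod ps)"
proof -
  obtain qs where qs: "qs \<in> lists \<Sigma>" "length qs = word_length G T (bprod ps)" "bprod qs = bprod ps"
    using ex_T_reduced[OF assms(1)] .
  hence "map tau qs \<in> reduced_words G T (bprod qs)" by (auto simp: reduced_words_def block_gens_def)
  hence "len (bprod qs) = blen qs" using qs by (intro T_reduced_additive) auto
  hence "length ps = length qs" using assms qs by (intro additive_length_unique) auto
  thus ?thesis using map_tau_T[OF assms(1)] qs by (simp add: reduced_words_def)
qed

end

section \<open>Words over the blocks\<close>


lemma quotient_kernel_bij:
  assumes "r = {(u, v). u \<in> A \<and> v \<in> A \<and> F u = F v}"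
  shows "\<exists>f. bij_betw f (A // r) (F ` A)"
proof (intro exI bij_betwI')
  define f where "f C = the_elem (F ` C)" for C
  have f: "f (r `` {u}) = F u" if "u \<in> A" for u
  proof -
    have "F ` (r `` {u}) = {F u}" using that assms by auto
    thus ?thesis by (simp add: f_def)
  qed
  fix C assume "C \<in> A // r"
  then obtain u where u: "u \<in> A" "C = r `` {u}" by (auto simp: quotient_def)
  thus "f C \<in> F ` A" using f by auto
  fix D assume "D \<in> A // r"
  then obtain v where v: "v \<in> A" "D = r `` {v}" by (auto simp: quotient_def)
  show "f C = f D \<longleftrightarrow> C = D" using u v f assms by auto
next
  fix y assume "y \<in> F ` A"
  then obtain u where u: "u \<in> A" "y = F u" by auto
  have "F ` (r `` {u}) = {F u}" using u assms by auto
  thus "\<exists>C \<in> A // r. y = the_elem (F ` C)"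
    using u by (intro bexI[of _ "r `` {u}"]) (auto simp: quotientI)
qed

lemma (in group) ord_commuting_involutions:
  assumes "r \<in> carrier G" "s \<in> carrier G" "r \<otimes> r = \<one>" "s \<otimes> s = \<one>" "r \<otimes> s = s \<otimes> r" "r \<noteq> s"
  shows "ord (r \<otimes> s) = 2"
proof -
  have "r \<otimes> s \<otimes> (r \<otimes> s) = r \<otimes> (s \<otimes> r) \<otimes> s" using assms(1,2) by (simp add: m_assoc)
  also have "\<dots> = (r \<otimes> r) \<otimes> (s \<otimes> s)" unfolding assms(5)[symmetric] using assms(1,2) by (simp add: m_assoc)
  finally have "r \<otimes> s \<otimes> (r \<otimes> s) = \<one>" using assms by simp
  hence "(r \<otimes> s) [^] (2::nat) = \<one>" using assms by (simp add: numeral_2_eq_2)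
  hence "ord (r \<otimes> s) dvd 2" using assms by (simp add: pow_eq_id)
  moreover have "r \<otimes> s \<noteq> \<one>"
  proof
    assume "r \<otimes> s = \<one>"
    hence "r = inv s" using assms by (metis inv_equality)
    moreover have "inv s = s" using assms by (intro inv_equality)
    ultimately show False using assms by simp
  qed
  hence "ord (r \<otimes> s) \<noteq> 1" using ord_eq_1[of "r \<otimes> s"] assms(1,2) by blast
  ultimately show ?thesis using prime_nat_iff[of 2] two_is_prime_nat by auto
qed

text \<open>The projection criterion for equality in a partially commutative monoid, the pairs in
  \<open>J\<close> being those that commute. The case a = b counts occurrences of single letters;
  \<open>J\<close> will contain no pair \<open>{a, a}\<close>.\<close>

definition proj_eq :: "'a set \<Rightarrow> 'a set set \<Rightarrow> 'a list \<Rightarrow> 'a list \<Rightarrow> bool" where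
  "proj_eq S J u v \<longleftrightarrow> (\<forall>a\<in>S. \<forall>b\<in>S. {a, b} \<notin> J \<longrightarrow>
     filter (\<lambda>c. c = a \<or> c = b) u = filter (\<lambda>c. c = a \<or> c = b) v)"

lemma braid_moves_context:
  "(y, z) \<in> (braid_moves G J)\<^sup>* \<Longrightarrow> (u @ y @ v, u @ z @ v) \<in> (braid_moves G J)\<^sup>*"
proof (induction rule: rtrancl_induct)
  case (step y z)
  from step(2) obtain u' v' r s m where
    "y = u' @ alternating r s m @ v'" "z = u' @ alternating s r m @ v'"
    "{r, s} \<in> J" "m = group.ord G (r \<otimes>\<^bsub>G\<^esub> s)" by (auto simp: braid_moves_def)
  hence "(u @ y @ v, u @ z @ v) \<in> braid_moves G J"
    by (simp add: braid_moves_def) (metis append.assoc)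
  thus ?case using step(3) by auto
qed simp

lemma last_append_in_set: "ys \<noteq> [] \<Longrightarrow> last (xs @ ys) \<in> set ys"
  by simp

text \<open>What the words require of the geometry: \<open>tl_swap\<close> makes the tiling
  invariant under J-moves, and \<open>tl_inj\<close> makes it determine the projections. These
  assumptions do not mention blocks, so they can be checked for (W, S) alone.\<close>

locale tiling_model = sign_partition +
  fixes J :: "'a set set" and Tl :: "'a \<Rightarrow> 't set" and tl :: "'a list \<Rightarrow> 't"
  assumes J_commute: "{a, b} \<in> J \<Longrightarrow> a \<in> S \<and> b \<in> S \<and> a \<noteq> b \<and> a \<otimes> b = b \<otimes> a"
    and tl_tiling: "w \<in> W \<Longrightarrow> r \<in> reduced_words G S w \<Longrightarrow> tl r \<in> Tl w"
    and tl_swap: "{a, b} \<in> J \<Longrightarrow> u \<in> lists S \<Longrightarrow> v \<in> lists S \<Longrightarrow> tl (u @ [a, b] @ v) = tl (u @ [b, a] @ v)"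
    and tl_inj: "w \<in> W \<Longrightarrow> r \<in> reduced_words G S w \<Longrightarrow> r' \<in> reduced_words G S w \<Longrightarrow> tl r = tl r' \<Longrightarrow>
           proj_eq S J r r'"
begin

abbreviation XG where "XG \<equiv> block_group G e \<Sigma>"
abbreviation K where "K \<equiv> block_relations G e J \<Sigma>"
abbreviation expand :: "'a set list \<Rightarrow> 'a list" where "expand ps \<equiv> concat (map e ps)"

definition J_indep :: "'a set \<Rightarrow> 'a set \<Rightarrow> bool" where
  "J_indep P Q \<longleftrightarrow> (\<forall>a\<in>P. \<forall>b\<in>Q. {a, b} \<in> J)"

lemma group_XG: "group XG"
  unfolding block_group_def
  by (rule subgroup.subgroup_is_group[OF generate_is_subgroup[OF T_closed] is_group])

lemma braid_moves_J:
  assumes "(y, z) \<in> braid_moves G J"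
  obtains u v a b where "y = u @ [a, b] @ v" "z = u @ [b, a] @ v" "{a, b} \<in> J"
proof -
  from assms obtain u v r s where
    *: "y = u @ alternating r s (ord (r \<otimes> s)) @ v" "z = u @ alternating s r (ord (r \<otimes> s)) @ v"
    "{r, s} \<in> J" by (auto simp: braid_moves_def)
  have "ord (r \<otimes> s) = 2"
    using J_commute[OF *(3)] by (intro ord_commuting_involutions) (auto simp: gens_square)
  thus ?thesis using * that by (simp add: numeral_2_eq_2)
qed

lemma tl_braid: "(y, z) \<in> (braid_moves G J)\<^sup>* \<Longrightarrow> y \<in> lists S \<Longrightarrow> z \<in> lists S \<and> tl y = tl z"
proof (induction rule: rtrancl_induct)
  case (step y z)
  obtain u v a b where "y = u @ [a, b] @ v" "z = u @ [b, a] @ v" "{a, b} \<in> J"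
    using step(2) by (rule braid_moves_J)
  thus ?case using step tl_swap[of a b u v] by auto
qed simp

lemma tl_shift_letter:
  "a \<in> S \<Longrightarrow> vs \<in> lists S \<Longrightarrow> u \<in> lists S \<Longrightarrow> v \<in> lists S \<Longrightarrow> (\<And>b. b \<in> set vs \<Longrightarrow> {a, b} \<in> J) \<Longrightarrow>
     tl (u @ a # vs @ v) = tl (u @ vs @ a # v)"
proof (induction vs arbitrary: u)
  case (Cons b vs)
  have "tl (u @ [a, b] @ (vs @ v)) = tl (u @ [b, a] @ (vs @ v))" using Cons.prems by (intro tl_swap) auto
  also have "\<dots> = tl ((u @ [b]) @ a # vs @ v)" by simp
  also have "\<dots> = tl ((u @ [b]) @ vs @ a # v)" using Cons.prems by (intro Cons.IH) auto
  finally show ?case by simp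
qed simp

lemma tl_shift:
  "us \<in> lists S \<Longrightarrow> vs \<in> lists S \<Longrightarrow> u \<in> lists S \<Longrightarrow> v \<in> lists S \<Longrightarrow> J_indep (set us) (set vs) \<Longrightarrow>
     tl (u @ us @ vs @ v) = tl (u @ vs @ us @ v)"
proof (induction us arbitrary: u)
  case (Cons a us)
  have "tl (u @ (a # us) @ vs @ v) = tl ((u @ [a]) @ us @ vs @ v)" by simp
  also have "\<dots> = tl ((u @ [a]) @ vs @ us @ v)" using Cons.prems by (intro Cons.IH) (auto simp: J_indep_def)
  also have "\<dots> = tl (u @ a # vs @ (us @ v))" by simp
  also have "\<dots> = tl (u @ vs @ a # (us @ v))"
    using Cons.prems by (intro tl_shift_letter) (auto simp: J_indep_def)
  finally show ?case by simp
qed simp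

lemma words_commute:
  "us \<in> lists S \<Longrightarrow> vs \<in> lists S \<Longrightarrow> J_indep (set us) (set vs) \<Longrightarrow>
     prod_of us \<otimes> prod_of vs = prod_of vs \<otimes> prod_of us"
proof (induction us)
  case (Cons a us)
  have a: "a \<in> S" "us \<in> lists S" using Cons by auto
  have "vs \<in> lists S \<Longrightarrow> (\<And>b. b \<in> set vs \<Longrightarrow> {a, b} \<in> J) \<Longrightarrow> a \<otimes> prod_of vs = prod_of vs \<otimes> a"
  proof (induction vs)
    case (Cons b vs)
    have b: "b \<in> S" "vs \<in> lists S" "a \<otimes> b = b \<otimes> a" using Cons J_commute by auto
    have "a \<otimes> prod_of (b # vs) = (a \<otimes> b) \<otimes> prod_of vs" using a b(1,2) by (simp add: m_assoc)
    also have "\<dots> = b \<otimes> (a \<otimes> prod_of vs)" unfolding b(3) using a b(1,2) by (simp add: m_assoc)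
    also have "a \<otimes> prod_of vs = prod_of vs \<otimes> a" using Cons b by auto
    finally show ?case using a b(1,2) by (simp add: m_assoc)
  qed (use a in simp)
  hence av: "a \<otimes> prod_of vs = prod_of vs \<otimes> a" using Cons.prems by (auto simp: J_indep_def)
  have IH: "prod_of us \<otimes> prod_of vs = prod_of vs \<otimes> prod_of us"
    using Cons by (auto simp: J_indep_def)
  have "prod_of (a # us) \<otimes> prod_of vs = a \<otimes> (prod_of us \<otimes> prod_of vs)"
    using a Cons.prems by (simp add: m_assoc)
  also have "\<dots> = (a \<otimes> prod_of vs) \<otimes> prod_of us" unfolding IH using a Cons.prems by (simp add: m_assoc)
  also have "\<dots> = prod_of vs \<otimes> prod_of (a # us)" unfolding av using a Cons.prems by (simp add: m_assoc)
  finally show ?case .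
qed simp

lemma e_lists: "P \<in> \<Sigma> \<Longrightarrow> e P \<in> lists S"
  using e_reduced by (auto simp: reduced_words_def)

lemma expand_lists: "ps \<in> lists \<Sigma> \<Longrightarrow> expand ps \<in> lists S"
  by (induction ps) (auto dest: e_lists)

lemma set_expand: "ps \<in> lists \<Sigma> \<Longrightarrow> set (expand ps) = \<Union> (set ps)"
  by (induction ps) (auto simp: e_set)

lemma prod_expand: "ps \<in> lists \<Sigma> \<Longrightarrow> prod_of (expand ps) = bprod ps"
proof (induction ps)
  case (Cons P ps)
  thus ?case using e_lists[of P] expand_lists[of ps] e_prod[of P] prod_of_append[of "e P" "expand ps"] by auto
qed simp

lemma length_expand: "ps \<in> lists \<Sigma> \<Longrightarrow> length (expand ps) = blen ps"
  by (induction ps) (auto simp: e_prod)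

lemma tau_commute:
  assumes "P \<in> \<Sigma>" "Q \<in> \<Sigma>" "J_indep P Q" shows "tau P \<otimes> tau Q = tau Q \<otimes> tau P"
  using words_commute[of "e P" "e Q"] assms e_lists e_prod e_set by auto

lemma J_indep_sym: "J_indep P Q \<Longrightarrow> J_indep Q P"
  unfolding J_indep_def by (metis insert_commute)

lemma K_iff: "{r, s} \<in> K \<longleftrightarrow> (\<exists>P\<in>\<Sigma>. \<exists>Q\<in>\<Sigma>. P \<noteq> Q \<and> r = tau P \<and> s = tau Q \<and> J_indep P Q)"
proof
  assume "{r, s} \<in> K"
  then obtain P Q where *: "{r, s} = {tau P, tau Q}" "P \<in> \<Sigma>" "Q \<in> \<Sigma>" "P \<noteq> Q" "J_indep P Q"
    unfolding block_relations_def J_indep_def by blast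
  from *(1) consider "r = tau P" "s = tau Q" | "r = tau Q" "s = tau P"
    by (auto simp: doubleton_eq_iff)
  thus "\<exists>P\<in>\<Sigma>. \<exists>Q\<in>\<Sigma>. P \<noteq> Q \<and> r = tau P \<and> s = tau Q \<and> J_indep P Q"
    using * J_indep_sym by metis
qed (auto simp: block_relations_def J_indep_def)

text \<open>The exponent is an order in \<open>block_group\<close>. Independent blocks have
  commuting block elements, distinct by \<open>tau_inj\<close>, so it is 2 and the move is a
  swap.\<close>

lemma braid_moves_K:
  "(y, z) \<in> braid_moves XG K \<longleftrightarrow>
     (\<exists>u v P Q. P \<in> \<Sigma> \<and> Q \<in> \<Sigma> \<and> P \<noteq> Q \<and> J_indep P Q \<and> y = u @ [tau P, tau Q] @ v \<and> z = u @ [tau Q, tau P] @ v)"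
proof -
  interpret XG: group XG by (rule group_XG)
  have ord: "XG.ord (tau P \<otimes>\<^bsub>XG\<^esub> tau Q) = 2" if "P \<in> \<Sigma>" "Q \<in> \<Sigma>" "P \<noteq> Q" "J_indep P Q" for P Q
  proof (intro XG.ord_commuting_involutions)
    show "tau P \<noteq> tau Q" using that tau_inj by blast
    show "tau P \<otimes>\<^bsub>XG\<^esub> tau Q = tau Q \<otimes>\<^bsub>XG\<^esub> tau P"
      using that tau_commute by (simp add: block_group_def)
  qed (use that tau_X in \<open>auto simp: block_group_def\<close>)
  show ?thesis
  proof
    assume "(y, z) \<in> braid_moves XG K"
    then obtain u v r s where
      *: "y = u @ alternating r s (XG.ord (r \<otimes>\<^bsub>XG\<^esub> s)) @ v" "z = u @ alternating s r (XG.ord (r \<otimes>\<^bsub>XG\<^esub> s)) @ v"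
      "{r, s} \<in> K" unfolding braid_moves_def by blast
    then obtain P Q where "P\<in>\<Sigma>" "Q\<in>\<Sigma>" "P \<noteq> Q" "r = tau P" "s = tau Q" "J_indep P Q"
      unfolding K_iff by blast
    thus "\<exists>u v P Q. P \<in> \<Sigma> \<and> Q \<in> \<Sigma> \<and> P \<noteq> Q \<and> J_indep P Q \<and> y = u @ [tau P, tau Q] @ v \<and> z = u @ [tau Q, tau P] @ v"
      using * ord[of P Q] by (auto simp: numeral_2_eq_2)
  next
    assume "\<exists>u v P Q. P \<in> \<Sigma> \<and> Q \<in> \<Sigma> \<and> P \<noteq> Q \<and> J_indep P Q \<and> y = u @ [tau P, tau Q] @ v \<and> z = u @ [tau Q, tau P] @ v"
    then obtain u v P Q where *: "P \<in> \<Sigma>" "Q \<in> \<Sigma>" "P \<noteq> Q" "J_indep P Q"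
      "y = u @ [tau P, tau Q] @ v" "z = u @ [tau Q, tau P] @ v" by blast
    have "{tau P, tau Q} \<in> K" unfolding K_iff using * by blast
    moreover have "y = u @ alternating (tau P) (tau Q) (XG.ord (tau P \<otimes>\<^bsub>XG\<^esub> tau Q)) @ v"
      "z = u @ alternating (tau Q) (tau P) (XG.ord (tau P \<otimes>\<^bsub>XG\<^esub> tau Q)) @ v"
      using * ord[of P Q] by (simp_all add: numeral_2_eq_2)
    ultimately show "(y, z) \<in> braid_moves XG K" unfolding braid_moves_def by blast
  qed
qed

text \<open>The classes consist of words of group elements, whereas expansion needs the blocks
  themselves; \<open>tau_inj\<close> allows them to be recovered.\<close>

definition blocks :: "'a list \<Rightarrow> 'a set list" where
  "blocks w = map (inv_into \<Sigma> tau) w"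

lemma blocks_map: "ps \<in> lists \<Sigma> \<Longrightarrow> blocks (map tau ps) = ps"
proof -
  have "inj_on tau \<Sigma>" using tau_inj by (auto simp: inj_on_def)
  thus "ps \<in> lists \<Sigma> \<Longrightarrow> blocks (map tau ps) = ps"
    by (induction ps) (auto simp: blocks_def)
qed

text \<open>A move of \<open>K\<close> interchanges two adjacent expansions, every letter of one
  being related by \<open>J\<close> to every letter of the other.\<close>

lemma tl_K_moves:
  assumes "(map tau ps, w) \<in> (braid_moves XG K)\<^sup>*" "ps \<in> lists \<Sigma>"
  shows "\<exists>qs \<in> lists \<Sigma>. w = map tau qs \<and> tl (expand ps) = tl (expand qs)"
  using assms(1)
proof (induction rule: rtrancl_induct)
  case base thus ?case using assms by auto
next
  case (step w z)
  then obtain qs where qs: "qs \<in> lists \<Sigma>" "w = map tau qs" "tl (expand ps) = tl (expand qs)" by auto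
  obtain u v P Q where *: "P \<in> \<Sigma>" "Q \<in> \<Sigma>" "J_indep P Q"
    "w = u @ [tau P, tau Q] @ v" "z = u @ [tau Q, tau P] @ v"
    using step(2) unfolding braid_moves_K by blast
  from *(4) qs(2) obtain us P' Q' vs where uv: "qs = us @ P' # Q' # vs" "u = map tau us" "v = map tau vs"
    "tau P' = tau P" "tau Q' = tau Q"
    by (force simp: append_eq_map_conv map_eq_append_conv map_eq_Cons_conv)
  have l: "us \<in> lists \<Sigma>" "vs \<in> lists \<Sigma>" "P' \<in> \<Sigma>" "Q' \<in> \<Sigma>" using uv qs by auto
  hence [simp]: "P' = P" "Q' = Q" using tau_inj uv * by blast+
  have "tl (expand us @ e P @ e Q @ expand vs) = tl (expand us @ e Q @ e P @ expand vs)"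
    using l * expand_lists e_lists e_set by (intro tl_shift) auto
  hence "tl (expand qs) = tl (expand (us @ [Q, P] @ vs))" by (simp add: uv)
  thus ?case using l * qs uv by (intro bexI[of _ "us @ [Q, P] @ vs"]) auto
qed

text \<open>Let \<open>Q\<close> be the last block of \<open>qs\<close>, and take its last
  occurrence in \<open>ps\<close>. Every later block is independent of \<open>Q\<close>, for
  otherwise some projections of the two expansions would end in different letters. So
  \<open>Q\<close> can be moved to the end and cancelled, and the projections stay equal.\<close>

lemma proj_eq_K_equiv:
  "ps \<in> lists \<Sigma> \<Longrightarrow> qs \<in> lists \<Sigma> \<Longrightarrow> proj_eq S J (expand ps) (expand qs) \<Longrightarrow>
     (map tau ps, map tau qs) \<in> (braid_moves XG K)\<^sup>*"
proof (induction qs arbitrary: ps rule: rev_induct)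
  case Nil
  have "ps = []"
  proof (rule ccontr)
    assume "ps \<noteq> []"
    then obtain P ps' where ps: "ps = P # ps'" by (cases ps) auto
    then obtain s where s: "s \<in> P" "s \<in> S" "P \<in> \<Sigma>" using block_nonempty[of P] block_subset[of P] Nil by auto
    \<comment> \<open>The diagonal projection counts the occurrences of one letter.\<close>
    have "{s, s} \<notin> J" using J_commute[of s s] by blast
    hence "filter (\<lambda>c. c = s \<or> c = s) (expand ps) = filter (\<lambda>c. c = s \<or> c = s) (expand [])"
      using Nil(3) s(2) unfolding proj_eq_def by blast
    hence "filter (\<lambda>c. c = s) (expand ps) = []" by simp
    moreover have "s \<in> set (expand ps)" using s ps e_set by auto
    ultimately show False by (auto simp: filter_empty_conv)
  qed
  thus ?case by simp
next
  case (snoc Q qs)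
  have l: "Q \<in> \<Sigma>" "qs \<in> lists \<Sigma>" using snoc by auto
  obtain b where b: "b \<in> Q" "b \<in> S" using block_nonempty block_subset l by blast
  have "{b, b} \<notin> J" using J_commute[of b b] by blast
  hence "filter (\<lambda>c. c = b \<or> c = b) (expand ps) = filter (\<lambda>c. c = b \<or> c = b) (expand (qs @ [Q]))"
    using snoc b unfolding proj_eq_def by blast
  moreover have "b \<in> set (filter (\<lambda>c. c = b \<or> c = b) (expand (qs @ [Q])))"
    using b l e_set by auto
  ultimately have "b \<in> set (expand ps)" by (metis (no_types) filter_is_subset subsetD)
  then obtain P where "P \<in> set ps" "b \<in> P" unfolding set_expand[OF snoc.prems(1)] by auto
  hence "Q \<in> set ps" using block_disjoint[of P Q b] b l snoc by auto
  then obtain us vs where ps: "ps = us @ Q # vs" "Q \<notin> set vs" by (metis split_list_last)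
  have l': "us \<in> lists \<Sigma>" "vs \<in> lists \<Sigma>" using ps snoc by auto
  have indep: "J_indep P Q" if P: "P \<in> set vs" for P
    unfolding J_indep_def
  proof (intro ballI, rule ccontr)
    fix a b assume ab: "a \<in> P" "b \<in> Q" "{a, b} \<notin> J"
    have P': "P \<in> \<Sigma>" "P \<noteq> Q" using P l' ps by auto
    have S: "a \<in> S" "b \<in> S" using ab P' l block_subset by auto
    let ?f = "filter (\<lambda>c. c = a \<or> c = b)"
    have eq: "?f (expand ps) = ?f (expand (qs @ [Q]))" using snoc S ab unfolding proj_eq_def by blast
    have a: "a \<notin> set (e Q)" using ab P' l block_disjoint[of P Q a] unfolding e_set[OF l(1)] by blast
    have b: "b \<notin> set (expand vs)" 
    proof
      assume "b \<in> set (expand vs)"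
      then obtain R where R: "R \<in> set vs" "b \<in> R" unfolding set_expand[OF l'(2)] by auto
      hence "R = Q" using l l' ab block_disjoint[of R Q b] by auto
      thus False using R ps by simp
    qed
    \<comment> \<open>In the expansion of \<open>qs @ [Q]\<close> the projection ends within
      \<open>e Q\<close>, which contains \<open>b\<close> but not \<open>a\<close>; for
      \<open>ps\<close> it ends within the expansion of \<open>vs\<close>, which contains
      \<open>a\<close> but not \<open>b\<close>.\<close>
    have "b \<in> set (?f (e Q))" using ab unfolding set_filter e_set[OF l(1)] by simp
    hence "?f (e Q) \<noteq> []" by (metis empty_iff empty_set)
    hence "last (?f (expand qs) @ ?f (e Q)) \<in> set (?f (e Q))" by (rule last_append_in_set)
    moreover have "?f (expand ps) = ?f (expand qs) @ ?f (e Q)" unfolding eq by simp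
    ultimately have lastQ: "last (?f (expand ps)) \<in> set (?f (e Q))" by (simp only:)
    have "a \<in> set (?f (expand vs))" using ab P unfolding set_filter set_expand[OF l'(2)] by blast
    hence "?f (expand vs) \<noteq> []" by (metis empty_iff empty_set)
    hence "last (?f (expand (us @ [Q])) @ ?f (expand vs)) \<in> set (?f (expand vs))"
      by (rule last_append_in_set)
    moreover have "?f (expand ps) = ?f (expand (us @ [Q])) @ ?f (expand vs)" unfolding ps by simp
    ultimately have "last (?f (expand ps)) \<in> set (?f (expand vs))" by (simp only:)
    thus False using lastQ a b by auto
  qed
  have move: "vs' \<in> lists \<Sigma> \<Longrightarrow> (\<And>P. P \<in> set vs' \<Longrightarrow> J_indep P Q \<and> P \<noteq> Q) \<Longrightarrow>
      (u @ tau Q # map tau vs', u @ map tau vs' @ [tau Q]) \<in> (braid_moves XG K)\<^sup>*" for u vs'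
  proof (induction vs' arbitrary: u)
    case (Cons P vs')
    have "J_indep Q P" "P \<in> \<Sigma>" "Q \<noteq> P" using Cons J_indep_sym by auto
    hence "(u @ [tau Q, tau P] @ map tau vs', u @ [tau P, tau Q] @ map tau vs') \<in> braid_moves XG K"
      unfolding braid_moves_K using l by blast
    moreover have "((u @ [tau P]) @ tau Q # map tau vs', (u @ [tau P]) @ map tau vs' @ [tau Q])
       \<in> (braid_moves XG K)\<^sup>*"
      using Cons.prems by (intro Cons.IH) auto
    ultimately show ?case by (simp add: converse_rtrancl_into_rtrancl)
  qed simp
  have "(map tau ps, map tau (us @ vs) @ [tau Q]) \<in> (braid_moves XG K)\<^sup>*"
    using move[of vs "map tau us"] l' indep ps by auto
  moreover have "proj_eq S J (expand (us @ vs)) (expand qs)"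
    unfolding proj_eq_def
  proof (intro ballI impI)
    fix a b assume ab: "a \<in> S" "b \<in> S" "{a, b} \<notin> J"
    let ?f = "filter (\<lambda>c. c = a \<or> c = b)"
    have eq: "?f (expand ps) = ?f (expand (qs @ [Q]))" using snoc ab unfolding proj_eq_def by blast
    \<comment> \<open>All letters of \<open>Q\<close> are related by \<open>J\<close> to all letters
      of \<open>vs\<close>, so a pair outside \<open>J\<close> cannot meet both; hence the move of
      \<open>Q\<close> is invisible to this projection.\<close>
    have "?f (e Q) = [] \<or> ?f (expand vs) = []"
    proof (rule ccontr)
      assume "\<not> ?thesis"
      then obtain c d where cd: "c \<in> set (e Q)" "c = a \<or> c = b" "d \<in> set (expand vs)" "d = a \<or> d = b"
        by (auto simp: filter_empty_conv)
      from cd(3) obtain P where "P \<in> set vs" "d \<in> P" unfolding set_expand[OF l'(2)] by blast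
      hence "{d, c} \<in> J" using indep[of P] cd(1) unfolding e_set[OF l(1)] J_indep_def by blast
      moreover from this have "d \<noteq> c" using J_commute by blast
      ultimately show False using cd ab by (auto simp: insert_commute)
    qed
    hence "?f (e Q @ expand vs) = ?f (expand vs @ e Q)" by auto
    hence "?f (expand (us @ vs)) @ ?f (e Q) = ?f (expand ps)" by (simp add: ps)
    also have "\<dots> = ?f (expand qs) @ ?f (e Q)" by (simp add: eq)
    finally show "?f (expand (us @ vs)) = ?f (expand qs)" by simp
  qed
  hence "(map tau (us @ vs), map tau qs) \<in> (braid_moves XG K)\<^sup>*"
    using l l' by (intro snoc.IH) auto
  hence "([] @ map tau (us @ vs) @ [tau Q], [] @ map tau qs @ [tau Q]) \<in> (braid_moves XG K)\<^sup>*"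
    by (rule braid_moves_context)
  ultimately show ?case by (simp add: rtrancl_trans)
qed

lemma reduced_XG: "reduced_words XG T x = reduced_words G T x"
  by (simp add: reduced_words_def word_length_def word_prod_def block_group_def)

lemma reduced_T:
  assumes "w \<in> reduced_words G T x"
  obtains ps where "ps \<in> lists \<Sigma>" "w = map tau ps" "bprod ps = x"
    "expand ps \<in> reduced_words G S x" "consistent_word G S J e \<Sigma> (expand ps)"
proof -
  obtain ps where ps: "ps \<in> lists \<Sigma>" "w = map tau ps" "bprod ps = x"
    using assms T_word[of w] by (auto simp: reduced_words_def)
  have "len (bprod ps) = blen ps" using T_reduced_additive ps assms by auto
  hence "expand ps \<in> reduced_words G S x"
    using ps expand_lists prod_expand length_expand by (simp add: reduced_words_def)
  moreover have "consistent_word G S J e \<Sigma> (expand ps)"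
    unfolding consistent_word_def word_equiv_def using ps e_reduced
    by (intro exI[of _ "map e ps"]) auto
  ultimately show ?thesis using that ps by blast
qed

text \<open>Replacing each factor by the understood expression of its block costs only J-moves. The
  total length is that of the reduced word \<open>r\<close>, so the lengths of the blocks add up and
  \<open>additive_T_reduced\<close> applies.\<close>

lemma consistent_T_word:
  assumes "r \<in> reduced_words G S x" "consistent_word G S J e \<Sigma> r"
  obtains ps where "ps \<in> lists \<Sigma>" "map tau ps \<in> reduced_words G T x" "tl r = tl (expand ps)"
proof -
  obtain ys where ys: "r = concat ys" "\<And>y. y \<in> set ys \<Longrightarrow> \<exists>P\<in>\<Sigma>. y \<in> reduced_words G S (tau P) \<and>
      (e P, y) \<in> word_equiv G S J (tau P)"
    using assms(2) unfolding consistent_word_def by blast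
  have "(\<And>y. y \<in> set ys \<Longrightarrow> \<exists>P\<in>\<Sigma>. y \<in> reduced_words G S (tau P) \<and> (e P, y) \<in> word_equiv G S J (tau P)) \<Longrightarrow>
    \<exists>ps \<in> lists \<Sigma>. bprod ps = prod_of (concat ys) \<and> blen ps = length (concat ys) \<and> concat ys \<in> lists S \<and>
       (expand ps, concat ys) \<in> (braid_moves G J)\<^sup>*"
  proof (induction ys)
    case Nil thus ?case by (intro bexI[of _ "[]"]) auto
  next
    case (Cons y ys)
    have "\<exists>ps \<in> lists \<Sigma>. bprod ps = prod_of (concat ys) \<and> blen ps = length (concat ys) \<and>
        concat ys \<in> lists S \<and> (expand ps, concat ys) \<in> (braid_moves G J)\<^sup>*"
      by (rule Cons.IH, rule Cons.prems) simp
    then obtain ps where ps: "ps \<in> lists \<Sigma>" "bprod ps = prod_of (concat ys)" "blen ps = length (concat ys)"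
      "concat ys \<in> lists S" "(expand ps, concat ys) \<in> (braid_moves G J)\<^sup>*" by blast
    obtain P where P: "P \<in> \<Sigma>" "y \<in> reduced_words G S (tau P)" "(e P, y) \<in> word_equiv G S J (tau P)"
      using Cons(2)[of y] by auto
    have y: "y \<in> lists S" "prod_of y = tau P" "length y = len (tau P)" "(e P, y) \<in> (braid_moves G J)\<^sup>*"
      using P by (auto simp: reduced_words_def word_equiv_def)
    have "([] @ e P @ expand ps, [] @ y @ expand ps) \<in> (braid_moves G J)\<^sup>*"
      using y(4) by (rule braid_moves_context)
    moreover have "(y @ expand ps @ [], y @ concat ys @ []) \<in> (braid_moves G J)\<^sup>*"
      using ps(5) by (rule braid_moves_context)
    ultimately have "(expand (P # ps), concat (y # ys)) \<in> (braid_moves G J)\<^sup>*"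
      by (simp add: rtrancl_trans)
    thus ?case using P y ps by (intro bexI[of _ "P # ps"]) (auto simp: prod_of_append)
  qed
  then obtain ps where ps: "ps \<in> lists \<Sigma>" "bprod ps = prod_of r" "blen ps = length r"
    "(expand ps, r) \<in> (braid_moves G J)\<^sup>*" using ys by auto
  have r: "prod_of r = x" "length r = len x" using assms(1) by (auto simp: reduced_words_def)
  have "map tau ps \<in> reduced_words G T (bprod ps)"
    using ps r by (intro additive_T_reduced) auto
  moreover have "tl (expand ps) = tl r" using tl_braid[OF ps(4) expand_lists[OF ps(1)]] by simp
  ultimately show ?thesis using that ps r by auto
qed

text \<open>A word over \<open>T\<close> is sent to the tiling of its expansion. K-equivalence is
  the kernel of this map, and the consistent tilings are its image.\<close>

theorem word_classes_bij_tilings: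
  assumes "x \<in> X"
  shows "\<exists>f. bij_betw f (word_classes XG T K x) (consistent_tilings G S J e \<Sigma> Tl tl x)"
proof -
  define A where "A = reduced_words G T x"
  define F where "F w = tl (expand (blocks w))" for w
  have xW: "x \<in> W" using assms X_W by simp
  have img: "F ` A = consistent_tilings G S J e \<Sigma> Tl tl x"
  proof (intro equalityI subsetI)
    fix \<tau> assume "\<tau> \<in> F ` A"
    then obtain w where w: "w \<in> A" "\<tau> = F w" by auto
    then obtain ps where ps: "ps \<in> lists \<Sigma>" "w = map tau ps"
      "expand ps \<in> reduced_words G S x" "consistent_word G S J e \<Sigma> (expand ps)"
      unfolding A_def by (metis reduced_T)
    thus "\<tau> \<in> consistent_tilings G S J e \<Sigma> Tl tl x"
      using w xW tl_tiling by (auto simp: consistent_tilings_def F_def blocks_map)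
  next
    fix \<tau> assume "\<tau> \<in> consistent_tilings G S J e \<Sigma> Tl tl x"
    then obtain r where r: "r \<in> reduced_words G S x" "consistent_word G S J e \<Sigma> r" "\<tau> = tl r"
      by (auto simp: consistent_tilings_def)
    then obtain ps where ps: "ps \<in> lists \<Sigma>" "map tau ps \<in> reduced_words G T x" "tl r = tl (expand ps)"
      by (metis consistent_T_word)
    thus "\<tau> \<in> F ` A" using r by (intro image_eqI[of _ _ "map tau ps"]) (auto simp: A_def F_def blocks_map)
  qed
  have "(u, v) \<in> (braid_moves XG K)\<^sup>* \<longleftrightarrow> F u = F v" if uv: "u \<in> A" "v \<in> A" for u v
  proof -
    obtain ps where ps: "ps \<in> lists \<Sigma>" "u = map tau ps" "expand ps \<in> reduced_words G S x"
      using uv(1) unfolding A_def by (metis reduced_T)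
    obtain qs where qs: "qs \<in> lists \<Sigma>" "v = map tau qs" "expand qs \<in> reduced_words G S x"
      using uv(2) unfolding A_def by (metis reduced_T)
    show ?thesis
    proof
      assume "(u, v) \<in> (braid_moves XG K)\<^sup>*"
      then obtain qs' where qs': "qs' \<in> lists \<Sigma>" "v = map tau qs'" "tl (expand ps) = tl (expand qs')"
        using tl_K_moves[OF _ ps(1)] ps by blast
      hence "qs' = qs" using qs blocks_map by metis
      thus "F u = F v" using ps qs qs' by (simp add: F_def blocks_map)
    next
      assume "F u = F v"
      hence "tl (expand ps) = tl (expand qs)" using ps qs by (simp add: F_def blocks_map)
      hence "proj_eq S J (expand ps) (expand qs)" using ps qs xW tl_inj by blast
      thus "(u, v) \<in> (braid_moves XG K)\<^sup>*" using ps qs proj_eq_K_equiv by simp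
    qed
  qed
  hence "word_equiv XG T K x = {(u, v). u \<in> A \<and> v \<in> A \<and> F u = F v}"
    unfolding word_equiv_def reduced_XG A_def[symmetric] by blast
  from quotient_kernel_bij[OF this] show ?thesis
    by (simp add: word_classes_def reduced_XG img flip: A_def)
qed

end

section \<open>Monotone paths\<close>


text \<open>The open sets \<open>U\<close> and \<open>V\<close> are disjoint and cover the
  complement of \<open>C\<close>. A component that meets \<open>U\<close> stays in the bounded set
  \<open>U\<close>, whereas from a point of \<open>V\<close> a horizontal ray escapes to infinity
  without meeting \<open>C\<close>. The graphs may touch anywhere, so degenerate polygons are
  included.\<close>

lemma inside_between_graphs:
  fixes h :: "complex \<Rightarrow> real" and f g :: "real \<Rightarrow> real"
  assumes h: "h = Im \<or> h = (\<lambda>z. - Im z)"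
    and cont: "continuous_on UNIV f" "continuous_on UNIV g"
    and le: "\<And>t. f t \<le> g t" and ends: "f a = g a" "f b = g b"
  defines "C \<equiv> {z. a \<le> h z \<and> h z \<le> b \<and> (Re z = f (h z) \<or> Re z = g (h z))}"
  shows "inside C = {z. a \<le> h z \<and> h z \<le> b \<and> f (h z) < Re z \<and> Re z < g (h z)}"
proof -
  define U where "U = {z. a < h z \<and> h z < b \<and> f (h z) < Re z \<and> Re z < g (h z)}"
  define V where "V = {z. h z < a} \<union> {z. b < h z} \<union> {z. Re z < f (h z)} \<union> {z. g (h z) < Re z}"
  have hc: "continuous_on UNIV h" using h by (auto intro!: continuous_intros)
  have fc: "continuous_on UNIV (\<lambda>z. f (h z))" "continuous_on UNIV (\<lambda>z. g (h z))"
    using continuous_on_compose2[OF cont(1) hc] continuous_on_compose2[OF cont(2) hc] by auto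
  have Rc: "continuous_on UNIV Re" by (intro continuous_intros)
  have "U = {z. a < h z} \<inter> {z. h z < b} \<inter> {z. f (h z) < Re z} \<inter> {z. Re z < g (h z)}"
    by (auto simp: U_def)
  also have "open \<dots>"
    by (intro open_Int open_Collect_less hc fc Rc continuous_on_const)
  finally have "open U" .
  have "open V" unfolding V_def
    by (intro open_Un open_Collect_less hc fc Rc continuous_on_const)
  \<comment> \<open>The graphs meet at the heights \<open>a\<close> and \<open>b\<close>, so no
    point lies strictly between them there.\<close>
  have U_eq: "U = {z. a \<le> h z \<and> h z \<le> b \<and> f (h z) < Re z \<and> Re z < g (h z)}"
    using ends by (auto simp: U_def order.strict_iff_order)
  have UV: "U \<inter> V = {}" by (auto simp: U_def V_def)
  have cover: "- C \<subseteq> U \<union> V"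
  proof
    fix z assume "z \<in> - C"
    thus "z \<in> U \<union> V" by (auto simp: C_def U_eq V_def not_less not_le)
  qed
  have VC: "V \<inter> C = {}" 
  proof -
    { fix z assume "z \<in> V" "z \<in> C"
      hence False using le[of "h z"] by (auto simp: V_def C_def) }
    thus ?thesis by blast
  qed
  have UC: "U \<inter> C = {}" by (auto simp: U_def C_def)
  have "bounded U"
  proof -
    have "bounded (k ` {a..b})" if "continuous_on UNIV k" for k :: "real \<Rightarrow> real"
      by (rule compact_imp_bounded[OF compact_continuous_image[OF
            continuous_on_subset[OF that subset_UNIV] compact_Icc]])
    hence "bounded (f ` {a..b})" "bounded (g ` {a..b})" using cont by blast+
    then obtain B1 B2 where "\<forall>x\<in>f ` {a..b}. norm x \<le> B1" "\<forall>x\<in>g ` {a..b}. norm x \<le> B2"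
      unfolding bounded_iff by blast
    hence B: "\<bar>f t\<bar> \<le> B1" "\<bar>g t\<bar> \<le> B2" if "t \<in> {a..b}" for t
      using that by auto
    have "norm z \<le> (B1 + B2) + (\<bar>a\<bar> + \<bar>b\<bar>)" if "z \<in> U" for z
    proof -
      have "\<bar>Re z\<bar> \<le> B1 + B2" "\<bar>h z\<bar> \<le> \<bar>a\<bar> + \<bar>b\<bar>"
        using that B[of "h z"] by (auto simp: U_def)
      moreover have "\<bar>h z\<bar> = \<bar>Im z\<bar>" using h by auto
      ultimately show ?thesis using cmod_le[of z] by linarith
    qed
    thus ?thesis by (auto simp: bounded_iff)
  qed
  show ?thesis unfolding U_eq[symmetric]
  proof
    show "U \<subseteq> inside C"
    proof
      fix z assume z: "z \<in> U"
      let ?K = "connected_component_set (- C) z"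
      have "connected ?K" by simp
      moreover have "?K \<subseteq> U \<union> V" using cover connected_component_subset by blast
      moreover have "z \<in> ?K" using z UC by (auto intro: connected_component_refl)
      ultimately have "?K \<inter> V = {}"
        using connectedD[OF _ \<open>open U\<close> \<open>open V\<close>, of ?K] UV z by blast
      hence "?K \<subseteq> U" using \<open>?K \<subseteq> U \<union> V\<close> by blast
      thus "z \<in> inside C" using z UC \<open>bounded U\<close> bounded_subset by (auto simp: inside_def)
    qed
    show "inside C \<subseteq> U"
    proof
      fix z assume z: "z \<in> inside C"
      show "z \<in> U"
      proof (rule ccontr)
        assume "z \<notin> U"
        hence zV: "z \<in> V" using z cover by (auto simp: inside_def)
        \<comment> \<open>The ray keeps its height; it runs to the left from points left of
          \<open>f\<close> and to the right from all other points of \<open>V\<close>.\<close>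
        obtain s :: real where s: "s = 1 \<or> s = -1" "\<And>r. 0 \<le> r \<Longrightarrow> z + of_real (s * r) \<in> V"
        proof (cases "Re z < f (h z)")
          case True
          show ?thesis by (rule that[of "-1"]) (use True h in \<open>auto simp: V_def\<close>)
        next
          case False
          show ?thesis by (rule that[of 1]) (use False h zV in \<open>auto simp: V_def\<close>)
        qed
        let ?R = "(\<lambda>r. z + of_real (s * r)) ` {0..}"
        have "connected ?R" by (intro connected_continuous_image continuous_intros) auto
        moreover have "?R \<subseteq> - C" using s(2) VC by auto
        moreover have "z \<in> ?R" by (rule image_eqI[of _ _ 0]) auto
        ultimately have "?R \<subseteq> connected_component_set (- C) z"
          by (intro connected_component_maximal)
        moreover have "\<not> bounded ?R"
        proof
          assume "bounded ?R"
          then obtain B where B: "\<And>w. w \<in> ?R \<Longrightarrow> norm w \<le> B" by (auto simp: bounded_iff)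
          have B0: "0 \<le> B" using B[OF \<open>z \<in> ?R\<close>] norm_ge_zero order_trans by blast
          define r where "r = B + norm z + 1"
          have "norm (z + of_real (s * r)) \<le> B" using B0 by (intro B imageI) (auto simp: r_def)
          moreover have "norm (of_real (s * r) :: complex) = r"
            using s(1) B0 norm_ge_zero[of z] by (auto simp: r_def norm_of_real simp del: norm_ge_zero of_real_mult of_real_add of_real_1 of_real_minus)
          moreover have "norm (of_real (s * r) :: complex) \<le> norm (z + of_real (s * r)) + norm z"
            using norm_triangle_ineq4[of "z + of_real (s * r)" z] by simp
          ultimately show False by (simp add: r_def)
        qed
        ultimately show False using z bounded_subset by (auto simp: inside_def)
      qed
    qed
  qed
qed

lemma polyline_Cons: "polyline p (d # ds) = closed_segment p (p + d) \<union> polyline (p + d) ds"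
proof -
  have v: "path_vertex p (d # ds) (Suc k) = path_vertex (p + d) ds k" for k
    by (simp add: path_vertex_def add.assoc)
  have v0: "path_vertex q es 0 = q" for q es by (simp add: path_vertex_def)
  show ?thesis
    by (simp add: polyline_def lessThan_Suc_eq_insert_0 v v0 UN_extend_simps(10))
qed

lemma polyline_snoc:
  "polyline p (ds @ [d]) = polyline p ds \<union> closed_segment (p + sum_list ds) (p + sum_list ds + d)"
proof (induction ds arbitrary: p)
  case Nil
  show ?case unfolding append_Nil polyline_Cons by (simp add: polyline_def)
next
  case (Cons c ds)
  show ?case unfolding append_Cons polyline_Cons Cons by (simp add: add.assoc Un_assoc)
qed

text \<open>Megatiles are read from the top, while paths of type D run upwards; this translates
  between the two.\<close>

lemma polyline_rev: "polyline (p + sum_list ds) (rev (map uminus ds)) = polyline p ds"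
proof (induction ds arbitrary: p)
  case (Cons d ds)
  have sum: "sum_list (map uminus ds) = - sum_list ds"
    by (induction ds) auto
  have "polyline (p + sum_list (d # ds)) (rev (map uminus (d # ds))) =
     polyline (p + d + sum_list ds) (rev (map uminus ds)) \<union> closed_segment (p + d) p"
    by (simp add: polyline_snoc sum add.assoc)
  thus ?case by (simp only: Cons polyline_Cons closed_segment_commute[of "p + d"] Un_commute)
qed (simp add: polyline_def)

text \<open>Paths of type A run downwards, paths of type D upwards: \<open>h\<close> is the height in the direction
  of travel.\<close>

locale height =
  fixes h :: "complex \<Rightarrow> real"
  assumes h_cases: "h = Im \<or> h = (\<lambda>z. - Im z)"
begin

lemma h_add [simp]: "h (x + y) = h x + h y" using h_cases by auto
lemma h_zero [simp]: "h 0 = 0" using h_cases by auto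
lemma h_scaleR [simp]: "h (r *\<^sub>R z) = r * h z" using h_cases by auto
lemma h_of_real [simp]: "h (complex_of_real r) = 0" using h_cases by auto

lemma ex_point: "\<exists>z. Re z = x \<and> h z = t"
  using h_cases by (auto intro: exI[of _ "Complex x t"] exI[of _ "Complex x (- t)"])

lemma point_eqI: "Re z = Re w \<Longrightarrow> h z = h w \<Longrightarrow> z = w"
  using h_cases by (auto simp: complex_eq_iff)

definition up :: "complex list \<Rightarrow> bool" where
  "up ds \<longleftrightarrow> (\<forall>d\<in>set ds. 0 < h d)"

lemma up_simps [simp]:
  "up []" "up (d # ds) \<longleftrightarrow> 0 < h d \<and> up ds" "up (ds @ es) \<longleftrightarrow> up ds \<and> up es"
  by (auto simp: up_def)

lemma up_take: "up ds \<Longrightarrow> up (take n ds)" and up_drop: "up ds \<Longrightarrow> up (drop n ds)"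
  by (auto simp: up_def dest: in_set_takeD in_set_dropD)

lemma up_sum_nonneg: "up ds \<Longrightarrow> 0 \<le> h (sum_list ds)"
  by (induction ds) auto

lemma up_sum_pos: "up ds \<Longrightarrow> ds \<noteq> [] \<Longrightarrow> 0 < h (sum_list ds)"
  using up_sum_nonneg by (cases ds) (auto simp: add_pos_nonneg)

text \<open>The horizontal displacement at height \<open>t\<close> along the path that starts at height \<open>y\<close>.\<close>

fun offs :: "real \<Rightarrow> complex list \<Rightarrow> real \<Rightarrow> real" where
  "offs y [] t = 0"
| "offs y (d # ds) t = Re d / h d * max 0 (min (h d) (t - y)) + offs (y + h d) ds t"

lemma offs_append: "offs y (xs @ ys) t = offs y xs t + offs (y + h (sum_list xs)) ys t"
  by (induction xs arbitrary: y) (auto simp: add.assoc)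

lemma offs_shift: "offs y ds t = offs 0 ds (t - y)"
proof (induction ds arbitrary: y t)
  case (Cons d ds)
  show ?case using Cons[of "y + h d" t] Cons[of "h d" "t - y"] by (simp add: algebra_simps)
qed simp

lemma offs_below: "up ds \<Longrightarrow> t \<le> y \<Longrightarrow> offs y ds t = 0"
  by (induction ds arbitrary: y) auto

lemma offs_above: "up ds \<Longrightarrow> y + h (sum_list ds) \<le> t \<Longrightarrow> offs y ds t = Re (sum_list ds)"
proof (induction ds arbitrary: y)
  case (Cons d ds)
  thus ?case using up_sum_nonneg[of ds] by (simp add: add.assoc min_def max_def)
qed simp

lemma continuous_offs: "continuous_on UNIV (offs y ds)"
proof (induction ds arbitrary: y)
  case (Cons d ds)
  show ?case unfolding offs.simps by (intro continuous_intros Cons)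
qed simp

lemma segment_graph:
  assumes "0 < h d"
  shows "closed_segment p (p + d) =
    {z. h p \<le> h z \<and> h z \<le> h p + h d \<and> Re z = Re p + Re d / h d * (h z - h p)}"
proof (intro equalityI subsetI)
  fix z assume "z \<in> closed_segment p (p + d)"
  then obtain u where u: "0 \<le> u" "u \<le> 1" "z = (1 - u) *\<^sub>R p + u *\<^sub>R (p + d)"
    by (auto simp: closed_segment_def)
  hence z: "z = p + u *\<^sub>R d" by (simp add: algebra_simps)
  have "u * h d \<le> 1 * h d" using u assms by (intro mult_right_mono) auto
  thus "z \<in> {z. h p \<le> h z \<and> h z \<le> h p + h d \<and> Re z = Re p + Re d / h d * (h z - h p)}"
    using u(1,2) assms unfolding z by simp
next
  fix z assume z: "z \<in> {z. h p \<le> h z \<and> h z \<le> h p + h d \<and> Re z = Re p + Re d / h d * (h z - h p)}"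
  define u where "u = (h z - h p) / h d"
  have u: "0 \<le> u" "u \<le> 1" using z assms by (auto simp: u_def)
  have "z = (1 - u) *\<^sub>R p + u *\<^sub>R (p + d)"
    using z assms by (intro point_eqI) (auto simp: u_def field_simps)
  thus "z \<in> closed_segment p (p + d)" using u by (auto simp: closed_segment_def)
qed

text \<open>An edge contributes nothing to \<open>offs\<close> below its start and its full
  displacement above its end, so the linear pieces fit together into one function of the
  height.\<close>

lemma polyline_graph:
  "up ds \<Longrightarrow> ds \<noteq> [] \<Longrightarrow> polyline p ds =
     {z. h p \<le> h z \<and> h z \<le> h p + h (sum_list ds) \<and> Re z = Re p + offs (h p) ds (h z)}"
proof (induction ds arbitrary: p)
  case (Cons d ds)
  have d: "0 < h d" "up ds" using Cons by auto
  have seg: "z \<in> closed_segment p (p + d) \<longleftrightarrow>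
      h p \<le> h z \<and> h z \<le> h p + h d \<and> Re z = Re p + offs (h p) (d # ds) (h z)" for z
  proof (cases "h z \<le> h p + h d")
    case True
    thus ?thesis using d offs_below[of ds "h z" "h p + h d"]
      by (cases "h z = h p + h d") (auto simp: segment_graph min_def max_def)
  qed (use d in \<open>simp add: segment_graph\<close>)
  show ?case
  proof (cases "ds = []")
    case True
    have "polyline p (d # ds) = closed_segment p (p + d)"
      unfolding polyline_Cons True by (simp add: polyline_def)
    thus ?thesis unfolding set_eq_iff seg mem_Collect_eq by (simp add: seg True)
  next
    case False
    have "z \<in> polyline (p + d) ds \<longleftrightarrow> h p + h d \<le> h z \<and> h z \<le> h p + h (sum_list (d # ds)) \<and>
        Re z = Re p + offs (h p) (d # ds) (h z)" for z
    proof (cases "h p + h d \<le> h z")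
      case True
      hence "offs (h p) (d # ds) (h z) = Re d + offs (h p + h d) ds (h z)"
        using d by (simp add: min_def max_def)
      thus ?thesis unfolding Cons.IH[OF d(2) False, of "p + d"] mem_Collect_eq
        using True by (simp add: add.assoc)
    qed (simp add: Cons.IH[OF d(2) False])
    hence "z \<in> polyline p (d # ds) \<longleftrightarrow> h p \<le> h z \<and> h z \<le> h p + h (sum_list (d # ds)) \<and>
        Re z = Re p + offs (h p) (d # ds) (h z)" for z
      unfolding polyline_Cons Un_iff seg using d(1) up_sum_nonneg[OF d(2)] by (simp del: offs.simps) linarith
    thus ?thesis unfolding set_eq_iff mem_Collect_eq by blast
  qed
qed simp

lemma polygon_graph:
  assumes "up ds" "up es" "ds \<noteq> []" "es \<noteq> []" "sum_list ds = sum_list es"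
    and le: "\<And>t. offs (h p) ds t \<le> offs (h p) es t"
  shows "polygon_boundary p ds es = {z. h p \<le> h z \<and> h z \<le> h p + h (sum_list ds) \<and>
      (Re z = Re p + offs (h p) ds (h z) \<or> Re z = Re p + offs (h p) es (h z))}" (is ?B)
    and "polygon p ds es = {z. h p \<le> h z \<and> h z \<le> h p + h (sum_list ds) \<and>
      Re p + offs (h p) ds (h z) \<le> Re z \<and> Re z \<le> Re p + offs (h p) es (h z)}"
proof -
  show B: ?B using assms by (auto simp: polygon_boundary_def polyline_graph)
  have c: "continuous_on UNIV (\<lambda>t. Re p + offs (h p) ds t)" for ds
    by (intro continuous_intros continuous_offs)
  have "inside (polygon_boundary p ds es) = {z. h p \<le> h z \<and> h z \<le> h p + h (sum_list ds) \<and>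
      Re p + offs (h p) ds (h z) < Re z \<and> Re z < Re p + offs (h p) es (h z)}"
    unfolding B
    by (rule inside_between_graphs[OF h_cases c c])
      (use le in \<open>simp_all add: assms offs_below offs_above\<close>)
  thus "polygon p ds es = {z. h p \<le> h z \<and> h z \<le> h p + h (sum_list ds) \<and>
      Re p + offs (h p) ds (h z) \<le> Re z \<and> Re z \<le> Re p + offs (h p) es (h z)}"
    unfolding polygon_def B using le by (force simp: order.strict_iff_order)
qed

end

section \<open>Tiles swept by block swaps\<close>


text \<open>A swap \<open>(a, k)\<close> interchanges the two blocks of length \<open>k\<close> that start at index \<open>a\<close>.\<close>

definition swp :: "nat \<times> nat \<Rightarrow> 'b list \<Rightarrow> 'b list" where
  "swp \<sigma> ds = (case \<sigma> of (a, k) \<Rightarrow>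
     take a ds @ take k (drop (a + k) ds) @ take k (drop a ds) @ drop (a + 2 * k) ds)"

definition fits :: "nat \<Rightarrow> nat \<times> nat \<Rightarrow> bool" where
  "fits n \<sigma> \<longleftrightarrow> 1 \<le> snd \<sigma> \<and> fst \<sigma> + 2 * snd \<sigma> \<le> n"

definition indep :: "nat \<times> nat \<Rightarrow> nat \<times> nat \<Rightarrow> bool" where
  "indep \<sigma> \<tau> \<longleftrightarrow> fst \<sigma> + 2 * snd \<sigma> \<le> fst \<tau> \<or> fst \<tau> + 2 * snd \<tau> \<le> fst \<sigma>"

lemma indep_sym: "indep \<sigma> \<tau> \<Longrightarrow> indep \<tau> \<sigma>" by (auto simp: indep_def)

fun swps :: "(nat \<times> nat) list \<Rightarrow> 'b list \<Rightarrow> 'b list" where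
  "swps [] ds = ds"
| "swps (\<sigma> # ss) ds = swps ss (swp \<sigma> ds)"

lemma swps_append: "swps (ss @ ss') ds = swps ss' (swps ss ds)"
  by (induction ss arbitrary: ds) auto

lemma swp_split:
  assumes "fits (length ds) (a, k)"
  obtains pre A B post where "ds = pre @ A @ B @ post" "length pre = a" "length A = k" "length B = k"
    "swp (a, k) ds = pre @ B @ A @ post"
proof
  have "drop (a + k) ds = take k (drop (a + k) ds) @ drop (a + 2 * k) ds"
    by (metis append_take_drop_id drop_drop add.commute add.left_commute mult_2)
  moreover have "drop a ds = take k (drop a ds) @ drop (a + k) ds"
    by (metis append_take_drop_id drop_drop add.commute)
  ultimately show "ds = take a ds @ take k (drop a ds) @ take k (drop (a + k) ds) @ drop (a + 2 * k) ds"
    by (metis append_take_drop_id)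
qed (use assms in \<open>auto simp: swp_def fits_def\<close>)

lemma swp_blocks:
  "length pre = a \<Longrightarrow> length A = k \<Longrightarrow> length B = k \<Longrightarrow> swp (a, k) (pre @ A @ B @ post) = pre @ B @ A @ post"
  by (simp add: swp_def)

lemma length_swp [simp]: "fits (length ds) \<sigma> \<Longrightarrow> length (swp \<sigma> ds) = length ds"
  by (cases \<sigma>) (auto simp: swp_def fits_def)

lemma set_swp: "fits (length ds) \<sigma> \<Longrightarrow> set (swp \<sigma> ds) = set ds"
  by (cases \<sigma>) (auto elim: swp_split)

lemma sum_swp: "fits (length ds) \<sigma> \<Longrightarrow> sum_list (swp \<sigma> ds) = sum_list (ds :: complex list)"
  by (cases \<sigma>) (auto elim!: swp_split)

lemma indep_split:
  assumes "fits (length ds) (a, k)" "fits (length ds) (b, l)" "a + 2 * k \<le> b"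
  obtains pre A B mid C D post where "ds = pre @ A @ B @ mid @ C @ D @ post"
    "length pre = a" "length A = k" "length B = k" "a + 2 * k + length mid = b" "length C = l" "length D = l"
proof -
  obtain pre' C D post where 1: "ds = pre' @ C @ D @ post" "length pre' = b" "length C = l" "length D = l"
    using swp_split[OF assms(2)] by metis
  have "fits (length pre') (a, k)" using assms 1 by (simp add: fits_def)
  then obtain pre A B mid where "pre' = pre @ A @ B @ mid" "length pre = a" "length A = k" "length B = k"
    using swp_split by metis
  thus ?thesis using 1 that[of pre A B mid C D post] by simp
qed

lemma swp_commute:
  assumes "fits (length ds) \<sigma>" "fits (length ds) \<tau>" "indep \<sigma> \<tau>"
  shows "swp \<sigma> (swp \<tau> ds) = swp \<tau> (swp \<sigma> ds)"
proof -
  have *: "swp (a, k) (swp (b, l) ds) = swp (b, l) (swp (a, k) ds)"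
    if *: "fits (length ds) (a, k)" "fits (length ds) (b, l)" "a + 2 * k \<le> b" for a k b l
  proof -
    obtain pre A B mid C D post where ds: "ds = pre @ A @ B @ mid @ C @ D @ post"
      and l: "length pre = a" "length A = k" "length B = k" "a + 2 * k + length mid = b" "length C = l" "length D = l"
      using indep_split[OF *] by blast
    have "swp (a, k) ds = pre @ B @ A @ mid @ C @ D @ post"
      "swp (a, k) (pre @ A @ B @ mid @ D @ C @ post) = pre @ B @ A @ mid @ D @ C @ post"
      using l by (simp_all add: ds swp_blocks)
    moreover have "swp (b, l) ds = pre @ A @ B @ mid @ D @ C @ post"
      "swp (b, l) (pre @ B @ A @ mid @ C @ D @ post) = pre @ B @ A @ mid @ D @ C @ post"
      using l swp_blocks[of "pre @ A @ B @ mid" b C l D post] swp_blocks[of "pre @ B @ A @ mid" b C l D post]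
      by (simp_all add: ds)
    ultimately show ?thesis by simp
  qed
  show ?thesis using assms *[of "fst \<sigma>" "snd \<sigma>" "fst \<tau>" "snd \<tau>"] *[of "fst \<tau>" "snd \<tau>" "fst \<sigma>" "snd \<sigma>"]
    by (auto simp: indep_def)
qed

text \<open>All on which the tile of a swap depends: its starting vertex and the two blocks to be
  interchanged.\<close>

definition blk :: "nat \<times> nat \<Rightarrow> complex list \<Rightarrow> complex \<times> complex list \<times> complex list" where
  "blk \<sigma> ds = (case \<sigma> of (a, k) \<Rightarrow> (sum_list (take a ds), take k (drop a ds), take k (drop (a + k) ds)))"

lemma blk_blocks:
  "length pre = a \<Longrightarrow> length A = k \<Longrightarrow> length B = k \<Longrightarrow> blk (a, k) (pre @ A @ B @ post) = (sum_list pre, A, B)"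
  by (simp add: blk_def)

text \<open>A swap earlier on the path permutes edges of which only the sum matters, as the starting
  vertex of the tile; a later one does not matter at all.\<close>

lemma blk_swp:
  assumes "fits (length ds) \<sigma>" "fits (length ds) \<tau>" "indep \<sigma> \<tau>"
  shows "blk \<sigma> (swp \<tau> ds) = blk \<sigma> ds"
proof (cases "fst \<sigma> + 2 * snd \<sigma> \<le> fst \<tau>")
  case True
  obtain a k b l where s: "\<sigma> = (a, k)" "\<tau> = (b, l)" by (cases \<sigma>, cases \<tau>)
  obtain pre A B mid C D post where ds: "ds = pre @ A @ B @ mid @ C @ D @ post"
    and l: "length pre = a" "length A = k" "length B = k" "a + 2 * k + length mid = b" "length C = l" "length D = l"
    by (rule indep_split[of ds a k b l]) (use True assms s in auto)
  have "swp \<tau> ds = pre @ A @ B @ mid @ D @ C @ post"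
    using l swp_blocks[of "pre @ A @ B @ mid" b C l D post] by (simp add: ds s)
  thus ?thesis using l by (simp add: ds s blk_blocks)
next
  case False
  obtain a k b l where s: "\<sigma> = (b, l)" "\<tau> = (a, k)" by (cases \<sigma>, cases \<tau>)
  obtain pre A B mid C D post where ds: "ds = pre @ A @ B @ mid @ C @ D @ post"
    and l: "length pre = a" "length A = k" "length B = k" "a + 2 * k + length mid = b" "length C = l" "length D = l"
    by (rule indep_split[of ds a k b l]) (use False assms s in \<open>auto simp: indep_def\<close>)
  have "swp \<tau> ds = pre @ B @ A @ mid @ C @ D @ post"
    using l by (simp add: ds s swp_blocks)
  thus ?thesis using l blk_blocks[of "pre @ A @ B @ mid" b C l D post] blk_blocks[of "pre @ B @ A @ mid" b C l D post]
    by (simp add: ds s add.left_commute add.commute)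
qed

text \<open>Blocks of one edge give the rhombi of both types, and blocks of two edges give the
  octagons of type D.\<close>

definition etile :: "nat \<times> nat \<Rightarrow> complex list \<Rightarrow> complex set" where
  "etile \<sigma> ds = (case blk \<sigma> ds of (p, A, B) \<Rightarrow> polygon p (A @ B) (B @ A))"

lemma etile_tile_between:
  assumes "fits (length ds) (a, k)"
  shows "etile (a, k) ds = tile_between ds (swp (a, k) ds) a (2 * k)"
proof -
  obtain pre A B post where *: "ds = pre @ A @ B @ post" "length pre = a" "length A = k" "length B = k"
    "swp (a, k) ds = pre @ B @ A @ post" using swp_split[OF assms] by metis
  show ?thesis unfolding etile_def tile_between_def *(5)
    using * by (simp add: blk_blocks path_vertex_def)
qed

fun etiles :: "(nat \<times> nat) list \<Rightarrow> complex list \<Rightarrow> complex set set" where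
  "etiles [] ds = {}"
| "etiles (\<sigma> # ss) ds = insert (etile \<sigma> ds) (etiles ss (swp \<sigma> ds))"

lemma etiles_append: "etiles (ss @ ss') ds = etiles ss ds \<union> etiles ss' (swps ss ds)"
  by (induction ss arbitrary: ds) auto

lemma etiles_mem:
  "A \<in> etiles ss ds \<longleftrightarrow> (\<exists>vs \<tau> us. ss = vs @ \<tau> # us \<and> A = etile \<tau> (swps vs ds))"
proof (induction ss arbitrary: ds)
  case (Cons \<sigma> ss)
  have "(\<exists>vs \<tau> us. \<sigma> # ss = vs @ \<tau> # us \<and> A = etile \<tau> (swps vs ds)) \<longleftrightarrow>
    A = etile \<sigma> ds \<or> (\<exists>vs \<tau> us. ss = vs @ \<tau> # us \<and> A = etile \<tau> (swps vs (swp \<sigma> ds)))"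
  proof
    assume "\<exists>vs \<tau> us. \<sigma> # ss = vs @ \<tau> # us \<and> A = etile \<tau> (swps vs ds)"
    then obtain vs \<tau> us where "\<sigma> # ss = vs @ \<tau> # us" "A = etile \<tau> (swps vs ds)" by blast
    thus "A = etile \<sigma> ds \<or> (\<exists>vs \<tau> us. ss = vs @ \<tau> # us \<and> A = etile \<tau> (swps vs (swp \<sigma> ds)))"
      by (cases vs) fastforce+
  next
    assume "A = etile \<sigma> ds \<or> (\<exists>vs \<tau> us. ss = vs @ \<tau> # us \<and> A = etile \<tau> (swps vs (swp \<sigma> ds)))"
    thus "\<exists>vs \<tau> us. \<sigma> # ss = vs @ \<tau> # us \<and> A = etile \<tau> (swps vs ds)"
    proof (elim disjE exE conjE)
      assume "A = etile \<sigma> ds"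
      thus ?thesis by (intro exI[of _ "[]"]) auto
    next
      fix vs \<tau> us assume "ss = vs @ \<tau> # us" "A = etile \<tau> (swps vs (swp \<sigma> ds))"
      thus ?thesis by (intro exI[of _ "\<sigma> # vs"]) auto
    qed
  qed
  thus ?case using Cons[of "swp \<sigma> ds"] by simp
qed simp

lemma filter_commute:
  "filter p us = [] \<or> filter p vs = [] \<Longrightarrow> filter p (us @ vs @ ws) = filter p (vs @ us @ ws)"
  by auto

text \<open>The counterpart of \<open>proj_eq\<close> for sequences of swaps, with overlap in place
  of non-commutation.\<close>

definition proj_eq_steps :: "(nat \<times> nat) list \<Rightarrow> (nat \<times> nat) list \<Rightarrow> bool" where
  "proj_eq_steps ss ss' \<longleftrightarrow>
     (\<forall>\<sigma> \<tau>. \<not> indep \<sigma> \<tau> \<longrightarrow> filter (\<lambda>c. c = \<sigma> \<or> c = \<tau>) ss = filter (\<lambda>c. c = \<sigma> \<or> c = \<tau>) ss')"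

lemma length_swps: "(\<And>\<sigma>. \<sigma> \<in> set ss \<Longrightarrow> fits (length ds) \<sigma>) \<Longrightarrow> length (swps ss ds) = length ds"
  by (induction ss arbitrary: ds) auto

lemma etiles_swap:
  assumes "fits (length ds) \<sigma>" "fits (length ds) \<tau>" "indep \<sigma> \<tau>"
  shows "etiles (\<sigma> # \<tau> # ss) ds = etiles (\<tau> # \<sigma> # ss) ds"
  using assms blk_swp[of ds \<sigma> \<tau>] blk_swp[of ds \<tau> \<sigma>] swp_commute[of ds \<sigma> \<tau>]
  by (auto simp: etile_def indep_sym)

lemma etiles_shift_letter:
  assumes "fits (length ds) \<sigma>" "\<And>\<tau>. \<tau> \<in> set ts \<Longrightarrow> fits (length ds) \<tau> \<and> indep \<sigma> \<tau>"
  shows "etiles (\<sigma> # ts @ ss) ds = etiles (ts @ \<sigma> # ss) ds"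
  using assms
proof (induction ts arbitrary: ds)
  case (Cons \<tau> ts)
  have "etiles (\<sigma> # \<tau> # ts @ ss) ds = etiles (\<tau> # \<sigma> # ts @ ss) ds"
    using Cons.prems by (intro etiles_swap) auto
  also have "etiles (\<sigma> # ts @ ss) (swp \<tau> ds) = etiles (ts @ \<sigma> # ss) (swp \<tau> ds)"
    using Cons.prems by (intro Cons.IH) auto
  hence "etiles (\<tau> # \<sigma> # ts @ ss) ds = etiles (\<tau> # ts @ \<sigma> # ss) ds" by simp
  finally show ?case by simp
qed simp

lemma etiles_shift:
  assumes "\<And>\<sigma>. \<sigma> \<in> set us \<Longrightarrow> fits (length ds) \<sigma>" "\<And>\<tau>. \<tau> \<in> set ts \<Longrightarrow> fits (length ds) \<tau>"
    "\<And>\<sigma> \<tau>. \<sigma> \<in> set us \<Longrightarrow> \<tau> \<in> set ts \<Longrightarrow> indep \<sigma> \<tau>"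
  shows "etiles (us @ ts @ ss) ds = etiles (ts @ us @ ss) ds"
  using assms
proof (induction us arbitrary: ds)
  case (Cons \<sigma> us)
  have "etiles (us @ ts @ ss) (swp \<sigma> ds) = etiles (ts @ us @ ss) (swp \<sigma> ds)"
    using Cons.prems by (intro Cons.IH) auto
  hence "etiles ((\<sigma> # us) @ ts @ ss) ds = etiles (\<sigma> # ts @ us @ ss) ds" by simp
  also have "\<dots> = etiles (ts @ \<sigma> # us @ ss) ds"
    using Cons.prems by (intro etiles_shift_letter) auto
  finally show ?case by simp
qed simp

text \<open>A neighbourhood would contain points on both horizontal sides; the sign of
  \<open>s\<close> selects the side that is tested.\<close>

lemma frontier_right:
  fixes z :: complex
  assumes "z \<in> A" "s \<noteq> 0" "\<And>\<epsilon>. 0 < \<epsilon> \<Longrightarrow> z + of_real (s * \<epsilon>) \<notin> A"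
  shows "z \<in> frontier A"
proof -
  have "z \<notin> interior A"
  proof
    assume "z \<in> interior A"
    then obtain \<epsilon> where e: "0 < \<epsilon>" "ball z \<epsilon> \<subseteq> A" by (auto simp: mem_interior)
    define \<delta> where "\<delta> = \<epsilon> / (2 * \<bar>s\<bar>)"
    have "norm (of_real (s * \<delta>) :: complex) = \<epsilon> / 2"
      unfolding norm_of_real using e assms(2) by (simp add: \<delta>_def abs_mult)
    hence "z + of_real (s * \<delta>) \<in> ball z \<epsilon>" using e by (simp add: dist_norm)
    moreover have "0 < \<delta>" using e assms(2) by (simp add: \<delta>_def)
    ultimately show False using assms(3) e by blast
  qed
  thus ?thesis using assms(1) closure_subset by (auto simp: frontier_def)
qed

section \<open>Monotone sweeps\<close>

context height begin

lemma h_minus [simp]: "h (- x) = - h x" "h (x - y) = h x - h y" using h_cases by auto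

definition ht :: "nat \<Rightarrow> complex list \<Rightarrow> real" where
  "ht j ds = h (sum_list (take j ds))"

lemma ht_mono: "up ds \<Longrightarrow> i < j \<Longrightarrow> j \<le> length ds \<Longrightarrow> ht i ds < ht j ds"
proof -
  assume *: "up ds" "i < j" "j \<le> length ds"
  have "take j ds = take i ds @ take (j - i) (drop i ds)"
    using * by (metis less_imp_add_positive take_add add_diff_cancel_left')
  moreover have "0 < h (sum_list (take (j - i) (drop i ds)))"
    using * by (intro up_sum_pos up_take up_drop) auto
  ultimately show ?thesis by (simp add: ht_def)
qed

lemma ht_mono_le: "up ds \<Longrightarrow> i \<le> j \<Longrightarrow> j \<le> length ds \<Longrightarrow> ht i ds \<le> ht j ds"
  using ht_mono[of ds i j] by (cases "i = j") auto

lemma ht_less_iff: "up ds \<Longrightarrow> i \<le> length ds \<Longrightarrow> j \<le> length ds \<Longrightarrow> ht i ds < ht j ds \<longleftrightarrow> i < j"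
  using ht_mono[of ds i j] ht_mono_le[of ds j i] by (cases "i < j") auto

text \<open>Strictness at every intermediate height gives the tile positive width there, by which
  swaps can later be recovered from tiles.\<close>

definition raising :: "complex list \<Rightarrow> complex list \<Rightarrow> bool" where
  "raising A B \<longleftrightarrow> (\<forall>t. 0 < t \<longrightarrow> t < h (sum_list (A @ B)) \<longrightarrow> offs 0 (A @ B) t < offs 0 (B @ A) t)"

definition raises :: "nat \<times> nat \<Rightarrow> complex list \<Rightarrow> bool" where
  "raises \<sigma> ds \<longleftrightarrow> (case blk \<sigma> ds of (p, A, B) \<Rightarrow> raising A B)"

lemma raises_swp:
  "fits (length ds) \<sigma> \<Longrightarrow> fits (length ds) \<tau> \<Longrightarrow> indep \<sigma> \<tau> \<Longrightarrow> raises \<sigma> (swp \<tau> ds) \<longleftrightarrow> raises \<sigma> ds"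
  by (simp add: raises_def blk_swp)

lemma up_swp: "fits (length ds) \<sigma> \<Longrightarrow> up (swp \<sigma> ds) \<longleftrightarrow> up ds"
  by (simp add: up_def set_swp)

text \<open>The edges outside the two blocks contribute the same displacement before and after the
  swap. So the graphs can differ only between the heights at which the blocks begin and end, and
  there \<open>raising\<close> compares them.\<close>

lemma step_facts:
  assumes "fits (length ds) (a, k)" "up ds" "raises (a, k) ds"
  shows "ht a ds < t \<Longrightarrow> t < ht (a + 2 * k) ds \<Longrightarrow> offs 0 ds t < offs 0 (swp (a, k) ds) t"
    and "t \<le> ht a ds \<Longrightarrow> offs 0 (swp (a, k) ds) t = offs 0 ds t"
    and "ht (a + 2 * k) ds \<le> t \<Longrightarrow> offs 0 (swp (a, k) ds) t = offs 0 ds t"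
    and "etile (a, k) ds = {z. ht a ds \<le> h z \<and> h z \<le> ht (a + 2 * k) ds \<and>
           offs 0 ds (h z) \<le> Re z \<and> Re z \<le> offs 0 (swp (a, k) ds) (h z)}"
proof -
  obtain pre A B post where ds: "ds = pre @ A @ B @ post" and l: "length pre = a" "length A = k" "length B = k"
    and sw: "swp (a, k) ds = pre @ B @ A @ post" using swp_split[OF assms(1)] by metis
  define p where "p = sum_list pre"
  define y where "y = h (sum_list (A @ B))"
  have k: "1 \<le> k" using assms(1) by (simp add: fits_def)
  have lo: "ht a ds = h p" using l by (simp add: ht_def ds p_def)
  have "take (a + 2 * k) ds = pre @ A @ B" using l by (simp add: ds)
  hence hi: "ht (a + 2 * k) ds = h p + y" by (simp add: ht_def p_def y_def add.assoc)
  have u: "up pre" "up A" "up B" "up post" using assms(2) by (auto simp: ds)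
  have r: "raising A B" using assms(3) l by (simp add: raises_def ds blk_blocks)
  have F: "offs 0 ds t = offs 0 pre t + offs (h p) (A @ B) t + offs (h p + y) post t" for t
    by (simp add: ds offs_append p_def y_def add.assoc)
  have F': "offs 0 (swp (a, k) ds) t = offs 0 pre t + offs (h p) (B @ A) t + offs (h p + y) post t" for t
    by (simp add: sw offs_append p_def y_def add.assoc add.commute add.left_commute)
  have sumBA: "h (sum_list (B @ A)) = y" by (simp add: y_def)
  have below: "offs (h p) (B @ A) t = offs (h p) (A @ B) t" if "t \<le> h p" for t
    using that u by (simp add: offs_below)
  have above: "offs (h p) (B @ A) t = offs (h p) (A @ B) t" if "h p + y \<le> t" for t
  proof -
    have "offs (h p) (B @ A) t = Re (sum_list (B @ A))" using that u sumBA by (intro offs_above) auto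
    moreover have "offs (h p) (A @ B) t = Re (sum_list (A @ B))"
      using that u by (intro offs_above) (auto simp: y_def)
    ultimately show ?thesis by simp
  qed
  have mid: "offs (h p) (A @ B) t < offs (h p) (B @ A) t" if "h p < t" "t < h p + y" for t
    using r that unfolding raising_def y_def[symmetric] offs_shift[of "h p"] by auto
  show "ht a ds < t \<Longrightarrow> t < ht (a + 2 * k) ds \<Longrightarrow> offs 0 ds t < offs 0 (swp (a, k) ds) t"
    using mid by (simp add: F F' lo hi)
  show "t \<le> ht a ds \<Longrightarrow> offs 0 (swp (a, k) ds) t = offs 0 ds t"
    using below by (simp add: F F' lo)
  show "ht (a + 2 * k) ds \<le> t \<Longrightarrow> offs 0 (swp (a, k) ds) t = offs 0 ds t"
    using above by (simp add: F F' hi)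
  have le: "offs (h p) (A @ B) t \<le> offs (h p) (B @ A) t" for t
    using below[of t] above[of t] mid[of t] by (cases "t \<le> h p"; cases "h p + y \<le> t") auto
  have pre: "offs 0 pre t = Re p" if "h p \<le> t" for t
    using that u offs_above[of pre 0 t] by (simp add: p_def)
  have post: "offs (h p + y) post t = 0" if "t \<le> h p + y" for t
    using that u by (simp add: offs_below)
  have "A @ B \<noteq> []" "B @ A \<noteq> []" using l k by auto
  hence "polygon p (A @ B) (B @ A) = {z. h p \<le> h z \<and> h z \<le> h p + y \<and>
      Re p + offs (h p) (A @ B) (h z) \<le> Re z \<and> Re z \<le> Re p + offs (h p) (B @ A) (h z)}"
    unfolding y_def using u by (intro polygon_graph(2) le) (auto simp: add.commute)
  moreover have "etile (a, k) ds = polygon p (A @ B) (B @ A)"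
    using l by (simp add: etile_def ds blk_blocks p_def)
  ultimately show "etile (a, k) ds = {z. ht a ds \<le> h z \<and> h z \<le> ht (a + 2 * k) ds \<and>
           offs 0 ds (h z) \<le> Re z \<and> Re z \<le> offs 0 (swp (a, k) ds) (h z)}"
    using pre post unfolding lo hi F F' by (auto simp del: offs.simps)
qed

lemma step_le:
  assumes "fits (length ds) \<sigma>" "up ds" "raises \<sigma> ds"
  shows "offs 0 ds t \<le> offs 0 (swp \<sigma> ds) t"
proof -
  obtain a k where s: "\<sigma> = (a, k)" by (cases \<sigma>)
  show ?thesis unfolding s using step_facts(1-3)[OF assms[unfolded s], of t]
    by (cases "t \<le> ht a ds"; cases "ht (a + 2 * k) ds \<le> t") auto
qed

text \<open>Each swap is required to move the graph to the right at the moment when it is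
  performed.\<close>

fun asc :: "(nat \<times> nat) list \<Rightarrow> complex list \<Rightarrow> bool" where
  "asc [] ds = True"
| "asc (\<sigma> # ss) ds \<longleftrightarrow> fits (length ds) \<sigma> \<and> raises \<sigma> ds \<and> asc ss (swp \<sigma> ds)"

lemma asc_append: "asc (ss @ ss') ds \<longleftrightarrow> asc ss ds \<and> asc ss' (swps ss ds)"
  by (induction ss arbitrary: ds) auto

lemma asc_fits: "asc ss ds \<Longrightarrow> \<sigma> \<in> set ss \<Longrightarrow> fits (length ds) \<sigma>"
proof (induction ss arbitrary: ds)
  case (Cons \<tau> ss)
  thus ?case using Cons.IH[of "swp \<tau> ds"] by auto
qed simp

lemma asc_up: "asc ss ds \<Longrightarrow> up (swps ss ds) \<longleftrightarrow> up ds"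
  by (induction ss arbitrary: ds) (auto simp: up_swp)

lemma asc_sum: "asc ss ds \<Longrightarrow> sum_list (swps ss ds) = sum_list ds"
  by (induction ss arbitrary: ds) (auto simp: sum_swp)

lemma asc_length: "asc ss ds \<Longrightarrow> length (swps ss ds) = length ds"
  by (intro length_swps asc_fits)

lemma asc_le: "asc ss ds \<Longrightarrow> up ds \<Longrightarrow> offs 0 ds t \<le> offs 0 (swps ss ds) t"
proof (induction ss arbitrary: ds)
  case (Cons \<sigma> ss)
  hence "up (swp \<sigma> ds)" by (simp add: up_swp)
  thus ?case using Cons step_le[of ds \<sigma> t] Cons.IH[of "swp \<sigma> ds"] by (auto intro: order_trans)
qed simp

lemma etile_bounds:
  assumes "fits (length ds) \<sigma>" "up ds" "raises \<sigma> ds" "z \<in> etile \<sigma> ds"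
  shows "0 \<le> h z" "h z \<le> h (sum_list ds)" "offs 0 ds (h z) \<le> Re z" "Re z \<le> offs 0 (swp \<sigma> ds) (h z)"
proof -
  obtain a k where s: "\<sigma> = (a, k)" by (cases \<sigma>)
  note z = assms(4)[unfolded s step_facts(4)[OF assms(1-3)[unfolded s]], simplified]
  have "ht 0 ds \<le> ht a ds" "ht (a + 2 * k) ds \<le> ht (length ds) ds"
    using assms(1,2) by (intro ht_mono_le; simp add: s fits_def)+
  thus "0 \<le> h z" "h z \<le> h (sum_list ds)" using z by (auto simp: ht_def)
  show "offs 0 ds (h z) \<le> Re z" "Re z \<le> offs 0 (swp \<sigma> ds) (h z)" using z s by auto
qed

lemma etiles_bounds:
  assumes "asc ss ds" "up ds" "A \<in> etiles ss ds" "z \<in> A"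
  shows "0 \<le> h z \<and> h z \<le> h (sum_list ds) \<and> offs 0 ds (h z) \<le> Re z \<and> Re z \<le> offs 0 (swps ss ds) (h z)"
  using assms
proof (induction ss arbitrary: ds)
  case (Cons \<sigma> ss)
  hence *: "fits (length ds) \<sigma>" "raises \<sigma> ds" "up (swp \<sigma> ds)" "asc ss (swp \<sigma> ds)" by (auto simp: up_swp)
  show ?case
  proof (cases "A = etile \<sigma> ds")
    case True
    thus ?thesis using etile_bounds[OF *(1) Cons.prems(2) *(2)] Cons.prems(4) asc_le[OF *(4,3), of "h z"] by force
  next
    case False
    hence "A \<in> etiles ss (swp \<sigma> ds)" using Cons by auto
    thus ?thesis using Cons.IH[OF *(4,3) _ Cons.prems(4)] step_le[OF *(1) Cons.prems(2) *(2), of "h z"] *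
      by (auto simp: sum_swp)
  qed
qed simp

text \<open>The first swap after which the graph is no longer to the left of the point covers it.
  The left inequality is strict because a point of the initial path may lie on an edge that no tile
  touches.\<close>

lemma etiles_cover:
  assumes "asc ss ds" "up ds" "offs 0 ds (h z) < Re z" "Re z \<le> offs 0 (swps ss ds) (h z)"
  shows "z \<in> \<Union> (etiles ss ds)"
  using assms
proof (induction ss arbitrary: ds)
  case (Cons \<sigma> ss)
  hence *: "fits (length ds) \<sigma>" "raises \<sigma> ds" "up (swp \<sigma> ds)" "asc ss (swp \<sigma> ds)" by (auto simp: up_swp)
  show ?case
  proof (cases "offs 0 (swp \<sigma> ds) (h z) < Re z")
    case True
    thus ?thesis using Cons * by auto
  next
    case False
    obtain a k where s: "\<sigma> = (a, k)" by (cases \<sigma>)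
    note sf = step_facts[OF *(1)[unfolded s] Cons.prems(2) *(2)[unfolded s]]
    have "ht a ds \<le> h z" "h z \<le> ht (a + 2 * k) ds"
      using sf(2)[of "h z"] sf(3)[of "h z"] False Cons.prems(3) s by (auto simp: not_less intro: ccontr)
    hence "z \<in> etile \<sigma> ds" using sf(4) False Cons.prems(3) s by auto
    thus ?thesis by simp
  qed
qed simp

lemma frontier_above:
  assumes "z \<in> A" "\<And>w. w \<in> A \<Longrightarrow> Re w \<le> g (h w)" "g (h z) \<le> Re z" shows "z \<in> frontier A"
proof (rule frontier_right[of _ _ 1])
  fix \<epsilon> :: real assume "0 < \<epsilon>"
  show "z + of_real (1 * \<epsilon>) \<notin> A"
  proof
    assume "z + of_real (1 * \<epsilon>) \<in> A"
    from assms(2)[OF this] show False using assms(3) \<open>0 < \<epsilon>\<close> by simp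
  qed
qed (use assms in auto)

lemma frontier_below:
  assumes "z \<in> A" "\<And>w. w \<in> A \<Longrightarrow> g (h w) \<le> Re w" "Re z \<le> g (h z)" shows "z \<in> frontier A"
proof (rule frontier_right[of _ _ "-1"])
  fix \<epsilon> :: real assume "0 < \<epsilon>"
  show "z + of_real (-1 * \<epsilon>) \<notin> A"
  proof
    assume "z + of_real (-1 * \<epsilon>) \<in> A"
    from assms(2)[OF this] show False using assms(3) \<open>0 < \<epsilon>\<close> by simp
  qed
qed (use assms in auto)

text \<open>The graph after the first swap separates the first tile from all others. A common point
  therefore lies on this graph, rightmost at its height in one tile and leftmost in the
  other.\<close>

lemma etiles_disjoint:
  assumes "asc ss ds" "up ds" "A \<in> etiles ss ds" "B \<in> etiles ss ds" "A \<noteq> B"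
  shows "A \<inter> B \<subseteq> frontier A \<inter> frontier B"
  using assms
proof (induction ss arbitrary: ds)
  case (Cons \<sigma> ss)
  hence *: "fits (length ds) \<sigma>" "raises \<sigma> ds" "up (swp \<sigma> ds)" "asc ss (swp \<sigma> ds)" by (auto simp: up_swp)
  have first: "etile \<sigma> ds \<inter> C \<subseteq> frontier (etile \<sigma> ds) \<inter> frontier C" if C: "C \<in> etiles ss (swp \<sigma> ds)" for C
  proof
    fix z assume z: "z \<in> etile \<sigma> ds \<inter> C"
    note e = etile_bounds(4)[OF *(1) Cons.prems(2) *(2)]
    have b: "offs 0 (swp \<sigma> ds) (h w) \<le> Re w" if "w \<in> C" for w
      using etiles_bounds[OF *(4,3) C that] by simp
    have "z \<in> frontier (etile \<sigma> ds)" using z e b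
      by (intro frontier_above[of _ _ "offs 0 (swp \<sigma> ds)"]) auto
    moreover have "z \<in> frontier C" using z e b
      by (intro frontier_below[of _ _ "offs 0 (swp \<sigma> ds)"]) auto
    ultimately show "z \<in> frontier (etile \<sigma> ds) \<inter> frontier C" by blast
  qed
  consider "A = etile \<sigma> ds" "B \<in> etiles ss (swp \<sigma> ds)" | "B = etile \<sigma> ds" "A \<in> etiles ss (swp \<sigma> ds)"
    | "A \<in> etiles ss (swp \<sigma> ds)" "B \<in> etiles ss (swp \<sigma> ds)"
    using Cons.prems(3-5) by auto
  thus ?case
  proof cases
    case 1 thus ?thesis using first by blast
  next
    case 2 thus ?thesis using first[of A] by blast
  next
    case 3 thus ?thesis using Cons.IH[OF *(4,3)] Cons.prems by blast
  qed
qed simp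

text \<open>\<open>etiles_cover\<close> reaches every point strictly to the right of the initial
  path. The initial path itself belongs to the boundary, which also settles edges shared by both
  sides.\<close>

lemma etiles_tiling:
  assumes "asc ss ds" "up ds" "ds \<noteq> []" "etiles ss ds \<subseteq> \<P>"
  shows "etiles ss ds \<in> tilings_by \<P> 0 ds (swps ss ds)"
proof -
  have l: "length (swps ss ds) = length ds" by (rule asc_length[OF assms(1)])
  have e: "up (swps ss ds)" "sum_list ds = sum_list (swps ss ds)"
    using asc_up[OF assms(1)] asc_sum[OF assms(1)] assms(2) by simp_all
  have ne: "swps ss ds \<noteq> []" using l assms(3) by (cases "swps ss ds") auto
  note pg = polygon_graph[OF assms(2) e(1) assms(3) ne e(2), of 0, simplified, OF asc_le[OF assms(1,2)]]
  have fin: "finite (etiles ss' ds')" for ss' ds' by (induction ss' arbitrary: ds') auto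
  have "\<Union> (etiles ss ds) \<union> polygon_boundary 0 ds (swps ss ds) = polygon 0 ds (swps ss ds)"
  proof (intro equalityI subsetI)
    fix z assume "z \<in> \<Union> (etiles ss ds) \<union> polygon_boundary 0 ds (swps ss ds)"
    thus "z \<in> polygon 0 ds (swps ss ds)"
    proof
      assume "z \<in> \<Union> (etiles ss ds)"
      thus ?thesis using etiles_bounds[OF assms(1,2)] unfolding pg(2) by blast
    qed (auto simp: polygon_def)
  next
    fix z assume z: "z \<in> polygon 0 ds (swps ss ds)"
    show "z \<in> \<Union> (etiles ss ds) \<union> polygon_boundary 0 ds (swps ss ds)"
    proof (cases "offs 0 ds (h z) < Re z")
      case True
      thus ?thesis using etiles_cover[OF assms(1,2), of z] z unfolding pg(2) by blast
    next
      case False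
      thus ?thesis using z unfolding pg by auto
    qed
  qed
  thus ?thesis using fin etiles_disjoint[OF assms(1,2)] assms(4) by (auto simp: tilings_by_def)
qed

section \<open>Recovering the swaps from the tiles\<close>

lemma etile_point:
  assumes "fits (length ds) (a, k)" "up ds" "raises (a, k) ds" "ht a ds \<le> t" "t \<le> ht (a + 2 * k) ds"
  obtains z where "z \<in> etile (a, k) ds" "h z = t" "Re z = offs 0 ds t"
proof -
  obtain z where z: "Re z = offs 0 ds t" "h z = t" using ex_point by blast
  have "z \<in> etile (a, k) ds"
    using z step_facts(4)[OF assms(1-3)] step_le[OF assms(1-3), of t] assms by auto
  thus ?thesis using that z by blast
qed

lemma etile_heights:
  assumes "fits (length ds) (a, k)" "up ds" "raises (a, k) ds"
  shows "h ` etile (a, k) ds = {ht a ds..ht (a + 2 * k) ds}"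
proof (intro equalityI subsetI)
  fix t assume "t \<in> {ht a ds..ht (a + 2 * k) ds}"
  thus "t \<in> h ` etile (a, k) ds" using etile_point[OF assms, of t] by (metis atLeastAtMost_iff image_eqI)
qed (use step_facts(4)[OF assms] in auto)

text \<open>The heights covered by the tile determine its first and last vertex, since heights
  increase strictly along the path.\<close>

lemma etile_inj:
  assumes "fits (length ds) \<sigma>" "fits (length ds) \<tau>" "up ds" "raises \<sigma> ds" "raises \<tau> ds"
    "etile \<sigma> ds = etile \<tau> ds"
  shows "\<sigma> = \<tau>"
proof -
  obtain a k b l where s: "\<sigma> = (a, k)" "\<tau> = (b, l)" by (cases \<sigma>, cases \<tau>)
  have fits: "1 \<le> k" "a + 2 * k \<le> length ds" "1 \<le> l" "b + 2 * l \<le> length ds"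
    using assms s by (auto simp: fits_def)
  have "{ht a ds..ht (a + 2 * k) ds} = {ht b ds..ht (b + 2 * l) ds}"
    using etile_heights[of ds a k] etile_heights[of ds b l] assms unfolding s by metis
  moreover have "ht a ds < ht (a + 2 * k) ds" using fits assms(3) by (intro ht_mono) auto
  ultimately have eq: "ht a ds = ht b ds" "ht (a + 2 * k) ds = ht (b + 2 * l) ds"
    by (auto simp: Icc_eq_Icc)
  have inj: "i = j" if "ht i ds = ht j ds" "i \<le> length ds" "j \<le> length ds" for i j
    using that ht_less_iff[OF assms(3), of i j] ht_less_iff[OF assms(3), of j i] by auto
  have "a = b" "a + 2 * k = b + 2 * l" using fits by (intro inj eq; simp)+
  thus ?thesis using s by simp
qed

text \<open>At half the height of a common edge, the left side of the tile of
  \<open>\<sigma>\<close> lies on the old graph, which \<open>\<tau>\<close> pushes strictly to the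
  right.\<close>

lemma overlap_raise:
  assumes "fits (length ds) \<sigma>" "fits (length ds) \<tau>" "up ds" "raises \<sigma> ds" "raises \<tau> ds" "\<not> indep \<sigma> \<tau>"
  obtains z where "z \<in> etile \<sigma> ds" "Re z < offs 0 (swp \<tau> ds) (h z)"
proof -
  obtain a k b l where s: "\<sigma> = (a, k)" "\<tau> = (b, l)" by (cases \<sigma>, cases \<tau>)
  have fits: "1 \<le> k" "a + 2 * k \<le> length ds" "1 \<le> l" "b + 2 * l \<le> length ds"
    using assms s by (auto simp: fits_def)
  \<comment> \<open>The edge at the larger of the two starting indices is moved by both
    swaps.\<close>
  define j where "j = max a b"
  have j: "a \<le> j" "b \<le> j" "Suc j \<le> a + 2 * k" "Suc j \<le> b + 2 * l"
    using assms(6) s fits by (auto simp: j_def indep_def)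
  define t where "t = (ht j ds + ht (Suc j) ds) / 2"
  have "ht j ds < ht (Suc j) ds" "ht a ds \<le> ht j ds" "ht b ds \<le> ht j ds"
    "ht (Suc j) ds \<le> ht (a + 2 * k) ds" "ht (Suc j) ds \<le> ht (b + 2 * l) ds"
    using j fits assms(3) by (intro ht_mono ht_mono_le; simp)+
  hence t: "ht a ds \<le> t" "t \<le> ht (a + 2 * k) ds" "ht b ds < t" "t < ht (b + 2 * l) ds"
    by (auto simp: t_def)
  obtain z where "z \<in> etile (a, k) ds" "h z = t" "Re z = offs 0 ds t"
    using etile_point[of ds a k t] assms s t by auto
  thus ?thesis using that[of z] step_facts(1)[of ds b l t] assms s t by auto
qed

text \<open>If a swap \<open>v\<close> before \<open>\<tau>\<close> overlapped
  \<open>\<sigma>\<close>, the graph would pass a point on the left side of the tile of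
  \<open>\<sigma>\<close>, but all later tiles lie to the right of the graph. So \<open>v\<close> is
  independent of \<open>\<sigma>\<close>, leaves its tile unchanged, and the induction goes
  on.\<close>

lemma etile_first:
  assumes "asc (vs @ \<tau> # us) ds" "up ds" "fits (length ds) \<sigma>" "raises \<sigma> ds"
    "etile \<sigma> ds = etile \<tau> (swps vs ds)"
  shows "\<sigma> = \<tau> \<and> (\<forall>v\<in>set vs. indep \<sigma> v)"
  using assms
proof (induction vs arbitrary: ds)
  case Nil
  thus ?case using etile_inj[of ds \<sigma> \<tau>] by simp
next
  case (Cons v vs)
  hence *: "fits (length ds) v" "raises v ds" "up (swp v ds)" "asc (vs @ \<tau> # us) (swp v ds)"
    by (auto simp: up_swp)
  have ind: "indep \<sigma> v"
  proof (rule ccontr)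
    assume "\<not> indep \<sigma> v"
    then obtain z where z: "z \<in> etile \<sigma> ds" "Re z < offs 0 (swp v ds) (h z)"
      using overlap_raise[OF Cons.prems(3) *(1) Cons.prems(2,4) *(2)] by blast
    have "z \<in> etile \<tau> (swps vs (swp v ds))" using z(1) Cons.prems(5) by simp
    hence "etile \<tau> (swps vs (swp v ds)) \<in> etiles (vs @ \<tau> # us) (swp v ds) \<and> z \<in> etile \<tau> (swps vs (swp v ds))"
      by (auto simp: etiles_append)
    thus False using etiles_bounds[OF *(4,3)] z(2) by force
  qed
  have "etile \<sigma> (swp v ds) = etile \<sigma> ds" using blk_swp[OF Cons.prems(3) *(1) ind] by (simp add: etile_def)
  hence "\<sigma> = \<tau> \<and> (\<forall>v\<in>set vs. indep \<sigma> v)"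
    using Cons.prems * ind by (intro Cons.IH[of "swp v ds"]) (auto simp: raises_swp)
  thus ?case using ind by (intro conjI ballI) auto
qed

text \<open>After the swap the graph has passed part of the left side of its tile and never
  returns.\<close>

lemma etile_notin:
  assumes "asc ss (swp \<sigma> ds)" "up ds" "fits (length ds) \<sigma>" "raises \<sigma> ds"
  shows "etile \<sigma> ds \<notin> etiles ss (swp \<sigma> ds)"
proof
  assume *: "etile \<sigma> ds \<in> etiles ss (swp \<sigma> ds)"
  have "\<not> indep \<sigma> \<sigma>" using assms(3) by (auto simp: indep_def fits_def)
  then obtain z where z: "z \<in> etile \<sigma> ds" "Re z < offs 0 (swp \<sigma> ds) (h z)"
    using overlap_raise[OF assms(3,3,2,4,4)] by blast
  have "up (swp \<sigma> ds)" using assms by (simp add: up_swp)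
  thus False using etiles_bounds[OF assms(1) _ * z(1)] z(2) by force
qed

lemma asc_shift:
  assumes "asc (vs @ \<sigma> # us) ds" "\<forall>v\<in>set vs. indep \<sigma> v"
  shows "asc (\<sigma> # vs @ us) ds"
  using assms
proof (induction vs arbitrary: ds)
  case (Cons v vs)
  hence *: "fits (length ds) v" "raises v ds" "asc (vs @ \<sigma> # us) (swp v ds)" "indep \<sigma> v" "indep v \<sigma>"
    by (auto simp: indep_sym)
  have "asc (\<sigma> # vs @ us) (swp v ds)" using Cons.IH[OF *(3)] Cons.prems(2) by simp
  hence "fits (length ds) \<sigma>" "raises \<sigma> (swp v ds)" "asc (vs @ us) (swp \<sigma> (swp v ds))" using * by auto
  thus ?case using * swp_commute[of ds \<sigma> v] by (simp add: raises_swp)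
qed simp

text \<open>The first tile of one tiling lies on the left boundary, so it can be swept first in the other.\<close>

lemma etiles_inj:
  assumes "asc ss ds" "asc ss' ds" "up ds" "etiles ss ds = etiles ss' ds"
  shows "proj_eq_steps ss ss'"
  using assms
proof (induction ss arbitrary: ss' ds)
  case Nil
  thus ?case by (cases ss') (auto simp: proj_eq_steps_def)
next
  case (Cons \<sigma> ss)
  hence *: "fits (length ds) \<sigma>" "raises \<sigma> ds" "up (swp \<sigma> ds)" "asc ss (swp \<sigma> ds)" by (auto simp: up_swp)
  have "etile \<sigma> ds \<in> etiles ss' ds" using Cons.prems(4) by auto
  then obtain vs \<tau> us where s: "ss' = vs @ \<tau> # us" "etile \<sigma> ds = etile \<tau> (swps vs ds)"
    by (auto simp: etiles_mem)
  have i: "\<sigma> = \<tau>" "\<forall>v\<in>set vs. indep \<sigma> v"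
    using etile_first[of vs \<tau> us ds \<sigma>] Cons.prems s * by auto
  have a: "asc (\<sigma> # vs @ us) ds" using Cons.prems(2) s i by (intro asc_shift) auto
  have "etiles (\<sigma> # vs @ us) ds = etiles ss' ds"
    unfolding s(1) i(1)[symmetric] using * i asc_fits[OF Cons.prems(2)] s
    by (intro etiles_shift_letter) auto
  hence "insert (etile \<sigma> ds) (etiles (vs @ us) (swp \<sigma> ds)) = insert (etile \<sigma> ds) (etiles ss (swp \<sigma> ds))"
    using Cons.prems(4) by simp
  \<comment> \<open>The tile of \<open>\<sigma>\<close> does not recur later in either sweep, so it
    can be cancelled from both sets.\<close>
  moreover have "etile \<sigma> ds \<notin> etiles (vs @ us) (swp \<sigma> ds)" "etile \<sigma> ds \<notin> etiles ss (swp \<sigma> ds)"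
    using a *(4) etile_notin[OF _ Cons.prems(3) *(1,2)] by auto
  ultimately have "etiles ss (swp \<sigma> ds) = etiles (vs @ us) (swp \<sigma> ds)" by (metis insert_ident)
  hence IH: "proj_eq_steps ss (vs @ us)" using a * by (intro Cons.IH) auto
  show ?case unfolding proj_eq_steps_def
  proof (intro allI impI)
    fix \<alpha> \<beta> assume ab: "\<not> indep \<alpha> \<beta>"
    let ?f = "filter (\<lambda>c. c = \<alpha> \<or> c = \<beta>)"
    have "?f ss = ?f (vs @ us)" using IH ab unfolding proj_eq_steps_def by blast
    moreover have "?f [\<sigma>] = [] \<or> ?f vs = []"
    proof (rule ccontr)
      assume "\<not> ?thesis"
      then obtain v where v: "\<sigma> = \<alpha> \<or> \<sigma> = \<beta>" "v \<in> set vs" "v = \<alpha> \<or> v = \<beta>"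
        by (auto simp: filter_empty_conv split: if_splits)
      have "indep \<sigma> v" "\<not> indep \<sigma> \<sigma>" using i v *(1) by (auto simp: indep_def fits_def)
      thus False using v ab indep_sym by metis
    qed
    hence "?f ([\<sigma>] @ vs @ us) = ?f (vs @ [\<sigma>] @ us)" by (rule filter_commute)
    moreover have "?f ([\<sigma>] @ ss) = ?f ([\<sigma>] @ vs @ us)"
      unfolding filter_append[of _ "[\<sigma>]"] \<open>?f ss = ?f (vs @ us)\<close> ..
    ultimately have "?f ([\<sigma>] @ ss) = ?f (vs @ [\<sigma>] @ us)" by (simp only:)
    thus "?f (\<sigma> # ss) = ?f ss'" using s(1) i(1) by (simp only: append_Cons append_Nil)
  qed
qed

end

section \<open>Sweeping by reduced words\<close>


text \<open>The letter \<open>i\<close> acts on paths by the swaps \<open>steps i\<close>, of which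
  there are two for most letters of type D, and \<open>top i\<close> is a swap that stands for it:
  by \<open>top_filter\<close> it occurs once in \<open>steps i\<close> and in no other list, and by
  \<open>top_dep\<close> letters not related by \<open>J\<close> have overlapping representatives. A
  new letter is multiplied on the left, so ascents appear as \<open>pos (inv w)\<close>.\<close>

locale sweep_words = sign_group G S pos + height h
  for G :: "('a, 'b) monoid_scheme" (structure) and S pos and h +
  fixes I :: "'i set" and gen :: "'i \<Rightarrow> 'a" and path :: "'a \<Rightarrow> complex list"
    and steps :: "'i \<Rightarrow> (nat \<times> nat) list" and top :: "'i \<Rightarrow> nat \<times> nat"
    and \<P> :: "complex set set" and N :: nat and J :: "'a set set"
    and tl :: "'a list \<Rightarrow> complex set set"
  assumes gen_inj: "inj_on gen I" and S_eq: "S = gen ` I" and N_pos: "0 < N"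
    and path_length: "w \<in> generate G S \<Longrightarrow> length (path w) = N"
    and path_up: "w \<in> generate G S \<Longrightarrow> up (path w)"
    and path_gen: "w \<in> generate G S \<Longrightarrow> i \<in> I \<Longrightarrow> path (gen i \<otimes> w) = swps (steps i) (path w)"
    and steps_fit: "i \<in> I \<Longrightarrow> \<sigma> \<in> set (steps i) \<Longrightarrow> fits N \<sigma>"
    and ascend: "w \<in> generate G S \<Longrightarrow> i \<in> I \<Longrightarrow> pos (inv w) (gen i) \<Longrightarrow>
           asc (steps i) (path w) \<and> etiles (steps i) (path w) \<subseteq> \<P>"
    and J_steps: "a \<in> S \<Longrightarrow> b \<in> S \<Longrightarrow> {a, b} \<in> J \<Longrightarrow> \<exists>i\<in>I. \<exists>j\<in>I. a = gen i \<and> b = gen j \<and>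
           (\<forall>\<sigma>\<in>set (steps i). \<forall>\<tau>\<in>set (steps j). indep \<sigma> \<tau>)"
    and J_comm: "{a, b} \<in> J \<Longrightarrow> a \<in> S \<and> b \<in> S \<and> a \<noteq> b \<and> a \<otimes> b = b \<otimes> a"
    and top_dep: "i \<in> I \<Longrightarrow> j \<in> I \<Longrightarrow> {gen i, gen j} \<notin> J \<Longrightarrow> \<not> indep (top i) (top j)"
    and top_filter: "i \<in> I \<Longrightarrow> j \<in> I \<Longrightarrow> filter (\<lambda>c. c = top i) (steps j) = (if i = j then [top i] else [])"
    and tl_def: "r \<in> lists S \<Longrightarrow> tl r =
           \<Union>{etiles (steps i) (path (word_prod G vs)) | us i vs. i \<in> I \<and> r = us @ gen i # vs}"
begin

text \<open>Reversed because the rightmost letter of a word acts first on the path.\<close>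

definition step_word :: "'i list \<Rightarrow> (nat \<times> nat) list" where
  "step_word is = concat (map steps (rev is))"

lemma index_word: "r \<in> lists S \<Longrightarrow> \<exists>is \<in> lists I. r = map gen is"
  by (metis S_eq lists_image imageE)

lemma gen_S: "i \<in> I \<Longrightarrow> gen i \<in> S" by (simp add: S_eq)

lemma gen_word: "is \<in> lists I \<Longrightarrow> map gen is \<in> lists S"
  by (auto simp: S_eq)

lemma one_W: "\<one> \<in> W" by (rule generate.one)

lemma swps_path: "is \<in> lists I \<Longrightarrow> swps (step_word is) (path \<one>) = path (prod_of (map gen is))"
proof (induction "is")
  case (Cons i "is")
  thus ?case using path_gen[of "prod_of (map gen is)" i] prod_of_W[OF gen_word[of "is"]]
    by (simp add: step_word_def swps_append)
qed (simp add: step_word_def)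

lemma tl_Cons:
  assumes "i \<in> I" "r \<in> lists S"
  shows "tl (gen i # r) = etiles (steps i) (path (prod_of r)) \<union> tl r"
proof -
  have l: "gen i # r \<in> lists S" using assms gen_S by simp
  have "{etiles (steps j) (path (prod_of vs)) | us j vs. j \<in> I \<and> gen i # r = us @ gen j # vs} =
    insert (etiles (steps i) (path (prod_of r)))
      {etiles (steps j) (path (prod_of vs)) | us j vs. j \<in> I \<and> r = us @ gen j # vs}" (is "?L = insert ?e ?R")
  proof (intro equalityI subsetI)
    fix A assume "A \<in> ?L"
    then obtain us j vs where *: "A = etiles (steps j) (path (prod_of vs))" "j \<in> I" "gen i # r = us @ gen j # vs"
      by blast
    show "A \<in> insert ?e ?R"
    proof (cases us)
      case Nil
      hence "j = i" "vs = r" using * assms(1) gen_inj by (auto simp: inj_on_def)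
      thus ?thesis using * by simp
    next
      case (Cons b us')
      hence "r = us' @ gen j # vs" using * by simp
      thus ?thesis using * by blast
    qed
  next
    fix A assume "A \<in> insert ?e ?R"
    thus "A \<in> ?L"
    proof
      assume "A = ?e"
      moreover have "gen i # r = [] @ gen i # r" by simp
      ultimately show ?thesis using assms(1) by blast
    next
      assume "A \<in> ?R"
      then obtain us j vs where *: "A = etiles (steps j) (path (prod_of vs))" "j \<in> I" "r = us @ gen j # vs"
        by blast
      hence "gen i # r = (gen i # us) @ gen j # vs" by simp
      thus ?thesis using * by blast
    qed
  qed
  thus ?thesis unfolding tl_def[OF l] tl_def[OF assms(2)] by simp
qed

lemma tl_etiles: "is \<in> lists I \<Longrightarrow> tl (map gen is) = etiles (step_word is) (path \<one>)"
proof (induction "is")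
  case Nil
  show ?case using tl_def[of "[]"] by (simp add: step_word_def)
next
  case (Cons i "is")
  have "step_word (i # is) = step_word is @ steps i" by (simp add: step_word_def)
  thus ?case using Cons tl_Cons[of i "map gen is"] gen_word[of "is"] swps_path[of "is"]
    by (auto simp: etiles_append)
qed

text \<open>Suffixes of a reduced word are reduced, so each letter is a left ascent of the product
  after it, and \<open>ascend\<close> applies.\<close>

lemma asc_word:
  "is \<in> lists I \<Longrightarrow> len (prod_of (map gen is)) = length is \<Longrightarrow>
     asc (step_word is) (path \<one>) \<and> etiles (step_word is) (path \<one>) \<subseteq> \<P>"
proof (induction "is")
  case Nil thus ?case by (simp add: step_word_def)
next
  case (Cons i "is")
  define w where "w = prod_of (map gen is)"
  have l: "i \<in> I" "is \<in> lists I" using Cons by auto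
  have w: "w \<in> W" using prod_of_W[OF gen_word[OF l(2)]] by (simp add: w_def)
  have S: "gen i \<in> S" using l gen_S by simp
  have "len w \<le> length is" using len_le[OF gen_word[OF l(2)]] by (simp add: w_def)
  moreover have "len (gen i \<otimes> w) \<le> 1 + len w" using len_mult[of "gen i" w] len_gen[OF S] S w by simp
  moreover have "len (gen i \<otimes> w) = Suc (length is)" using Cons.prems by (simp add: w_def)
  ultimately have len: "len w = length is" "len w < len (gen i \<otimes> w)" by auto
  have IH: "asc (step_word is) (path \<one>)" "etiles (step_word is) (path \<one>) \<subseteq> \<P>"
    using Cons.IH[OF l(2)] len by (auto simp: w_def)
  have "pos (inv w) (gen i)" using left_pos_iff[OF w S] len by simp
  note a = ascend[OF w l(1) this]
  have "step_word (i # is) = step_word is @ steps i" by (simp add: step_word_def)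
  moreover have "swps (step_word is) (path \<one>) = path w" using swps_path[OF l(2)] by (simp add: w_def)
  ultimately show ?case using IH a by (simp add: asc_append etiles_append)
qed

text \<open>No list of steps contains the representative of another letter, so filtering swaps
  amounts to filtering letters.\<close>

lemma filter_steps:
  "is \<in> lists I \<Longrightarrow> i \<in> I \<Longrightarrow> j \<in> I \<Longrightarrow>
     filter (\<lambda>c. c = top i \<or> c = top j) (concat (map steps is)) = map top (filter (\<lambda>c. c = i \<or> c = j) is)"
proof (induction "is")
  case (Cons k "is")
  have k: "k \<in> I" using Cons by simp
  have top_inj: "i = j" if "top i = top j"
  proof (rule ccontr)
    assume "i \<noteq> j"
    thus False using top_filter[OF Cons.prems(2,3)] top_filter[OF Cons.prems(3,3)] that by simp
  qed
  have ne: "top i \<notin> set (steps k) \<or> k = i" "top j \<notin> set (steps k) \<or> k = j"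
    using top_filter[OF Cons.prems(2) k] top_filter[OF Cons.prems(3) k]
    by (auto simp: filter_empty_conv split: if_splits)
  have "filter (\<lambda>c. c = top i \<or> c = top j) (steps k) = (if k = i \<or> k = j then [top k] else [])"
  proof (cases "k = i \<or> k = j")
    case False
    thus ?thesis using ne by (auto simp: filter_empty_conv)
  next
    case True
    have "filter (\<lambda>c. c = top i \<or> c = top j) (steps k) = filter (\<lambda>c. c = top k) (steps k)"
      using True ne top_inj by (intro filter_cong) auto
    thus ?thesis using True top_filter[OF k k] by simp
  qed
  thus ?case using Cons by simp
qed simp

text \<open>A pair of letters outside \<open>J\<close> has overlapping representatives, onto which
  the projections agree by \<open>etiles_inj\<close>; \<open>filter_steps\<close> turns them back
  into projections onto the letters.\<close>

lemma tl_inj_words: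
  assumes "r \<in> reduced_words G S w" "r' \<in> reduced_words G S w" "tl r = tl r'"
  shows "proj_eq S J r r'"
proof -
  obtain "is" where i: "is \<in> lists I" "r = map gen is"
    using assms index_word[of r] by (auto simp: reduced_words_def)
  obtain js where j: "js \<in> lists I" "r' = map gen js"
    using assms index_word[of r'] by (auto simp: reduced_words_def)
  have li: "len (prod_of (map gen is)) = length is" "len (prod_of (map gen js)) = length js"
    using assms i j by (auto simp: reduced_words_def)
  have "proj_eq_steps (step_word is) (step_word js)"
    using asc_word[OF i(1) li(1)] asc_word[OF j(1) li(2)] tl_etiles[OF i(1)] tl_etiles[OF j(1)]
      path_up[OF one_W] assms(3) i j by (intro etiles_inj[of _ "path \<one>"]) auto
  hence st: "filter (\<lambda>c. c = \<sigma> \<or> c = \<tau>) (step_word is) = filter (\<lambda>c. c = \<sigma> \<or> c = \<tau>) (step_word js)"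
    if "\<not> indep \<sigma> \<tau>" for \<sigma> \<tau> using that unfolding proj_eq_steps_def by blast
  show ?thesis unfolding proj_eq_def
  proof (intro ballI impI)
    fix a b assume ab: "a \<in> S" "b \<in> S" "{a, b} \<notin> J"
    obtain k l where kl: "k \<in> I" "l \<in> I" "a = gen k" "b = gen l" using ab S_eq by auto
    let ?f = "filter (\<lambda>c. c = k \<or> c = l)"
    have ri: "rev is \<in> lists I" "rev js \<in> lists I" using i j by auto
    have "map top (?f (rev is)) = map top (?f (rev js))"
      using st[OF top_dep[OF kl(1,2)]] ab kl filter_steps[OF ri(1) kl(1,2)] filter_steps[OF ri(2) kl(1,2)]
      by (simp add: step_word_def)
    moreover have "k = l" if "top k = top l"
    proof (rule ccontr)
      assume "k \<noteq> l"
      thus False using top_filter[OF kl(1,2)] top_filter[OF kl(2,2)] that by simp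
    qed
    hence "inj_on top (set (?f (rev is)) \<union> set (?f (rev js)))"
      by (intro inj_onI) (auto split: if_splits)
    ultimately have "?f (rev is) = ?f (rev js)" by (rule map_inj_on)
    hence "?f is = ?f js" by (simp add: rev_filter[symmetric])
    moreover have "filter (\<lambda>c. c = a \<or> c = b) (map gen ks) = map gen (?f ks)" if "ks \<in> lists I" for ks
      using that kl gen_inj unfolding filter_map by (auto simp: inj_on_def intro!: arg_cong[of _ _ "map gen"] filter_cong)
    ultimately show "filter (\<lambda>c. c = a \<or> c = b) r = filter (\<lambda>c. c = a \<or> c = b) r'" using i j by simp
  qed
qed

text \<open>The swaps of the two letters are independent, so their lists can pass each other without
  changing any tile.\<close>

lemma tl_swap_words:
  assumes "{a, b} \<in> J" "u \<in> lists S" "v \<in> lists S"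
  shows "tl (u @ [a, b] @ v) = tl (u @ [b, a] @ v)"
proof -
  have ab: "a \<in> S" "b \<in> S" using J_comm[OF assms(1)] by auto
  obtain i j where ij: "i \<in> I" "j \<in> I" "a = gen i" "b = gen j"
    "\<And>\<sigma> \<tau>. \<sigma> \<in> set (steps i) \<Longrightarrow> \<tau> \<in> set (steps j) \<Longrightarrow> indep \<sigma> \<tau>" using J_steps[OF ab assms(1)] by blast
  obtain us vs where uv: "us \<in> lists I" "vs \<in> lists I" "u = map gen us" "v = map gen vs"
    using index_word assms by metis
  define d where "d = swps (step_word vs) (path \<one>)"
  have d: "length d = N" unfolding d_def swps_path[OF uv(2)]
    by (intro path_length prod_of_W gen_word uv)
  have "etiles (steps j @ steps i @ step_word us) d = etiles (steps i @ steps j @ step_word us) d"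
    using ij steps_fit indep_sym d by (intro etiles_shift) blast+
  hence "etiles (step_word (us @ [i, j] @ vs)) (path \<one>) = etiles (step_word (us @ [j, i] @ vs)) (path \<one>)"
    by (simp add: step_word_def etiles_append[of "concat (map steps (rev vs))"] d_def)
  thus ?thesis using tl_etiles[of "us @ [i, j] @ vs"] tl_etiles[of "us @ [j, i] @ vs"] uv ij by simp
qed

theorem word_classes_bij:
  assumes "admissible_partition G S e \<Sigma>" "x \<in> carrier (block_group G e \<Sigma>)"
  shows "\<exists>f. bij_betw f (word_classes (block_group G e \<Sigma>) (block_gens G e \<Sigma>) (block_relations G e J \<Sigma>) x)
           (consistent_tilings G S J e \<Sigma> (\<lambda>w. tilings_by \<P> 0 (path \<one>) (path w)) tl x)"
proof -
  interpret tiling_model G S pos e \<Sigma> J "\<lambda>w. tilings_by \<P> 0 (path \<one>) (path w)" tl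
  proof (unfold_locales)
    show "admissible_partition G S e \<Sigma>" by fact
    show "\<And>a b. {a, b} \<in> J \<Longrightarrow> a \<in> S \<and> b \<in> S \<and> a \<noteq> b \<and> a \<otimes> b = b \<otimes> a" by (rule J_comm)
    show "\<And>a b u v. {a, b} \<in> J \<Longrightarrow> u \<in> lists S \<Longrightarrow> v \<in> lists S \<Longrightarrow> tl (u @ [a, b] @ v) = tl (u @ [b, a] @ v)"
      by (rule tl_swap_words)
    show "\<And>w r r'. w \<in> W \<Longrightarrow> r \<in> reduced_words G S w \<Longrightarrow> r' \<in> reduced_words G S w \<Longrightarrow> tl r = tl r' \<Longrightarrow> proj_eq S J r r'"
      by (rule tl_inj_words)
    fix w r assume r: "w \<in> W" "r \<in> reduced_words G S w"
    then obtain "is" where i: "is \<in> lists I" "r = map gen is" using index_word[of r] by (auto simp: reduced_words_def)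
    have w: "prod_of (map gen is) = w" "len w = length is" using r i by (auto simp: reduced_words_def)
    note a = asc_word[OF i(1), unfolded w(1), OF w(2)]
    have ne: "path \<one> \<noteq> []" using path_length[OF one_W] N_pos by auto
    show "tl r \<in> tilings_by \<P> 0 (path \<one>) (path w)"
      using etiles_tiling[OF a[THEN conjunct1] path_up[OF one_W] ne a[THEN conjunct2]]
      unfolding i(2) tl_etiles[OF i(1)] swps_path[OF i(1)] w .
  qed
  show ?thesis using assms(2) by (intro word_classes_bij_tilings) (simp add: block_group_def)
qed

end

section \<open>Rhombi and megatiles\<close>


lemma swp_nth:
  assumes "fits (length ds) (a, k)" "j < length ds"
  shows "swp (a, k) ds ! j = ds ! (if a \<le> j \<and> j < a + k then j + k else if a + k \<le> j \<and> j < a + 2 * k then j - k else j)"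
proof -
  obtain pre A B post where "ds = pre @ A @ B @ post" "length pre = a" "length A = k" "length B = k"
    "swp (a, k) ds = pre @ B @ A @ post" using swp_split[OF assms(1)] by metis
  thus ?thesis by (auto simp: nth_append add.commute)
qed

lemma take_drop_1: "a < length xs \<Longrightarrow> take (Suc 0) (drop a xs) = [xs ! a]"
  by (simp add: take_Suc_conv_app_nth)

lemma take_drop_2: "Suc a < length xs \<Longrightarrow> take 2 (drop a xs) = [xs ! a, xs ! Suc a]"
  by (simp add: take_Suc_conv_app_nth numeral_2_eq_2)

text \<open>The tile depends on the two paths only through \<open>blk\<close>, so it may be computed
  from paths that differ by an independent swap.\<close>

lemma tile_between_cong:
  assumes "blk (a, k) ds = blk (a, k) ds'" "blk (a, k) es = blk (a, k) es'"
  shows "tile_between ds es a (2 * k) = tile_between ds' es' a (2 * k)"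
proof -
  have "take (2 * k) (drop a xs) = take k (drop a xs) @ take k (drop (a + k) xs)" for xs :: "complex list"
    by (simp add: mult_2 take_add add.commute)
  thus ?thesis using assms by (simp add: blk_def tile_between_def path_vertex_def)
qed

text \<open>With \<open>\<alpha> = Re u / Im u\<close>, \<open>\<beta> = Re v / Im v\<close>, \<open>p = Im u\<close>, \<open>q = Im v\<close>, this is the gap between the
  two sides of a megatile in its lower half; the upper half is symmetric.\<close>

lemma megatile_gap:
  fixes \<alpha> \<beta> p q t :: real
  assumes "0 < p" "0 < q" "0 < t" "t \<le> p + q"
    and "0 < \<alpha> \<and> 0 < \<beta> \<or> \<alpha> < 0 \<and> q \<le> p \<and> 0 < \<alpha> * p + \<beta> * q \<and> 0 < \<alpha> * (2 * p - q) + \<beta> * q"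
  shows "0 < \<alpha> * (max 0 (min p t) + max 0 (min p (t - q))) + \<beta> * (max 0 (min q t) + max 0 (min q (t - p)))"
  using assms(5)
proof
  assume "0 < \<alpha> \<and> 0 < \<beta>"
  thus ?thesis using assms(1-4) by (intro add_pos_nonneg mult_pos_pos mult_nonneg_nonneg) (auto simp: min_def max_def)
next
  assume *: "\<alpha> < 0 \<and> q \<le> p \<and> 0 < \<alpha> * p + \<beta> * q \<and> 0 < \<alpha> * (2 * p - q) + \<beta> * q"
  \<comment> \<open>As \<open>\<alpha>\<close> is negative, passing from \<open>p\<close> to the
    smaller \<open>q\<close> raises the sum, whence \<open>\<alpha> + \<beta>\<close> is
    positive.\<close>
  have "\<alpha> * p \<le> \<alpha> * q" using * by (simp add: mult_left_mono_neg)
  moreover have "0 < \<alpha> * p + \<beta> * q" using * by simp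
  ultimately have "0 < \<alpha> * q + \<beta> * q" by linarith
  hence "0 < (\<alpha> + \<beta>) * q" by (simp only: distrib_right)
  hence ab: "0 < \<alpha> + \<beta>" using assms(2) zero_less_mult_pos2 by blast
  consider "t \<le> q" | "q \<le> t" "t \<le> p" | "p \<le> t" by linarith
  thus ?thesis
  proof cases
    case 1
    hence g: "0 < (\<alpha> + \<beta>) * t" using ab assms(3) by simp
    have v: "max 0 (min p t) = t" "max 0 (min p (t - q)) = 0" "max 0 (min q t) = t" "max 0 (min q (t - p)) = 0"
      using 1 conjunct1[OF conjunct2[OF *]] assms(1-3) by (auto simp: min_def max_def)
    show ?thesis unfolding v using g by (simp add: algebra_simps)
  next
    case 2
    \<comment> \<open>Between \<open>q\<close> and \<open>p\<close> only the negative term varies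
      with \<open>t\<close>, so t = p is the worst case; it is the last inequality of the
      hypothesis.\<close>
    have "\<alpha> * (2 * p - q) \<le> \<alpha> * (2 * t - q)" using * 2 by (intro mult_left_mono_neg) auto
    hence g: "0 < \<alpha> * (2 * t - q) + \<beta> * q" using * by linarith
    have v: "max 0 (min p t) = t" "max 0 (min p (t - q)) = t - q" "max 0 (min q t) = q" "max 0 (min q (t - p)) = 0"
      using 2 assms(1-3) by (auto simp: min_def max_def)
    show ?thesis unfolding v using g by (simp add: algebra_simps)
  next
    case 3
    \<comment> \<open>From t = p onwards the gap increases at the rate
      \<open>\<alpha> + \<beta>\<close>.\<close>
    have "0 \<le> (\<alpha> + \<beta>) * (t - p)" using ab 3 by simp
    hence g: "0 < \<alpha> * (p + t - q) + \<beta> * (q + t - p)" using * by (simp add: algebra_simps)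
    have v: "max 0 (min p t) = p" "max 0 (min p (t - q)) = t - q" "max 0 (min q t) = q" "max 0 (min q (t - p)) = t - p"
      using 3 conjunct1[OF conjunct2[OF *]] assms(1-4) by (auto simp: min_def max_def)
    show ?thesis unfolding v using g by (simp add: algebra_simps)
  qed
qed

text \<open>The hypothesis of \<open>megatile_gap\<close> with denominators cleared; in the second
  alternative \<open>u\<close> leans to the left.\<close>

definition gap_ok :: "complex \<Rightarrow> complex \<Rightarrow> bool" where
  "gap_ok u v \<longleftrightarrow> 0 < Re u \<and> 0 < Re v \<or>
     Re u < 0 \<and> Im v \<le> Im u \<and> 0 < Re u + Re v \<and> Re u * Im v < 2 * Re u * Im u + Re v * Im u"

lemma clamp_reflect:
  fixes p x :: real
  shows "0 \<le> p \<Longrightarrow> max 0 (min p (p - x)) = p - max 0 (min p x)"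
  by (auto simp: min_def max_def)

context height begin

text \<open>The width at height \<open>t\<close> is \<open>\<beta> - \<alpha>\<close> times
  \<open>D\<close>, where \<open>D\<close> is the height gained on \<open>v\<close> when it comes
  first minus the height gained on it when it comes second.\<close>

lemma raising_rhombus:
  assumes "0 < h u" "0 < h v" "Re u * h v < Re v * h u"
  shows "raising [u] [v]"
  unfolding raising_def
proof (intro allI impI)
  fix t :: real assume t: "0 < t" "t < h (sum_list ([u] @ [v]))"
  define \<alpha> where "\<alpha> = Re u / h u"
  define \<beta> where "\<beta> = Re v / h v"
  have ab: "\<alpha> < \<beta>" using assms by (simp add: \<alpha>_def \<beta>_def field_simps)
  define D where "D = max 0 (min (h v) t) - max 0 (min (h v) (t - h u))"
  have "0 < D" using t assms by (auto simp: D_def min_def max_def)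
  hence "0 < (\<beta> - \<alpha>) * D" using ab by simp
  moreover have "max 0 (min (h u) t) =
     max 0 (min (h v) t) + max 0 (min (h u) (t - h v)) - max 0 (min (h v) (t - h u))"
    using t assms by (auto simp: min_def max_def)
  hence "\<alpha> * max 0 (min (h u) t) + \<beta> * max 0 (min (h v) (t - h u)) + (\<beta> - \<alpha>) * D =
     \<beta> * max 0 (min (h v) t) + \<alpha> * max 0 (min (h u) (t - h v))"
    unfolding D_def by (simp only:) (simp only: algebra_simps)
  ultimately show "offs 0 ([u] @ [v]) t < offs 0 ([v] @ [u]) t"
    by (simp add: \<alpha>_def[symmetric] \<beta>_def[symmetric])
qed

lemma rhombus_tile:
  assumes "0 < h u" "0 < h v" "Re u * h v < Re v * h u" "norm u = 1" "norm v = 1"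
  shows "polygon p [u, v] [v, u] \<in> unit_rhombi"
proof -
  have "u \<noteq> v" "u \<noteq> - v" using assms by (auto simp: )
  thus ?thesis using assms unfolding unit_rhombi_def by blast
qed

text \<open>Strictness at all intermediate heights leaves only the end points in common;
  \<open>megatiles\<close> demands this of its two sides.\<close>

lemma raising_polylines:
  assumes "up A" "up B" "A @ B \<noteq> []" "raising A B"
  shows "polyline p (A @ B) \<inter> polyline p (B @ A) = {p, p + sum_list (A @ B)}"
proof -
  have u: "up (A @ B)" "up (B @ A)" "B @ A \<noteq> []" using assms by auto
  define H where "H = h (sum_list (A @ B))"
  have s: "sum_list (B @ A) = sum_list (A @ B)" by (simp add: add.commute)
  have H: "0 < H" unfolding H_def using u(1) assms(3) by (rule up_sum_pos)
  have o: "offs (h p) (A @ B) (h p) = 0" "offs (h p) (B @ A) (h p) = 0"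
    "offs (h p) (A @ B) (h p + H) = Re (sum_list (A @ B))" "offs (h p) (B @ A) (h p + H) = Re (sum_list (A @ B))"
    using u s by (auto simp: offs_below offs_above H_def)
  show ?thesis
  proof (intro equalityI subsetI)
    fix z assume "z \<in> polyline p (A @ B) \<inter> polyline p (B @ A)"
    hence z: "h p \<le> h z" "h z \<le> h p + H" "Re z = Re p + offs (h p) (A @ B) (h z)"
      "offs (h p) (A @ B) (h z) = offs (h p) (B @ A) (h z)"
      using polyline_graph[OF u(1) assms(3)] polyline_graph[OF u(2,3)] by (auto simp: H_def)
    have "\<not> (0 < h z - h p \<and> h z - h p < H)"
    proof
      assume "0 < h z - h p \<and> h z - h p < H"
      hence "offs 0 (A @ B) (h z - h p) < offs 0 (B @ A) (h z - h p)"
        using assms(4) unfolding raising_def H_def[symmetric] by blast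
      hence "offs (h p) (A @ B) (h z) < offs (h p) (B @ A) (h z)"
        by (simp only: offs_shift[of "h p"])
      thus False using z(4) by simp
    qed
    hence "h z = h p \<or> h z = h p + H" using z by auto
    thus "z \<in> {p, p + sum_list (A @ B)}"
    proof
      assume "h z = h p"
      hence "z = p" using z(3) o(1) by (intro point_eqI) simp_all
      thus ?thesis by simp
    next
      assume hz: "h z = h p + H"
      hence "Re z = Re p + Re (sum_list (A @ B))" using z(3) o(3) by simp
      hence "z = p + sum_list (A @ B)" using hz by (intro point_eqI) (simp_all only: h_add H_def plus_complex.sel)
      thus ?thesis by simp
    qed
  next
    fix z assume "z \<in> {p, p + sum_list (A @ B)}"
    hence "h z = h p \<and> Re z = Re p \<or> h z = h p + H \<and> Re z = Re p + Re (sum_list (A @ B))"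
      unfolding H_def by (metis empty_iff h_add insert_iff plus_complex.sel(1))
    thus "z \<in> polyline p (A @ B) \<inter> polyline p (B @ A)"
      unfolding polyline_graph[OF u(1) assms(3)] polyline_graph[OF u(2,3)] s H_def[symmetric]
      using o H by (elim disjE conjE) (simp_all del: sum_list_append)
  qed
qed

end

interpretation upward: height Im by unfold_locales simp

interpretation downward: height "\<lambda>z. - Im z" by unfold_locales simp

text \<open>Both sides are symmetric about the middle height, so it suffices to compute the lower
  half, where the width is the gap of \<open>megatile_gap\<close> for \<open>u\<close> and
  \<open>v\<close> in one order or the other.\<close>

lemma raising_megatile:
  assumes "0 < Im u" "0 < Im v" "gap_ok u v \<or> gap_ok v u"
  shows "upward.raising [- cnj v, - cnj u] [u, v]"
  unfolding upward.raising_def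
proof (intro allI impI)
  fix t assume t: "0 < t" "t < Im (sum_list ([- cnj v, - cnj u] @ [u, v]))"
  define p where "p = Im u"
  define q where "q = Im v"
  define \<alpha> where "\<alpha> = Re u / p"
  define \<beta> where "\<beta> = Re v / q"
  define c where "c x s = max 0 (min x s)" for x s :: real
  have pq: "0 < p" "0 < q" using assms by (auto simp: p_def q_def)
  have gap: "0 < \<alpha> * (c p s + c p (s - q)) + \<beta> * (c q s + c q (s - p))" if s: "0 < s" "s \<le> p + q" for s
  proof -
    have "0 < \<alpha> \<and> 0 < \<beta> \<or> \<alpha> < 0 \<and> q \<le> p \<and> 0 < \<alpha> * p + \<beta> * q \<and> 0 < \<alpha> * (2 * p - q) + \<beta> * q" if "gap_ok u v"
      using that pq assms by (auto simp: gap_ok_def \<alpha>_def \<beta>_def field_simps p_def q_def)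
    moreover have "0 < \<beta> \<and> 0 < \<alpha> \<or> \<beta> < 0 \<and> p \<le> q \<and> 0 < \<beta> * q + \<alpha> * p \<and> 0 < \<beta> * (2 * q - p) + \<alpha> * p" if "gap_ok v u"
      using that pq assms by (auto simp: gap_ok_def \<alpha>_def \<beta>_def field_simps p_def q_def)
    ultimately show ?thesis
      using megatile_gap[OF pq s, of \<alpha> \<beta>] megatile_gap[OF pq(2,1) s(1), of \<beta> \<alpha>] s assms(3)
      unfolding c_def by (auto simp: add.commute)
  qed
  have "0 < \<alpha> * (c p t + c p (t - q) - c p (t - p - q) - c p (t - p - 2 * q)) +
      \<beta> * (c q t + c q (t - p) - c q (t - q - p) - c q (t - q - 2 * p))"
  proof (cases "t \<le> p + q")
    case True
    hence "c p (t - p - q) = 0" "c p (t - p - 2 * q) = 0" "c q (t - q - p) = 0" "c q (t - q - 2 * p) = 0"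
      using pq by (auto simp: c_def)
    thus ?thesis using gap[OF t(1) True] by simp
  next
    case False
    \<comment> \<open>Reflection in the middle height; the octagon has total height
      \<open>2 * p + 2 * q\<close>.\<close>
    define s where "s = 2 * p + 2 * q - t"
    have s: "0 < s" "s \<le> p + q" using t False by (auto simp: s_def p_def q_def)
    have cr: "c x (x - r) = x - c x r" if "0 < x" for x r
      using clamp_reflect[of x r] that by (simp add: c_def)
    have e: "t - p - q = p - (s - q)" "t - p - 2 * q = p - s" "t - q - p = q - (s - p)" "t - q - 2 * p = q - s"
      by (simp_all add: s_def)
    have "c p (t - p - q) = p - c p (s - q)" "c p (t - p - 2 * q) = p - c p s"
      "c q (t - q - p) = q - c q (s - p)" "c q (t - q - 2 * p) = q - c q s"
      unfolding e using cr pq by blast+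
    moreover have "c p t = p" "c p (t - q) = p" "c q t = q" "c q (t - p) = q"
      using False pq by (auto simp: c_def)
    ultimately show ?thesis using gap[OF s] by (simp add: add.commute)
  qed
  moreover have "upward.offs 0 ([- cnj v, - cnj u] @ [u, v]) t =
      - \<beta> * c q t - \<alpha> * c p (t - q) + \<alpha> * c p (t - p - q) + \<beta> * c q (t - q - 2 * p)"
    by (simp add: c_def \<alpha>_def \<beta>_def p_def q_def algebra_simps)
  moreover have "upward.offs 0 ([u, v] @ [- cnj v, - cnj u]) t =
      \<alpha> * c p t + \<beta> * c q (t - p) - \<beta> * c q (t - q - p) - \<alpha> * c p (t - p - 2 * q)"
    by (simp add: c_def \<alpha>_def \<beta>_def p_def q_def algebra_simps)
  ultimately show "upward.offs 0 ([- cnj v, - cnj u] @ [u, v]) t < upward.offs 0 ([u, v] @ [- cnj v, - cnj u]) t"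
    by (simp add: algebra_simps)
qed

text \<open>The definition reads the left side downwards, so \<open>e1\<close> and \<open>e2\<close>
  are the negatives of its two upper edges, \<open>v\<close> and then \<open>u\<close>.\<close>

lemma megatile_tile:
  assumes "0 < Im u" "0 < Im v" "upward.raising [- cnj v, - cnj u] [u, v]" "norm u = 1" "norm v = 1"
    "Re u \<noteq> 0" "Re v \<noteq> 0" "u \<noteq> v" "0 < Re (u + v)"
  shows "polygon p ([- cnj v, - cnj u] @ [u, v]) ([u, v] @ [- cnj v, - cnj u]) \<in> megatiles"
proof -
  define e1 where "e1 = - v"
  define e2 where "e2 = - u"
  define E where "E = [e1, e2, - cnj e2, - cnj e1]"
  define F where "F = map (\<lambda>z. - cnj z) [E ! 1, E ! 0, E ! 3, E ! 2]"
  let ?A = "[- cnj v, - cnj u] @ [u, v]" and ?B = "[u, v] @ [- cnj v, - cnj u]"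
  have E: "E = rev (map uminus ?A)" and F: "F = rev (map uminus ?B)"
    by (simp_all add: E_def F_def e1_def e2_def)
  define q where "q = p + sum_list ?A"
  have q': "q = p + sum_list ?B" by (simp add: q_def add.commute add.left_commute)
  have pE: "polyline q E = polyline p ?A" unfolding q_def E by (rule polyline_rev)
  have pF: "polyline q F = polyline p ?B" unfolding q' F by (rule polyline_rev)
  have "polyline p ?A \<inter> polyline p ?B = {p, q}"
    unfolding q_def using assms by (intro upward.raising_polylines) auto
  hence "polyline q E \<inter> polyline q F = {p, q}" unfolding pE pF .
  moreover have "q + sum_list E = p" by (simp add: q_def E_def e1_def e2_def)
  ultimately have "polyline q E \<inter> polyline q F = {q, q + sum_list E}" by auto
  moreover have "norm e1 = 1" "norm e2 = 1" "Im e1 < 0" "Im e2 < 0" "Re (e1 + e2) < 0" "e1 \<noteq> e2" "Re e1 \<noteq> 0" "Re e2 \<noteq> 0"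
    using assms by (auto simp: e1_def e2_def)
  ultimately have "polygon q E F \<in> megatiles"
    unfolding megatiles_def using E_def F_def by blast
  moreover have "polygon q E F = polygon p ?A ?B"
    unfolding polygon_def polygon_boundary_def pE pF ..
  ultimately show ?thesis by simp
qed

section \<open>Type A\<close>


text \<open>\<open>pos\<close> receives the generator and not its index; as \<open>gen_A\<close> is
  injective, at most one index is constrained. The inequality says that w keeps the simple root of
  \<open>gen_A i\<close> positive.\<close>

definition pos_A :: "nat \<Rightarrow> (nat \<Rightarrow> nat) \<Rightarrow> (nat \<Rightarrow> nat) \<Rightarrow> bool" where
  "pos_A n w s \<longleftrightarrow> (\<forall>i\<in>{1..n - 1}. s = gen_A i \<longrightarrow> w i < w (i + 1))"

lemma gen_A_apply: "gen_A i x = (if x = i then i + 1 else if x = i + 1 then i else x)"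
  by (simp add: gen_A_def Transposition.transpose_def)

lemma gen_A_inj: "gen_A i = gen_A j \<Longrightarrow> i = j"
proof -
  assume "gen_A i = gen_A j"
  hence "gen_A i i = gen_A j i" by (rule fun_cong)
  thus ?thesis by (auto simp: gen_A_apply split: if_splits)
qed

lemma gen_A_square: "gen_A i \<circ> gen_A i = id"
  by (simp add: gen_A_def)

lemma gen_A_permutes: "i \<in> {1..n - 1} \<Longrightarrow> gen_A i permutes {1..n}"
  unfolding gen_A_def by (intro permutes_swap_id) auto

lemma pos_A_iff: "i \<in> {1..n - 1} \<Longrightarrow> pos_A n w (gen_A i) \<longleftrightarrow> w i < w (i + 1)"
  using gen_A_inj by (auto simp: pos_A_def)

lemma gen_A_commute: "i + 2 \<le> j \<Longrightarrow> gen_A i \<circ> gen_A j = gen_A j \<circ> gen_A i"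
  by (rule ext) (auto simp: gen_A_apply)

lemma gens_A_carrier: "gens_A n \<subseteq> carrier (sym_group n)"
  using gen_A_permutes by (auto simp: gens_A_def sym_group_carrier)

lemma generate_A_permutes: "w \<in> generate (sym_group n) (gens_A n) \<Longrightarrow> w permutes {1..n}"
  using group.generate_in_carrier[OF sym_group_is_group gens_A_carrier] by (simp add: sym_group_carrier)

lemma sign_group_A: "sign_group (sym_group n) (gens_A n) (pos_A n)"
proof -
  interpret group "sym_group n" by (rule sym_group_is_group)
  show ?thesis
  proof (unfold_locales)
    show "gens_A n \<subseteq> carrier (sym_group n)" by (rule gens_A_carrier)
    fix s assume "s \<in> gens_A n"
    then obtain i where i: "i \<in> {1..n - 1}" "s = gen_A i" by (auto simp: gens_A_def)
    show "s \<otimes>\<^bsub>sym_group n\<^esub> s = \<one>\<^bsub>sym_group n\<^esub>"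
      by (simp add: sym_group_mult sym_group_one i gen_A_square)
    show "pos_A n \<one>\<^bsub>sym_group n\<^esub> s" using i by (simp add: pos_A_iff sym_group_one)
    fix w assume w: "pos_A n w s"
    show "\<not> pos_A n (w \<otimes>\<^bsub>sym_group n\<^esub> s) s"
      using w i by (simp add: pos_A_iff sym_group_mult gen_A_apply)
  next
    fix w s t assume w: "w \<in> generate (sym_group n) (gens_A n)" and "s \<in> gens_A n" "t \<in> gens_A n"
      and pos: "pos_A n w s" "\<not> pos_A n (t \<otimes>\<^bsub>sym_group n\<^esub> w) s"
    then obtain i j where i: "i \<in> {1..n - 1}" "s = gen_A i" and j: "j \<in> {1..n - 1}" "t = gen_A j"
      by (auto simp: gens_A_def)
    have inj: "w x = w y \<longleftrightarrow> x = y" for x y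
      using permutes_inj[OF generate_A_permutes[OF w]] by (auto simp: inj_def)
    have "w i < w (i + 1)" "\<not> gen_A j (w i) < gen_A j (w (i + 1))"
      using pos i j by (simp_all add: pos_A_iff sym_group_mult)
    \<comment> \<open>An adjacent transposition reverses the order of one pair of values only,
      \<open>j\<close> and \<open>j + 1\<close>.\<close>
    hence wi: "w i = j" "w (i + 1) = j + 1" by (auto simp: gen_A_apply split: if_splits)
    have "gen_A j (w x) = w (gen_A i x)" for x
      using wi inj[of x i] inj[of x "i + 1"] by (auto simp: gen_A_apply)
    thus "t \<otimes>\<^bsub>sym_group n\<^esub> w = w \<otimes>\<^bsub>sym_group n\<^esub> s"
      using i j by (auto simp: sym_group_mult)
  qed
qed

section \<open>Edges and paths of type A\<close>

lemma edge_A_simps: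
  assumes "j \<in> {1..n}"
  defines "\<phi> \<equiv> (2 * real j - 1) * pi / (2 * real n)"
  shows "0 < \<phi>" "\<phi> < pi" "Re (edge_A n j) = - cos \<phi>" "Im (edge_A n j) = - sin \<phi>" "0 < sin \<phi>"
proof -
  show \<phi>: "0 < \<phi>" using assms(1) by (auto simp: \<phi>_def intro!: divide_pos_pos mult_pos_pos)
  have "(2 * real j - 1) * pi < 2 * real n * pi" using assms(1) by (intro mult_strict_right_mono) auto
  thus "\<phi> < pi" using assms(1) by (simp add: \<phi>_def field_simps)
  thus "0 < sin \<phi>" using \<phi> by (rule sin_gt_zero[rotated])
  show "Re (edge_A n j) = - cos \<phi>" "Im (edge_A n j) = - sin \<phi>"
    by (simp_all add: edge_A_def \<phi>_def)
qed

text \<open>The right-hand side minus the left-hand side is sin (\<beta> - \<alpha>), both angles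
  lying between 0 and \<pi>.\<close>

lemma edge_A_slope:
  assumes "j \<in> {1..n}" "k \<in> {1..n}" "j < k"
  shows "Re (edge_A n j) * - Im (edge_A n k) < Re (edge_A n k) * - Im (edge_A n j)"
proof -
  define \<alpha> where "\<alpha> = (2 * real j - 1) * pi / (2 * real n)"
  define \<beta> where "\<beta> = (2 * real k - 1) * pi / (2 * real n)"
  note a = edge_A_simps[OF assms(1), folded \<alpha>_def]
  note b = edge_A_simps[OF assms(2), folded \<beta>_def]
  have "\<alpha> < \<beta>" unfolding \<alpha>_def \<beta>_def using assms by (intro divide_strict_right_mono mult_strict_right_mono) auto
  hence "0 < sin (\<beta> - \<alpha>)" using a b by (intro sin_gt_zero) auto
  thus ?thesis using a b by (simp add: sin_diff mult.commute)
qed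

lemma length_path_A [simp]: "length (path_A n w) = n"
  by (simp add: path_A_def)

lemma path_A_nth: "k < n \<Longrightarrow> path_A n w ! k = edge_A n (inv' w (Suc k))"
  by (simp add: path_A_def del: upt_Suc)

text \<open>Positions start at 1 and list indices at 0, hence the swap at
  \<open>i - 1\<close>.\<close>

lemma path_A_gen:
  assumes "w permutes {1..n}" "i \<in> {1..n - 1}"
  shows "path_A n (gen_A i \<circ> w) = swp (i - 1, 1) (path_A n w)"
proof (rule nth_equalityI)
  have f: "fits (length (path_A n w)) (i - 1, 1)" using assms by (auto simp: fits_def)
  show "length (path_A n (gen_A i \<circ> w)) = length (swp (i - 1, 1) (path_A n w))"
    using f by simp
  fix k assume k: "k < length (path_A n (gen_A i \<circ> w))"
  have "inv_into UNIV (gen_A i) = gen_A i" by (simp add: gen_A_def)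
  hence inv: "inv_into UNIV (gen_A i \<circ> w) = inv' w \<circ> gen_A i"
    using o_inv_distrib[OF permutes_bij[OF gen_A_permutes[OF assms(2)]] permutes_bij[OF assms(1)]] by simp
  have k': "k < n" using k by simp
  show "path_A n (gen_A i \<circ> w) ! k = swp (i - 1, 1) (path_A n w) ! k"
    using k' assms(2) swp_nth[OF f, of k] by (auto simp: path_A_nth inv gen_A_apply)
qed

lemma blk_path_A:
  assumes "i \<in> {1..n - 1}"
  shows "\<exists>p. blk (i - 1, 1) (path_A n w) =
    (p, [edge_A n (inv' w i)], [edge_A n (inv' w (i + 1))])"
proof -
  have "i - 1 < n" "i < n" using assms by auto
  thus ?thesis using assms by (simp add: blk_def take_drop_1 path_A_nth)
qed

lemma sweep_words_A:
  assumes "2 \<le> n"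
  shows "sweep_words (sym_group n) (gens_A n) (pos_A n) (\<lambda>z. - Im z) {1..n - 1} gen_A (path_A n)
    (\<lambda>i. [(i - 1, 1)]) (\<lambda>i. (i - 1, 1)) unit_rhombi n (rels_A n) (tiling_of_A n)"
proof -
  interpret sign_group "sym_group n" "gens_A n" "pos_A n" by (rule sign_group_A)
  have edges: "inv' w i \<in> {1..n}" if "w \<in> W" "i \<in> {1..n}" for w i
    using that permutes_in_image[OF permutes_inv[OF generate_A_permutes]] by blast
  show ?thesis
  proof (unfold_locales)
    show "inj_on gen_A {1..n - 1}" using gen_A_inj by (auto simp: inj_on_def)
    show "gens_A n = gen_A ` {1..n - 1}" by (simp add: gens_A_def)
    show "0 < n" using assms by simp
    fix w assume w: "w \<in> W"
    show "length (path_A n w) = n" by simp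
    show "downward.up (path_A n w)"
      using edge_A_simps[OF edges[OF w]] by (auto simp: downward.up_def path_A_def)
    fix i assume i: "i \<in> {1..n - 1}"
    show "path_A n (gen_A i \<otimes>\<^bsub>sym_group n\<^esub> w) = swps [(i - 1, 1)] (path_A n w)"
      using path_A_gen[OF generate_A_permutes[OF w] i] by (simp add: sym_group_mult)
    assume pos: "pos_A n (inv\<^bsub>sym_group n\<^esub> w) (gen_A i)"
    define u where "u = edge_A n (inv' w i)"
    define v where "v = edge_A n (inv' w (i + 1))"
    obtain p where blk: "blk (i - 1, 1) (path_A n w) = (p, [u], [v])"
      using blk_path_A[OF i] by (auto simp: u_def v_def)
    have mem: "inv' w i \<in> {1..n}" "inv' w (i + 1) \<in> {1..n}"
      using i by (intro edges[OF w]; auto)+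
    have "inv\<^bsub>sym_group n\<^esub> w = inv' w"
      using W_closed[OF w] by (rule sym_group_inv_equality)
    hence "inv' w i < inv' w (i + 1)" using pos i by (simp add: pos_A_iff)
    hence s: "Re u * - Im v < Re v * - Im u"
      unfolding u_def v_def by (intro edge_A_slope mem)
    have uv: "0 < - Im u" "0 < - Im v" "norm u = 1" "norm v = 1"
      using edge_A_simps[OF mem(1)] edge_A_simps[OF mem(2)] by (auto simp: u_def v_def edge_A_def)
    have "downward.raises (i - 1, 1) (path_A n w)"
      unfolding downward.raises_def blk using downward.raising_rhombus[OF uv(1,2) s] by simp
    moreover have "etile (i - 1, 1) (path_A n w) \<in> unit_rhombi"
      unfolding etile_def blk using downward.rhombus_tile[OF uv(1,2) s uv(3,4)] by simp
    ultimately show "downward.asc [(i - 1, 1)] (path_A n w) \<and> etiles [(i - 1, 1)] (path_A n w) \<subseteq> unit_rhombi"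
      using i by (auto simp: fits_def)
  next
    fix i \<sigma> assume "i \<in> {1..n - 1}" "\<sigma> \<in> set [(i - 1, 1 :: nat)]"
    thus "fits n \<sigma>" by (auto simp: fits_def)
  next
    fix a b assume "{a, b} \<in> rels_A n"
    then obtain i j where ij: "{a, b} = {gen_A i, gen_A j}" "i \<in> {1..n - 1}" "j \<in> {1..n - 1}" "i + 2 \<le> j"
      unfolding rels_A_def by blast
    have g: "gen_A i \<noteq> gen_A j" using gen_A_inj[of i j] ij by auto
    have ab: "a = gen_A i \<and> b = gen_A j \<or> a = gen_A j \<and> b = gen_A i"
      using ij(1) by (auto simp: doubleton_eq_iff)
    show "a \<in> gens_A n \<and> b \<in> gens_A n \<and> a \<noteq> b \<and> a \<otimes>\<^bsub>sym_group n\<^esub> b = b \<otimes>\<^bsub>sym_group n\<^esub> a"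
      using ab ij g gen_A_commute[OF ij(4)] by (auto simp: gens_A_def sym_group_mult)
    have "indep (i - 1, 1) (j - 1, 1)" "indep (j - 1, 1) (i - 1, 1)" using ij by (auto simp: indep_def)
    thus "\<exists>i\<in>{1..n - 1}. \<exists>j\<in>{1..n - 1}. a = gen_A i \<and> b = gen_A j \<and>
      (\<forall>\<sigma>\<in>set [(i - 1, 1 :: nat)]. \<forall>\<tau>\<in>set [(j - 1, 1)]. indep \<sigma> \<tau>)"
      using ab ij(2,3) by (elim disjE conjE) (metis (no_types) empty_iff empty_set set_ConsD)+
  next
    fix i j assume ij: "i \<in> {1..n - 1}" "j \<in> {1..n - 1}" "{gen_A i, gen_A j} \<notin> rels_A n"
    have "\<not> i + 2 \<le> j" "\<not> j + 2 \<le> i" using ij by (auto simp: rels_A_def insert_commute)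
    thus "\<not> indep (i - 1, 1) (j - 1, 1)" using ij by (auto simp: indep_def)
  next
    fix i j :: nat assume "i \<in> {1..n - 1}" "j \<in> {1..n - 1}"
    thus "filter (\<lambda>c. c = (i - 1, 1 :: nat)) [(j - 1, 1)] = (if i = j then [(i - 1, 1)] else [])" by auto
  next
    fix r assume r: "r \<in> lists (gens_A n)"
    have eq: "tiles_A n i (prod_of vs) = etiles [(i - 1, 1)] (path_A n (prod_of vs))"
      if "i \<in> {1..n - 1}" "r = us @ gen_A i # vs" for us i vs
    proof -
      have vs: "vs \<in> lists (gens_A n)" using r that by auto
      have f: "fits (length (path_A n (prod_of vs))) (i - 1, 1)"
        using that by (auto simp: fits_def)
      show ?thesis
        using etile_tile_between[OF f] path_A_gen[OF generate_A_permutes[OF prod_of_W[OF vs]] that(1)]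
        by (simp add: tiles_A_def)
    qed
    thus "tiling_of_A n r = \<Union> {etiles [(i - 1, 1)] (path_A n (prod_of vs)) | us i vs.
        i \<in> {1..n - 1} \<and> r = us @ gen_A i # vs}"
      unfolding tiling_of_A_def by (intro arg_cong[where f = Union]) (metis (lifting))
  qed
qed

section \<open>Type D\<close>


text \<open>\<open>s\<^sub>i\<close> interchanges \<open>lo_D i\<close> with \<open>i\<close>, and \<open>- lo_D i\<close> with \<open>- i\<close>.\<close>

definition lo_D :: "nat \<Rightarrow> int" where
  "lo_D i = (if i = 1 then - 2 else int i - 1)"

abbreviation labels :: "nat \<Rightarrow> int set" where
  "labels n \<equiv> {- int n..int n} - {0}"

text \<open>As in type A, with \<open>lo_D i\<close> in place of the lower neighbour. For i = 1 and
  a signed permutation the condition reads 0 < w 1 + w 2, so it is positivity of the root of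
  \<open>gen_D 1\<close> under w.\<close>

definition pos_D :: "nat \<Rightarrow> (int \<Rightarrow> int) \<Rightarrow> (int \<Rightarrow> int) \<Rightarrow> bool" where
  "pos_D n w s \<longleftrightarrow> (\<forall>i\<in>{1..n}. s = gen_D i \<longrightarrow> w (lo_D i) < w (int i))"

lemma gen_D_apply:
  "1 \<le> i \<Longrightarrow> gen_D i x = (if x = lo_D i then int i else if x = int i then lo_D i
     else if x = - lo_D i then - int i else if x = - int i then - lo_D i else x)"
  by (auto simp: gen_D_def lo_D_def Transposition.transpose_def)

lemma gen_D_other: "1 \<le> i \<Longrightarrow> x \<notin> {lo_D i, int i, - lo_D i, - int i} \<Longrightarrow> gen_D i x = x"
  by (simp add: gen_D_apply)

lemma gen_D_lo: "1 \<le> i \<Longrightarrow> gen_D i (lo_D i) = int i"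
  and gen_D_hi: "1 \<le> i \<Longrightarrow> gen_D i (int i) = lo_D i"
  by (auto simp: gen_D_apply)

lemma gen_D_inj: "1 \<le> i \<Longrightarrow> 1 \<le> j \<Longrightarrow> gen_D i = gen_D j \<Longrightarrow> i = j"
proof -
  assume *: "1 \<le> i" "1 \<le> j" "gen_D i = gen_D j"
  hence "gen_D i (int i) = gen_D j (int i)" "gen_D i (int j) = gen_D j (int j)" by simp_all
  thus ?thesis using *(1,2) by (auto simp: gen_D_apply lo_D_def split: if_splits)
qed

lemma gen_D_minus: "1 \<le> i \<Longrightarrow> gen_D i (- x) = - gen_D i x"
  by (auto simp: gen_D_apply lo_D_def)

lemma gen_D_square: "1 \<le> i \<Longrightarrow> gen_D i (gen_D i x) = x"
  by (auto simp: gen_D_apply lo_D_def)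

lemma gen_D_inv: "1 \<le> i \<Longrightarrow> inv_into UNIV (gen_D i) = gen_D i"
  by (rule inv_unique_comp) (auto simp: gen_D_square)

text \<open>The two generators move disjoint sets of absolute values, \<open>M i\<close> and
  \<open>M j\<close>.\<close>

lemma gen_D_commute:
  "1 \<le> i \<Longrightarrow> i + 2 \<le> j \<Longrightarrow> (i, j) \<noteq> (1, 3) \<Longrightarrow> gen_D i \<circ> gen_D j = gen_D j \<circ> gen_D i"
proof (rule ext)
  fix x
  assume *: "1 \<le> i" "i + 2 \<le> j" "(i, j) \<noteq> (1, 3)"
  have j: "1 \<le> j" using * by simp
  define M where "M k = {\<bar>lo_D k\<bar>, int k}" for k
  have stay: "gen_D k y = y" if "1 \<le> k" "\<bar>y\<bar> \<notin> M k" for k y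
    using that by (intro gen_D_other) (auto simp: M_def)
  have supp: "\<bar>gen_D k y\<bar> \<in> M k" if "1 \<le> k" "\<bar>y\<bar> \<in> M k" for k y
    using that unfolding gen_D_apply[OF that(1)] by (auto simp: M_def)
  have disj: "M i \<inter> M j = {}" using * by (auto simp: M_def lo_D_def)
  show "(gen_D i \<circ> gen_D j) x = (gen_D j \<circ> gen_D i) x"
  proof (cases "\<bar>x\<bar> \<in> M j")
    case True
    hence "\<bar>x\<bar> \<notin> M i" "\<bar>gen_D j x\<bar> \<notin> M i" using disj supp[OF j] by auto
    thus ?thesis using stay[OF *(1)] by simp
  next
    case False
    hence "gen_D j x = x" "gen_D j (gen_D i x) = gen_D i x"
      using stay[OF j] supp[OF *(1), of x] stay[OF *(1), of x] disj by (cases "\<bar>x\<bar> \<in> M i"; auto)+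
    thus ?thesis by simp
  qed
qed

text \<open>Two opposite pairs of values take the place of the single pair reversed by an adjacent
  transposition. For j = 1 the pairs (-1, 1) and (-2, 2) and pairs with zero can be reversed too;
  the last three hypotheses exclude them.\<close>

lemma gen_D_flip:
  assumes "1 \<le> j" "c < d" "\<not> gen_D j c < gen_D j d" "c \<noteq> 0" "d \<noteq> 0" "c \<noteq> - d"
  shows "c = lo_D j \<and> d = int j \<or> c = - int j \<and> d = - lo_D j"
proof (cases "j = 1")
  case True
  hence l: "lo_D j = - 2" "int j = 1" by (auto simp: lo_D_def)
  show ?thesis using assms(2-6) unfolding gen_D_apply[OF assms(1)] l by presburger
next
  case False
  have "lo_D j = int j - 1" "1 \<le> lo_D j" using False assms(1) by (auto simp: lo_D_def)
  thus ?thesis using assms(2-6) unfolding gen_D_apply[OF assms(1)] by (smt (verit))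
qed

lemma gen_D_permutes: "3 \<le> n \<Longrightarrow> i \<in> {1..n} \<Longrightarrow> gen_D i permutes labels n"
proof -
  assume *: "3 \<le> n" "i \<in> {1..n}"
  have i: "1 \<le> i" using * by simp
  have "gen_D i x = x" if "x \<notin> labels n" for x
    using that * by (intro gen_D_other i) (auto simp: lo_D_def)
  thus ?thesis unfolding permutes_def using gen_D_square[OF i] by metis
qed

lemma pos_D_iff: "i \<in> {1..n} \<Longrightarrow> pos_D n w (gen_D i) \<longleftrightarrow> w (lo_D i) < w (int i)"
  using gen_D_inj[of i] unfolding pos_D_def by (metis atLeastAtMost_iff)

lemma signed_perms_carrier:
  "w \<in> carrier (signed_perms n) \<longleftrightarrow> w permutes labels n \<and> (\<forall>i. w (- i) = - w i)"
  by (simp add: signed_perms_def)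

lemma signed_perms_inv_minus:
  assumes "w permutes A" "\<And>i. w (- i) = - w i"
  shows "inv' w (- i) = - inv' w (i :: int)"
proof -
  have "w (- inv' w i) = - i"
    using assms(2) permutes_inverses(1)[OF assms(1)] by simp
  thus ?thesis using permutes_inverses(2)[OF assms(1)] by metis
qed

lemma group_signed_perms: "group (signed_perms n)"
proof (rule groupI)
  fix w assume w: "w \<in> carrier (signed_perms n)"
  hence "inv' w \<in> carrier (signed_perms n)"
    using permutes_inv signed_perms_inv_minus unfolding signed_perms_carrier by blast
  moreover have "inv' w \<circ> w = id"
    using w permutes_inv_o(2) by (auto simp: signed_perms_carrier)
  ultimately show "\<exists>v\<in>carrier (signed_perms n). v \<otimes>\<^bsub>signed_perms n\<^esub> w = \<one>\<^bsub>signed_perms n\<^esub>"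
    by (auto simp: signed_perms_def)
qed (auto simp: signed_perms_def permutes_compose permutes_id)

lemma gens_D_signed_perms: "3 \<le> n \<Longrightarrow> gens_D n \<subseteq> carrier (signed_perms n)"
  using gen_D_permutes gen_D_minus by (auto simp: gens_D_def signed_perms_carrier)

lemma group_D_simps [simp]: "mult (group_D n) = (\<circ>)" "one (group_D n) = id"
  by (simp_all add: group_D_def signed_perms_def)

lemma group_group_D: "3 \<le> n \<Longrightarrow> group (group_D n)"
  unfolding group_D_def
  by (rule subgroup.subgroup_is_group[OF group.generate_is_subgroup[OF group_signed_perms gens_D_signed_perms]
        group_signed_perms])

lemma gens_D_carrier: "gens_D n \<subseteq> carrier (group_D n)"
  by (auto simp: group_D_def intro: generate.incl)

lemma group_D_signed:
  assumes "3 \<le> n" "w \<in> carrier (group_D n)"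
  shows "w permutes labels n" "w (- x) = - w x"
  using group.generate_in_carrier[OF group_signed_perms gens_D_signed_perms[OF assms(1)]] assms(2)
  by (auto simp: group_D_def signed_perms_carrier)

lemma generate_D_carrier: "3 \<le> n \<Longrightarrow> w \<in> generate (group_D n) (gens_D n) \<Longrightarrow> w \<in> carrier (group_D n)"
  using group.generate_in_carrier[OF group_group_D gens_D_carrier] .

lemma group_D_inv:
  assumes "3 \<le> n" "w \<in> carrier (group_D n)" shows "inv\<^bsub>group_D n\<^esub> w = inv' w"
proof -
  interpret group "group_D n" by (rule group_group_D[OF assms(1)])
  show ?thesis using l_inv[OF assms(2)] r_inv[OF assms(2)] by (intro inv_unique_comp[symmetric]) auto
qed

lemma sign_group_D:
  assumes n: "3 \<le> n" shows "sign_group (group_D n) (gens_D n) (pos_D n)"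
proof -
  interpret group "group_D n" by (rule group_group_D[OF n])
  show ?thesis
  proof (unfold_locales)
    show "gens_D n \<subseteq> carrier (group_D n)" by (rule gens_D_carrier)
    fix s assume "s \<in> gens_D n"
    then obtain i where i: "i \<in> {1..n}" "s = gen_D i" by (auto simp: gens_D_def)
    show "s \<otimes>\<^bsub>group_D n\<^esub> s = \<one>\<^bsub>group_D n\<^esub>" using i by (auto simp: gen_D_square)
    show "pos_D n \<one>\<^bsub>group_D n\<^esub> s" using i by (simp add: pos_D_iff lo_D_def)
    fix w assume w: "pos_D n w s"
    show "\<not> pos_D n (w \<otimes>\<^bsub>group_D n\<^esub> s) s"
      using w i by (simp add: pos_D_iff gen_D_apply)
  next
    fix w s t assume w: "w \<in> generate (group_D n) (gens_D n)" and "s \<in> gens_D n" "t \<in> gens_D n"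
      and pos: "pos_D n w s" "\<not> pos_D n (t \<otimes>\<^bsub>group_D n\<^esub> w) s"
    then obtain i j where i: "i \<in> {1..n}" "s = gen_D i" and j: "j \<in> {1..n}" "t = gen_D j"
      by (auto simp: gens_D_def)
    have ij1: "1 \<le> i" "1 \<le> j" using i j by auto
    note wD = group_D_signed[OF n generate_D_carrier[OF n w]]
    have inj: "w x = w y \<longleftrightarrow> x = y" for x y using permutes_inj[OF wD(1)] by (auto simp: inj_def)
    have w0: "w 0 = 0" using wD(1) by (auto simp: permutes_def)
    have less: "w (lo_D i) < w (int i)" "\<not> gen_D j (w (lo_D i)) < gen_D j (w (int i))"
      using pos i j by (simp_all add: pos_D_iff)
    \<comment> \<open>These inequalities hold for the positions themselves, and \<open>w\<close> is
      injective and odd.\<close>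
    have "w (lo_D i) \<noteq> 0" "w (int i) \<noteq> 0" "w (lo_D i) \<noteq> - w (int i)"
      using inj[of "lo_D i" 0] inj[of "int i" 0] inj[of "lo_D i" "- int i"] w0 wD(2)[of "int i"] i
      by (auto simp: lo_D_def split: if_splits)
    hence wi: "w (lo_D i) = lo_D j \<and> w (int i) = int j \<or> w (lo_D i) = - int j \<and> w (int i) = - lo_D j"
      by (intro gen_D_flip[OF ij1(2) less])
    have "gen_D j (w x) = w (gen_D i x)" for x
    proof -
      have neg: "w (- lo_D i) = - w (lo_D i)" "w (- int i) = - w (int i)" by (rule wD(2))+
      note g = gen_D_lo[OF ij1(1)] gen_D_hi[OF ij1(1)] gen_D_lo[OF ij1(2)] gen_D_hi[OF ij1(2)]
        gen_D_minus[OF ij1(1)] gen_D_minus[OF ij1(2)]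
      consider "x = lo_D i" | "x = int i" | "x = - lo_D i" | "x = - int i" | "x \<notin> {lo_D i, int i, - lo_D i, - int i}"
        by blast
      thus ?thesis
      proof cases
        case 5
        have "w x \<notin> {w (lo_D i), w (int i), w (- lo_D i), w (- int i)}" using 5 inj by blast
        hence "w x \<notin> {lo_D j, int j, - lo_D j, - int j}" using wi unfolding neg by auto
        thus ?thesis using gen_D_other[OF ij1(1) 5] gen_D_other[OF ij1(2)] by simp
      qed (use wi neg g in auto)
    qed
    thus "t \<otimes>\<^bsub>group_D n\<^esub> w = w \<otimes>\<^bsub>group_D n\<^esub> s" using i j by auto
  qed
qed

lemma edge_D_minus: "j \<noteq> 0 \<Longrightarrow> edge_D \<theta> (- j) = - cnj (edge_D \<theta> j)"
  by (auto simp: edge_D_def complex_eq_iff)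

lemma norm_edge_D [simp]: "norm (edge_D \<theta> j) = 1"
  by (simp add: edge_D_def)

section \<open>Edges of type D\<close>

context
  fixes n :: nat and \<theta> :: "nat \<Rightarrow> real"
  assumes angles: "angles_D n \<theta>"
begin

lemma edge_D_pos:
  assumes "j \<in> {1..int n}"
  shows "Re (edge_D \<theta> j) = cos (\<theta> (nat j))" "Im (edge_D \<theta> j) = sin (\<theta> (nat j))"
    "0 < cos (\<theta> (nat j))" "0 < sin (\<theta> (nat j))" "pi / 3 < \<theta> (nat j)" "\<theta> (nat j) < pi / 2"
proof -
  have "nat j \<in> {1..n}" using assms by auto
  thus t: "pi / 3 < \<theta> (nat j)" "\<theta> (nat j) < pi / 2" using angles by (auto simp: angles_D_def)
  show "Re (edge_D \<theta> j) = cos (\<theta> (nat j))" "Im (edge_D \<theta> j) = sin (\<theta> (nat j))"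
    using assms by (auto simp: edge_D_def)
  have "0 < pi / 3" by simp
  hence "0 < \<theta> (nat j)" using t by linarith
  thus "0 < cos (\<theta> (nat j))" "0 < sin (\<theta> (nat j))"
    using t by (auto intro!: cos_gt_zero sin_gt_zero)
qed

lemma angles_D_less: "j \<in> {1..int n} \<Longrightarrow> k \<in> {1..int n} \<Longrightarrow> j < k \<Longrightarrow> \<theta> (nat k) < \<theta> (nat j)"
proof -
  assume "j \<in> {1..int n}" "k \<in> {1..int n}" "j < k"
  hence "nat j \<in> {1..n}" "nat k \<in> {1..n}" "nat j < nat k" by auto
  thus ?thesis using angles unfolding angles_D_def by blast
qed

lemma edge_D_height: "j \<in> labels n \<Longrightarrow> 0 < Im (edge_D \<theta> j)"
proof (cases "0 < j")
  case False
  assume "j \<in> labels n"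
  hence "- j \<in> {1..int n}" using False by auto
  thus ?thesis using edge_D_pos[of "- j"] edge_D_minus[of "- j" \<theta>] False by auto
qed (use edge_D_pos in auto)

lemma edge_D_Re: "j \<in> labels n \<Longrightarrow> 0 < Re (edge_D \<theta> j) \<longleftrightarrow> 0 < j"
  and edge_D_Re_neg: "j \<in> labels n \<Longrightarrow> Re (edge_D \<theta> j) < 0 \<longleftrightarrow> j < 0"
proof -
  have "0 < Re (edge_D \<theta> j) \<and> 0 < j \<or> Re (edge_D \<theta> j) < 0 \<and> j < 0" if "j \<in> labels n"
  proof (cases "0 < j")
    case False
    hence "- j \<in> {1..int n}" using that by auto
    thus ?thesis using edge_D_pos[of "- j"] edge_D_minus[of "- j" \<theta>] False that by auto
  qed (use edge_D_pos that in auto)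
  thus "j \<in> labels n \<Longrightarrow> 0 < Re (edge_D \<theta> j) \<longleftrightarrow> 0 < j"
    "j \<in> labels n \<Longrightarrow> Re (edge_D \<theta> j) < 0 \<longleftrightarrow> j < 0" by auto
qed

text \<open>The two sides differ by the sine of the difference of the angles, and angles decrease as
  labels grow.\<close>

lemma edge_D_slope_pos:
  assumes "j \<in> {1..int n}" "k \<in> {1..int n}" "j < k"
  shows "Re (edge_D \<theta> j) * Im (edge_D \<theta> k) < Re (edge_D \<theta> k) * Im (edge_D \<theta> j)"
proof -
  note j = edge_D_pos[OF assms(1)] and k = edge_D_pos[OF assms(2)]
  have "0 < sin (\<theta> (nat j) - \<theta> (nat k))"
    using angles_D_less[OF assms] j(5,6) k(5,6) by (intro sin_gt_zero) auto
  thus ?thesis by (simp add: j(1,2) k(1,2) sin_diff mult.commute)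
qed

text \<open>Larger labels lean further to the right. Reflection in a vertical line reduces two
  negative labels to positive ones and reverses their order.\<close>

lemma edge_D_slope:
  assumes "j \<in> labels n" "k \<in> labels n" "j < k"
  shows "Re (edge_D \<theta> j) * Im (edge_D \<theta> k) < Re (edge_D \<theta> k) * Im (edge_D \<theta> j)"
proof -
  consider "0 < j" | "j < 0" "0 < k" | "k < 0" using assms by force
  thus ?thesis
  proof cases
    case 1
    thus ?thesis using assms by (intro edge_D_slope_pos) auto
  next
    case 2
    have "Re (edge_D \<theta> j) < 0" "0 < Re (edge_D \<theta> k)"
      using 2 edge_D_Re edge_D_Re_neg assms by auto
    hence "Re (edge_D \<theta> j) * Im (edge_D \<theta> k) < 0" "0 < Re (edge_D \<theta> k) * Im (edge_D \<theta> j)"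
      using edge_D_height assms by (auto intro!: mult_neg_pos mult_pos_pos)
    thus ?thesis by linarith
  next
    case 3
    have "Re (edge_D \<theta> (- k)) * Im (edge_D \<theta> (- j)) < Re (edge_D \<theta> (- j)) * Im (edge_D \<theta> (- k))"
      using 3 assms by (intro edge_D_slope_pos) auto
    thus ?thesis using 3 assms by (simp add: edge_D_minus)
  qed
qed

text \<open>Angles above \<open>\<pi>/4\<close> suffice here: \<open>sin\<close> decreases on the interval from \<open>\<theta>\<^sub>j + \<theta>\<^sub>k\<close> to \<open>2 \<theta>\<^sub>j\<close>.\<close>

lemma edge_D_gap_neg:
  assumes "j \<in> {1..int n}" "k \<in> {1..int n}" "j < k"
  shows "gap_ok (edge_D \<theta> (- j)) (edge_D \<theta> k)"
proof -
  note j = edge_D_pos[OF assms(1)] and k = edge_D_pos[OF assms(2)]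
  define \<alpha> where "\<alpha> = \<theta> (nat j)"
  define \<beta> where "\<beta> = \<theta> (nat k)"
  have ab: "\<beta> < \<alpha>" "pi / 3 < \<beta>" "\<alpha> < pi / 2"
    using angles_D_less[OF assms] j k by (auto simp: \<alpha>_def \<beta>_def)
  have "sin \<beta> \<le> sin \<alpha>" using ab by (intro sin_monotone_2pi_le) auto
  moreover have "cos \<alpha> < cos \<beta>" using ab by (intro cos_monotone_0_pi) auto
  moreover have "sin (2 * \<alpha>) < sin (\<alpha> + \<beta>)"
  proof -
    have "cos (\<alpha> + \<beta> - pi / 2) > cos (2 * \<alpha> - pi / 2)" using ab by (intro cos_monotone_0_pi) auto
    thus ?thesis by (simp add: cos_diff)
  qed
  hence "2 * sin \<alpha> * cos \<alpha> < sin \<alpha> * cos \<beta> + cos \<alpha> * sin \<beta>" by (simp add: sin_double sin_add)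
  ultimately show ?thesis
    using assms(1) j k by (simp add: gap_ok_def edge_D_minus \<alpha>_def \<beta>_def algebra_simps)
qed

text \<open>With a positive sum at most one label is negative, and it has the smaller absolute
  value, as \<open>edge_D_gap_neg\<close> requires.\<close>

lemma edge_D_gap:
  assumes "j \<in> labels n" "k \<in> labels n" "0 < j + k"
  shows "gap_ok (edge_D \<theta> j) (edge_D \<theta> k) \<or> gap_ok (edge_D \<theta> k) (edge_D \<theta> j)"
proof -
  consider "0 < j" "0 < k" | "j < 0" | "k < 0" using assms by force
  thus ?thesis
  proof cases
    case 1
    thus ?thesis using edge_D_Re assms by (simp add: gap_ok_def)
  next
    case 2
    thus ?thesis using edge_D_gap_neg[of "- j" k] assms by auto
  next
    case 3
    thus ?thesis using edge_D_gap_neg[of "- k" j] assms by auto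
  qed
qed

end

section \<open>Paths and tiles of type D\<close>

lemma swp_nth_1:
  assumes "fits (length ds) (a, 1)" "j < length ds"
  shows "swp (a, 1) ds ! j = ds ! (if j = a then a + 1 else if j = a + 1 then a else j)"
  using swp_nth[OF assms] by (cases "j = a"; cases "j = a + 1") auto

lemma gap_ok_sum: "gap_ok u v \<or> gap_ok v u \<Longrightarrow> 0 < Re (u + v)"
  by (auto simp: gap_ok_def)

lemma length_positions_D: "length (positions_D n) = 2 * n"
  by (simp add: positions_D_def)

lemma length_path_D [simp]: "length (path_D n \<theta> w) = 2 * n"
  by (simp add: path_D_def length_positions_D)

lemma positions_D_nth: "k < 2 * n \<Longrightarrow> positions_D n ! k = (if k < n then int k - int n else int k - int n + 1)"
  by (auto simp: positions_D_def nth_append)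

lemma path_D_nth:
  "k < 2 * n \<Longrightarrow> path_D n \<theta> w ! k = edge_D \<theta> (inv' w (if k < n then int k - int n else int k - int n + 1))"
  using nth_map[of k "positions_D n"] by (simp add: path_D_def positions_D_nth length_positions_D)

text \<open>For i = 1 the positions -2, -1 and 1, 2 are interchanged as blocks, which is the reason
  for admitting swaps of blocks. For i \<ge> 2 the first swap acts in the lower half of the path and
  the second in the upper half.\<close>

definition steps_D :: "nat \<Rightarrow> nat \<Rightarrow> (nat \<times> nat) list" where
  "steps_D n i = (if i = 1 then [(n - 2, 2)] else [(n - i, 1), (n + i - 2, 1)])"

text \<open>For i \<ge> 2 the swap in the upper half represents the letter. The block swap for 1
  covers the indices n - 2 to n + 1, so it overlaps the representatives of 2 and 3, the other
  letters not related to 1 in \<open>rels_D\<close>.\<close>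

definition top_D :: "nat \<Rightarrow> nat \<Rightarrow> nat \<times> nat" where
  "top_D n i = (if i = 1 then (n - 2, 2) else (n + i - 2, 1))"

lemma steps_D_fit: "3 \<le> n \<Longrightarrow> i \<in> {1..n} \<Longrightarrow> \<sigma> \<in> set (steps_D n i) \<Longrightarrow> fits (2 * n) \<sigma>"
  by (auto simp: steps_D_def fits_def split: if_splits)

text \<open>Entry by entry, \<open>g\<close> is the index from which the swaps fetch the edge that
  ends up at index \<open>k\<close>. It has to name the image under \<open>gen_D i\<close> of the
  position of \<open>k\<close>; the two cases in the position arise because 0 is skipped.\<close>

lemma path_D_gen:
  assumes "3 \<le> n" "w \<in> carrier (group_D n)" "i \<in> {1..n}"
  shows "path_D n \<theta> (gen_D i \<circ> w) = swps (steps_D n i) (path_D n \<theta> w)"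
proof (rule nth_equalityI)
  have i: "1 \<le> i" using assms by simp
  have fit: "fits (length (path_D n \<theta> w)) \<sigma>" if "\<sigma> \<in> set (steps_D n i)" for \<sigma>
    using steps_D_fit[OF assms(1,3) that] by simp
  show "length (path_D n \<theta> (gen_D i \<circ> w)) = length (swps (steps_D n i) (path_D n \<theta> w))"
    using length_swps[OF fit, of "steps_D n i"] by simp
  fix k assume "k < length (path_D n \<theta> (gen_D i \<circ> w))"
  hence k: "k < 2 * n" by simp
  have "inv_into UNIV (gen_D i \<circ> w) = inv' w \<circ> gen_D i"
    using o_inv_distrib[OF permutes_bij[OF gen_D_permutes[OF assms(1,3)]]
        permutes_bij[OF group_D_signed(1)[OF assms(1,2)]]] gen_D_inv[OF i] by simp
  hence lhs: "path_D n \<theta> (gen_D i \<circ> w) ! k =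
    edge_D \<theta> (inv' w (gen_D i (if k < n then int k - int n else int k - int n + 1)))"
    using k by (simp add: path_D_nth)
  show "path_D n \<theta> (gen_D i \<circ> w) ! k = swps (steps_D n i) (path_D n \<theta> w) ! k"
  proof (cases "i = 1")
    case True
    have f: "fits (length (path_D n \<theta> w)) (n - 2, 2)" using assms by (auto simp: fits_def)
    define g where "g = (if n - 2 \<le> k \<and> k < n then k + 2 else if n \<le> k \<and> k < n + 2 then k - 2 else k)"
    have g: "g < 2 * n" using k assms by (auto simp: g_def)
    have "swp (n - 2, 2) (path_D n \<theta> w) ! k = path_D n \<theta> w ! g"
      using swp_nth[OF f, of k] k assms by (auto simp: g_def)
    moreover have "gen_D i (if k < n then int k - int n else int k - int n + 1) =
      (if g < n then int g - int n else int g - int n + 1)"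
    proof -
      consider "k + 2 < n" | "k = n - 2" | "k = n - 1" | "k = n" | "k = n + 1" | "n + 1 < k" using assms by linarith
      thus ?thesis unfolding gen_D_apply[OF i] unfolding lo_D_def True
        by cases (use assms in \<open>simp_all add: g_def of_nat_diff\<close>)
    qed
    ultimately show ?thesis unfolding lhs using True g by (simp add: steps_D_def path_D_nth)
  next
    case False
    have i2: "2 \<le> i" "i \<le> n" using i False assms by auto
    define l where "l = n - i"
    define u where "u = n + i - 2"
    have lu: "l + 1 < u" "u + 1 < 2 * n" "l < n" "int l = int n - int i" "n \<le> u" "int u = int n + int i - 2"
      using i2 by (auto simp: l_def u_def)
    have f: "fits (length (path_D n \<theta> w)) (l, 1)" "fits (length (swp (l, 1) (path_D n \<theta> w))) (u, 1)"
      using lu by (auto simp: fits_def)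
    define m where "m = (if k = u then u + 1 else if k = u + 1 then u else k)"
    define g where "g = (if k = l then l + 1 else if k = l + 1 then l else m)"
    have m: "m < length (path_D n \<theta> w)" and g: "g < 2 * n" using k lu by (auto simp: m_def g_def)
    have "swp (u, 1) (swp (l, 1) (path_D n \<theta> w)) ! k = swp (l, 1) (path_D n \<theta> w) ! m"
      using swp_nth_1[OF f(2), of k] length_swp[OF f(1)] k by (simp add: m_def)
    also have "\<dots> = path_D n \<theta> w ! (if m = l then l + 1 else if m = l + 1 then l else m)"
      by (rule swp_nth_1[OF f(1) m])
    also have "(if m = l then l + 1 else if m = l + 1 then l else m) = g"
      using lu(1) by (auto simp: m_def g_def)
    finally have "swp (u, 1) (swp (l, 1) (path_D n \<theta> w)) ! k = path_D n \<theta> w ! g" .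
    moreover have "gen_D i (if k < n then int k - int n else int k - int n + 1) =
      (if g < n then int g - int n else int g - int n + 1)"
    proof -
      have lo: "lo_D i = int i - 1" using i2 by (simp add: lo_D_def)
      consider "k = l" | "k = l + 1" | "k = u" | "k = u + 1" | "k \<notin> {l, l + 1, u, u + 1}" by blast
      thus ?thesis
      proof cases
        case 1
        hence "g = l + 1" by (simp add: g_def)
        moreover have "gen_D i (- int i) = - lo_D i" using gen_D_minus[OF i] gen_D_hi[OF i] by simp
        ultimately show ?thesis using 1 lu i2 lo by auto
      next
        case 2
        hence "g = l" by (simp add: g_def)
        moreover have "gen_D i (- lo_D i) = - int i" using gen_D_minus[OF i] gen_D_lo[OF i] by simp
        ultimately show ?thesis using 2 lu i2 lo by auto
      next
        case 3
        hence "g = u + 1" using lu by (simp add: g_def m_def)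
        thus ?thesis using 3 lu i2 lo gen_D_lo[OF i] by auto
      next
        case 4
        hence "g = u" using lu by (simp add: g_def m_def)
        thus ?thesis using 4 lu i2 lo gen_D_hi[OF i] by auto
      next
        case 5
        hence "g = k" by (simp add: g_def m_def)
        moreover have "(if k < n then int k - int n else int k - int n + 1) \<notin> {lo_D i, int i, - lo_D i, - int i}"
          using 5 i2 lu unfolding lo by (auto split: if_splits)
        ultimately show ?thesis using gen_D_other[OF i] by simp
      qed
    qed
    ultimately show ?thesis unfolding lhs using False g
      by (simp add: steps_D_def path_D_nth flip: l_def u_def)
  qed
qed

lemma blk_1: "Suc a < length ds \<Longrightarrow> \<exists>p. blk (a, 1) ds = (p, [ds ! a], [ds ! Suc a])"
  by (simp add: blk_def take_drop_1)

lemma blk_2: "a + 3 < length ds \<Longrightarrow>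
    \<exists>p. blk (a, 2) ds = (p, [ds ! a, ds ! (a + 1)], [ds ! (a + 2), ds ! (a + 3)])"
  by (simp add: blk_def take_drop_2 numeral_3_eq_3)

text \<open>\<open>tiles_D\<close> bounds both rhombi by the paths before and after the whole
  letter, while a sweep performs the swaps one at a time. As they are independent, each tile has the
  same blocks either way.\<close>

lemma tiles_D_etiles:
  assumes "3 \<le> n" "w \<in> carrier (group_D n)" "i \<in> {1..n}"
  shows "tiles_D n \<theta> i w = etiles (steps_D n i) (path_D n \<theta> w)"
proof -
  let ?ds = "path_D n \<theta> w"
  have es: "path_D n \<theta> (gen_D i \<circ> w) = swps (steps_D n i) ?ds" by (rule path_D_gen[OF assms])
  show ?thesis
  proof (cases "i = 1")
    case True
    have f: "fits (length ?ds) (n - 2, 2)" using assms by (auto simp: fits_def)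
    show ?thesis using True es etile_tile_between[OF f] by (simp add: tiles_D_def steps_D_def)
  next
    case False
    let ?L = "(n - i, 1 :: nat)" and ?U = "(n + i - 2, 1 :: nat)"
    have f: "fits (length ?ds) ?L" "fits (length ?ds) ?U" "indep ?L ?U" "indep ?U ?L"
      using assms False by (auto simp: fits_def indep_def)
    have f': "fits (length (swp ?L ?ds)) ?L" "fits (length (swp ?L ?ds)) ?U"
      using f by simp_all
    have es': "path_D n \<theta> (gen_D i \<circ> w) = swp ?U (swp ?L ?ds)" using es False by (simp add: steps_D_def)
    have "tile_between ?ds (swp ?U (swp ?L ?ds)) (n - i) (2 * 1) = tile_between ?ds (swp ?L ?ds) (n - i) (2 * 1)"
      using blk_swp[OF f'(1,2) f(3)] by (intro tile_between_cong) simp_all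
    moreover have "tile_between ?ds (swp ?U (swp ?L ?ds)) (n + i - 2) (2 * 1) =
        tile_between (swp ?L ?ds) (swp ?U (swp ?L ?ds)) (n + i - 2) (2 * 1)"
      using blk_swp[OF f(2,1,4)] by (intro tile_between_cong) simp_all
    ultimately show ?thesis
      using False es' etile_tile_between[OF f(1)] etile_tile_between[OF f'(2)]
      by (simp add: tiles_D_def steps_D_def Let_def)
  qed
qed

text \<open>In terms of the labels at the moved positions, an ascent for i = 1 means 0 < a + b, the
  hypothesis of \<open>edge_D_gap\<close>. For i \<ge> 2 it means a < b and so also - b < - a,
  whence both rhombi are swept to the right.\<close>

lemma ascend_D:
  assumes n: "3 \<le> n" and ang: "angles_D n \<theta>" and w: "w \<in> carrier (group_D n)" and i: "i \<in> {1..n}"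
    and pos: "inv' w (lo_D i) < inv' w (int i)"
  shows "upward.asc (steps_D n i) (path_D n \<theta> w) \<and>
    etiles (steps_D n i) (path_D n \<theta> w) \<subseteq> unit_rhombi \<union> megatiles"
proof -
  let ?ds = "path_D n \<theta> w"
  define v where "v = inv' w"
  note wD = group_D_signed[OF n w]
  have vm: "v (- x) = - v x" for x unfolding v_def by (rule signed_perms_inv_minus[OF wD])
  have vmem: "v x \<in> labels n" if "x \<in> labels n" for x
    using that permutes_in_image[OF permutes_inv[OF wD(1)]] unfolding v_def by blast
  have v0: "v x \<noteq> 0" if "x \<in> labels n" for x using vmem[OF that] by blast
  have vinj: "v x = v y \<longleftrightarrow> x = y" for x y
    using permutes_inj[OF permutes_inv[OF wD(1)]] unfolding v_def by (auto simp: inj_def)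
  have nth: "?ds ! k = edge_D \<theta> (v (if k < n then int k - int n else int k - int n + 1))" if "k < 2 * n" for k
    unfolding v_def using that by (rule path_D_nth)
  show ?thesis
  proof (cases "i = 1")
    case True
    define a where "a = v 1"
    define b where "b = v 2"
    have mem: "a \<in> labels n" "b \<in> labels n"
      unfolding a_def b_def using n by (intro vmem; simp)+
    have ab: "0 < a + b" using pos True vm[of 2] by (simp add: lo_D_def a_def b_def v_def)
    have abne: "a \<noteq> b" using vinj by (simp add: a_def b_def)
    define x where "x = edge_D \<theta> a"
    define y where "y = edge_D \<theta> b"
    have e: "edge_D \<theta> (- a) = - cnj x" "edge_D \<theta> (- b) = - cnj y"
      using mem edge_D_minus by (auto simp: x_def y_def)
    obtain p where "blk (n - 2, 2) ?ds = (p, [?ds ! (n - 2), ?ds ! (n - 2 + 1)], [?ds ! (n - 2 + 2), ?ds ! (n - 2 + 3)])"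
      using blk_2[of "n - 2" ?ds] n by auto
    moreover have "?ds ! (n - 2) = - cnj y" "?ds ! (n - 2 + 1) = - cnj x" "?ds ! (n - 2 + 2) = x" "?ds ! (n - 2 + 3) = y"
    proof -
      have k: "n - 2 < 2 * n" "n - 2 + 1 < 2 * n" "n - 2 + 2 < 2 * n" "n - 2 + 3 < 2 * n" using n by auto
      have "(if n - 2 < n then int (n - 2) - int n else int (n - 2) - int n + 1) = - 2"
        "(if n - 2 + 1 < n then int (n - 2 + 1) - int n else int (n - 2 + 1) - int n + 1) = - 1"
        "(if n - 2 + 2 < n then int (n - 2 + 2) - int n else int (n - 2 + 2) - int n + 1) = 1"
        "(if n - 2 + 3 < n then int (n - 2 + 3) - int n else int (n - 2 + 3) - int n + 1) = 2"
        using n by auto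
      thus "?ds ! (n - 2) = - cnj y" "?ds ! (n - 2 + 1) = - cnj x" "?ds ! (n - 2 + 2) = x" "?ds ! (n - 2 + 3) = y"
        using nth[OF k(1)] nth[OF k(2)] nth[OF k(3)] nth[OF k(4)] e vm[of 1] vm[of 2]
        by (simp_all only: a_def[symmetric] b_def[symmetric] x_def[symmetric] y_def[symmetric])
    qed
    ultimately have blk: "blk (n - 2, 2) ?ds = (p, [- cnj y, - cnj x], [x, y])" by simp
    have im: "0 < Im x" "0 < Im y" using edge_D_height[OF ang] mem by (auto simp: x_def y_def)
    have gap: "gap_ok x y \<or> gap_ok y x" unfolding x_def y_def by (rule edge_D_gap[OF ang mem ab])
    have r: "upward.raising [- cnj y, - cnj x] [x, y]" by (rule raising_megatile[OF im gap])
    have re: "Re x \<noteq> 0" "Re y \<noteq> 0"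
      using edge_D_Re[OF ang mem(1)] edge_D_Re_neg[OF ang mem(1)] edge_D_Re[OF ang mem(2)]
        edge_D_Re_neg[OF ang mem(2)] mem by (auto simp: x_def y_def)
    have "x \<noteq> y"
    proof
      assume "x = y"
      thus False using edge_D_slope[OF ang mem] edge_D_slope[OF ang mem(2,1)] abne
        by (cases "a < b") (auto simp: x_def y_def)
    qed
    hence "etile (n - 2, 2) ?ds \<in> megatiles"
      using megatile_tile[OF im r _ _ re _ gap_ok_sum[OF gap]] by (simp add: etile_def blk x_def y_def)
    moreover have "upward.raises (n - 2, 2) ?ds" using r by (simp add: upward.raises_def blk)
    ultimately show ?thesis using True n by (simp add: steps_D_def fits_def)
  next
    case False
    hence i2: "2 \<le> i" "i \<le> n" using i by auto
    let ?L = "(n - i, 1 :: nat)" and ?U = "(n + i - 2, 1 :: nat)"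
    have f: "fits (length ?ds) ?L" "fits (length ?ds) ?U" "indep ?L ?U" "indep ?U ?L"
      using i2 by (auto simp: fits_def indep_def)
    define a where "a = v (int i - 1)"
    define b where "b = v (int i)"
    have mem: "a \<in> labels n" "b \<in> labels n"
      unfolding a_def b_def using i2 by (intro vmem; simp)+
    have mem': "- b \<in> labels n" "- a \<in> labels n" using mem by auto
    have ab: "a < b" using pos False by (simp add: lo_D_def a_def b_def v_def)
    have k: "n - i < 2 * n" "Suc (n - i) < 2 * n" "n + i - 2 < 2 * n" "Suc (n + i - 2) < 2 * n" using i2 by auto
    have "(if n - i < n then int (n - i) - int n else int (n - i) - int n + 1) = - int i"
      "(if Suc (n - i) < n then int (Suc (n - i)) - int n else int (Suc (n - i)) - int n + 1) = - (int i - 1)"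
      "(if n + i - 2 < n then int (n + i - 2) - int n else int (n + i - 2) - int n + 1) = int i - 1"
      "(if Suc (n + i - 2) < n then int (Suc (n + i - 2)) - int n else int (Suc (n + i - 2)) - int n + 1) = int i"
      using i2 by auto
    hence e: "?ds ! (n - i) = edge_D \<theta> (- b)" "?ds ! Suc (n - i) = edge_D \<theta> (- a)"
      "?ds ! (n + i - 2) = edge_D \<theta> a" "?ds ! Suc (n + i - 2) = edge_D \<theta> b"
      using nth[OF k(1)] nth[OF k(2)] nth[OF k(3)] nth[OF k(4)] vm[of "int i"] vm[of "int i - 1"]
      by (simp_all only: a_def[symmetric] b_def[symmetric])
    obtain p q where blk: "blk ?L ?ds = (p, [edge_D \<theta> (- b)], [edge_D \<theta> (- a)])"
      "blk ?U ?ds = (q, [edge_D \<theta> a], [edge_D \<theta> b])"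
      using blk_1[of "n - i" ?ds] blk_1[of "n + i - 2" ?ds] k e by auto
    have tile: "upward.raising [edge_D \<theta> c] [edge_D \<theta> d]"
      "polygon p [edge_D \<theta> c, edge_D \<theta> d] [edge_D \<theta> d, edge_D \<theta> c] \<in> unit_rhombi"
      if "c \<in> labels n" "d \<in> labels n" "c < d" for p c d
      using edge_D_slope[OF ang that] edge_D_height[OF ang that(1)] edge_D_height[OF ang that(2)]
      by (auto intro: upward.raising_rhombus upward.rhombus_tile)
    have L: "upward.raises ?L ?ds" "etile ?L ?ds \<in> unit_rhombi"
      unfolding upward.raises_def etile_def blk using tile[OF mem'] ab by simp_all
    have U: "upward.raises ?U ?ds" "etile ?U ?ds \<in> unit_rhombi"
      unfolding upward.raises_def etile_def blk using tile[OF mem] ab by simp_all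
    \<comment> \<open>The second swap acts on the path left by the first, from which it is
      independent.\<close>
    have "upward.raises ?U (swp ?L ?ds)" using U(1) upward.raises_swp[OF f(2,1,4)] by simp
    moreover have "etile ?U (swp ?L ?ds) = etile ?U ?ds" using blk_swp[OF f(2,1,4)] by (simp add: etile_def)
    moreover have "fits (length (swp ?L ?ds)) ?U" using f by simp
    ultimately show ?thesis using L U f(1) False by (simp add: steps_D_def)
  qed
qed

lemma rels_D_I:
  "i \<in> {1..n} \<Longrightarrow> j \<in> {1..n} \<Longrightarrow> i + 2 \<le> j \<Longrightarrow> (i, j) \<noteq> (1, 3) \<Longrightarrow> {gen_D i, gen_D j} \<in> rels_D n"
  unfolding rels_D_def mem_Collect_eq by (rule exI[of _ i], rule exI[of _ j]) simp

lemma sweep_words_D: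
  assumes n: "3 \<le> n" and ang: "angles_D n \<theta>"
  shows "sweep_words (group_D n) (gens_D n) (pos_D n) Im {1..n} gen_D (path_D n \<theta>)
    (steps_D n) (top_D n) (unit_rhombi \<union> megatiles) (2 * n) (rels_D n) (tiling_of_D n \<theta>)"
proof -
  interpret sign_group "group_D n" "gens_D n" "pos_D n" by (rule sign_group_D[OF n])
  note carr = generate_D_carrier[OF n]
  show ?thesis
  proof (unfold_locales)
    show "inj_on gen_D {1..n}" using gen_D_inj by (auto simp: inj_on_def)
    show "gens_D n = gen_D ` {1..n}" by (simp add: gens_D_def)
    show "0 < 2 * n" using n by simp
    fix w assume w: "w \<in> W"
    show "length (path_D n \<theta> w) = 2 * n" by simp
    show "upward.up (path_D n \<theta> w)"
      unfolding upward.up_def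
    proof
      fix d assume "d \<in> set (path_D n \<theta> w)"
      then obtain x where x: "x \<in> set (positions_D n)" "d = edge_D \<theta> (inv' w x)"
        by (auto simp: path_D_def)
      have "x \<in> labels n" using x(1) by (auto simp: positions_D_def)
      hence "inv' w x \<in> labels n"
        using permutes_in_image[OF permutes_inv[OF group_D_signed(1)[OF n carr[OF w]]]] by blast
      thus "0 < Im d" using edge_D_height[OF ang] x(2) by simp
    qed
    fix i assume i: "i \<in> {1..n}"
    show "path_D n \<theta> (gen_D i \<otimes>\<^bsub>group_D n\<^esub> w) = swps (steps_D n i) (path_D n \<theta> w)"
      using path_D_gen[OF n carr[OF w] i] by simp
    assume "pos_D n (inv\<^bsub>group_D n\<^esub> w) (gen_D i)"
    hence "inv' w (lo_D i) < inv' w (int i)"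
      using i by (simp add: pos_D_iff group_D_inv[OF n carr[OF w]])
    thus "upward.asc (steps_D n i) (path_D n \<theta> w) \<and>
        etiles (steps_D n i) (path_D n \<theta> w) \<subseteq> unit_rhombi \<union> megatiles"
      by (rule ascend_D[OF n ang carr[OF w] i])
  next
    fix i \<sigma> assume "i \<in> {1..n}" "\<sigma> \<in> set (steps_D n i)"
    thus "fits (2 * n) \<sigma>" by (rule steps_D_fit[OF n])
  next
    fix a b assume "{a, b} \<in> rels_D n"
    then obtain i j where ij: "{a, b} = {gen_D i, gen_D j}" "i \<in> {1..n}" "j \<in> {1..n}" "i + 2 \<le> j" "(i, j) \<noteq> (1, 3)"
      unfolding rels_D_def mem_Collect_eq by (elim exE conjE)
    have g: "gen_D i \<noteq> gen_D j"
    proof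
      assume "gen_D i = gen_D j"
      hence "i = j" by (rule gen_D_inj[rotated 2]) (use ij(2,3) in simp_all)
      thus False using ij(4) by simp
    qed
    have ab: "a = gen_D i \<and> b = gen_D j \<or> a = gen_D j \<and> b = gen_D i"
      using ij(1) by (auto simp: doubleton_eq_iff)
    have "gen_D i \<circ> gen_D j = gen_D j \<circ> gen_D i" using ij by (intro gen_D_commute) auto
    thus "a \<in> gens_D n \<and> b \<in> gens_D n \<and> a \<noteq> b \<and> a \<otimes>\<^bsub>group_D n\<^esub> b = b \<otimes>\<^bsub>group_D n\<^esub> a"
      using ab ij(2,3) g by (auto simp: gens_D_def)
    have "\<forall>\<sigma>\<in>set (steps_D n i). \<forall>\<tau>\<in>set (steps_D n j). indep \<sigma> \<tau>"
      using ij by (auto simp: steps_D_def indep_def)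
    moreover from this have "\<forall>\<tau>\<in>set (steps_D n j). \<forall>\<sigma>\<in>set (steps_D n i). indep \<tau> \<sigma>"
      using indep_sym by blast
    ultimately show "\<exists>i\<in>{1..n}. \<exists>j\<in>{1..n}. a = gen_D i \<and> b = gen_D j \<and>
      (\<forall>\<sigma>\<in>set (steps_D n i). \<forall>\<tau>\<in>set (steps_D n j). indep \<sigma> \<tau>)"
      using ab ij(2,3) by blast
  next
    fix i j assume ij: "i \<in> {1..n}" "j \<in> {1..n}" "{gen_D i, gen_D j} \<notin> rels_D n"
    have "\<not> (i + 2 \<le> j \<and> (i, j) \<noteq> (1, 3))" using rels_D_I[OF ij(1,2)] ij(3) by metis
    moreover have "\<not> (j + 2 \<le> i \<and> (j, i) \<noteq> (1, 3))"
      using rels_D_I[OF ij(2,1)] ij(3) by (metis insert_commute)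
    ultimately show "\<not> indep (top_D n i) (top_D n j)" using ij(1,2) n by (cases "i = 1"; cases "j = 1") (auto simp: indep_def top_D_def)
  next
    fix i j assume ij: "i \<in> {1..n}" "j \<in> {1..n}"
    have "n + i - 2 \<noteq> n - j \<and> (n + i - 2 = n + j - 2 \<longleftrightarrow> i = j)" if "i \<noteq> 1" "j \<noteq> 1"
      using ij that n by auto
    thus "filter (\<lambda>c. c = top_D n i) (steps_D n j) = (if i = j then [top_D n i] else [])"
      by (cases "i = 1"; cases "j = 1") (auto simp: top_D_def steps_D_def)
  next
    fix r assume r: "r \<in> lists (gens_D n)"
    have eq: "tiles_D n \<theta> i (prod_of vs) = etiles (steps_D n i) (path_D n \<theta> (prod_of vs))"
      if "i \<in> {1..n}" "r = us @ gen_D i # vs" for us i vs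
    proof -
      have vs: "vs \<in> lists (gens_D n)" using r that by auto
      show ?thesis by (rule tiles_D_etiles[OF n carr[OF prod_of_W[OF vs]] that(1)])
    qed
    thus "tiling_of_D n \<theta> r = \<Union> {etiles (steps_D n i) (path_D n \<theta> (prod_of vs)) | us i vs.
        i \<in> {1..n} \<and> r = us @ gen_D i # vs}"
      unfolding tiling_of_D_def by (intro arg_cong[where f = Union]) (metis (lifting))
  qed
qed

theorem theorem1p1:
  shows
    "(\<forall>n \<Sigma> e.
        n \<ge> 2 \<and> admissible_partition (sym_group n) (gens_A n) e \<Sigma> \<longrightarrow>
        (\<forall>x \<in> carrier (block_group (sym_group n) e \<Sigma>).
           \<exists>f. bij_betw f
             (word_classes (block_group (sym_group n) e \<Sigma>) (block_gens (sym_group n) e \<Sigma>)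
                (block_relations (sym_group n) e (rels_A n) \<Sigma>) x)
             (consistent_tilings (sym_group n) (gens_A n) (rels_A n) e \<Sigma>
                (tilings_A n) (tiling_of_A n) x)))
     \<and>
     (\<forall>n \<theta> \<Sigma> e.
        n \<ge> 3 \<and> angles_D n \<theta> \<and> admissible_partition (group_D n) (gens_D n) e \<Sigma> \<longrightarrow>
        (\<forall>x \<in> carrier (block_group (group_D n) e \<Sigma>).
           \<exists>f. bij_betw f
             (word_classes (block_group (group_D n) e \<Sigma>) (block_gens (group_D n) e \<Sigma>)
                (block_relations (group_D n) e (rels_D n) \<Sigma>) x)
             (consistent_tilings (group_D n) (gens_D n) (rels_D n) e \<Sigma>
                (tilings_D n \<theta>) (tiling_of_D n \<theta>) x)))"
proof (intro conjI allI impI ballI)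
  fix n :: nat and \<Sigma> e x
  assume "n \<ge> 2 \<and> admissible_partition (sym_group n) (gens_A n) e \<Sigma>"
    and x: "x \<in> carrier (block_group (sym_group n) e \<Sigma>)"
  hence n: "2 \<le> n" and adm: "admissible_partition (sym_group n) (gens_A n) e \<Sigma>" by auto
  \<comment> \<open>The left side of the polygon is the path of the neutral element of the
    group.\<close>
  have "tilings_A n = (\<lambda>w. tilings_by unit_rhombi 0 (path_A n \<one>\<^bsub>sym_group n\<^esub>) (path_A n w))"
    by (simp add: fun_eq_iff tilings_A_def sym_group_one)
  thus "\<exists>f. bij_betw f
      (word_classes (block_group (sym_group n) e \<Sigma>) (block_gens (sym_group n) e \<Sigma>)
         (block_relations (sym_group n) e (rels_A n) \<Sigma>) x)
      (consistent_tilings (sym_group n) (gens_A n) (rels_A n) e \<Sigma> (tilings_A n) (tiling_of_A n) x)"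
    using sweep_words.word_classes_bij[OF sweep_words_A[OF n] adm x] by simp
next
  fix n :: nat and \<theta> \<Sigma> e x
  assume "n \<ge> 3 \<and> angles_D n \<theta> \<and> admissible_partition (group_D n) (gens_D n) e \<Sigma>"
    and x: "x \<in> carrier (block_group (group_D n) e \<Sigma>)"
  hence n: "3 \<le> n" and ang: "angles_D n \<theta>" and adm: "admissible_partition (group_D n) (gens_D n) e \<Sigma>"
    by auto
  have "tilings_D n \<theta> = (\<lambda>w. tilings_by (unit_rhombi \<union> megatiles) 0 (path_D n \<theta> \<one>\<^bsub>group_D n\<^esub>) (path_D n \<theta> w))"
    by (simp add: fun_eq_iff tilings_D_def)
  thus "\<exists>f. bij_betw f
      (word_classes (block_group (group_D n) e \<Sigma>) (block_gens (group_D n) e \<Sigma>)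
         (block_relations (group_D n) e (rels_D n) \<Sigma>) x)
      (consistent_tilings (group_D n) (gens_D n) (rels_D n) e \<Sigma> (tilings_D n \<theta>) (tiling_of_D n \<theta>) x)"
    using sweep_words.word_classes_bij[OF sweep_words_D[OF n ang] adm x] by simp
qed

end
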